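(* Let $c\in\{-1,1\}$ and let $M$ be a biconservative hypersurface in $R^{n+1}(c)$ with mean curvature $H$, where $\nabla H$ vanishes nowhere and $H>0$. Let $m\in M$ and, if $c=-1$, assume further that $H(m)\neq 2/n$. Put $e_1=\nabla H/|\nabla H|$, let $D$ be the (integrable) distribution on $M$ orthogonal to $e_1$, let $\hat M$ be an integral submanifold of $D$ passing through $m$, and let $\Theta(t_1,\dots,t_{n-1})$ be a local parametrization of $\hat M$. Then there exists a neighbourhood $\mathcal N_m$ of $m$ in $M$ such that, for any parallel orthonormal base $\{\xi_1,\xi_2,\xi_3\}$ of the normal space of $\hat M$ in $E(n+1,c)$, $\mathcal N_m$ can be parametrized as $$x(s,t_1,\dots,t_{n-1})=\Theta(t_1,\dots,t_{n-1})+\alpha_1(s)\xi_1(t_1,\dots,t_{n-1})+\alpha_2(s)\xi_2(t_1,\dots,t_{n-1})+\alpha_3(s)\xi_3(t_1,\dots,t_{n-1})$$ for some smooth functions $\alpha_1,\alpha_2,\alpha_3$. Furthermore, the slices $t_1=\text{constant},\dots,t_{n-1}=\text{constant}$ are integral curves of $e_1$.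
   Context: $\mathbb E^m_s$ denotes $\mathbb R^m$ with the metric $-\sum_{i=1}^s dx_i^2+\sum_{j=s+1}^m dx_j^2$, and $\mathbb E^m=\mathbb E^m_0$. Put $R^{n+1}(1)=\mathbb S^{n+1}=\{x\in\mathbb E^{n+2}:\langle x,x\rangle=1\}$ with $E(n+1,1)=\mathbb E^{n+2}$, and $R^{n+1}(-1)=\mathbb H^{n+1}=\{x\in\mathbb E^{n+2}_1:\langle x,x\rangle=-1\}$ with $E(n+1,-1)=\mathbb E^{n+2}_1$. Hypersurfaces are smooth and connected, and $x:M\to E(n+1,c)$ denotes the position vector. For an oriented hypersurface $M^n\subset R^{n+1}(c)$ with unit normal $N$ and Levi-Civita connection $\widetilde\nabla$ of $R^{n+1}(c)$, the shape operator is $S(X)=-\widetilde\nabla_XN$, and the mean curvature $H$ is defined by $nH=\operatorname{tr}S$. $M$ is biconservative if the tangential part of the bitension field of its immersion vanishes; equivalently, $S(\nabla H)+\frac{nH}{2}\nabla H=0$. Orthonormality in $E(n+1,-1)$ is meant with respect to the Lorentzian metric (vectors of square norm $\pm1$); parallel means parallel with respect to the normal connection of $\hat M$ in $E(n+1,c)$. *)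

theory Defs
  imports "HOL-Analysis.Analysis"
begin

section \<open>Smooth maps and immersed manifolds\<close>

primrec Ck_on :: "nat \<Rightarrow> 'a::real_normed_vector set \<Rightarrow> ('a \<Rightarrow> 'b::real_normed_vector) \<Rightarrow> bool" where
  "Ck_on 0 U f \<longleftrightarrow> continuous_on U f"
| "Ck_on (Suc k) U f \<longleftrightarrow> (\<forall>u\<in>U. f differentiable (at u)) \<and>
     (\<forall>v. Ck_on k U (\<lambda>u. frechet_derivative f (at u) v))"

text \<open>Only used for open \<^term>\<open>U\<close>.\<close>
definition smooth_on :: "'a::real_normed_vector set \<Rightarrow> ('a \<Rightarrow> 'b::real_normed_vector) \<Rightarrow> bool" where
  "smooth_on U f \<longleftrightarrow> (\<forall>k. Ck_on k U f)"

text \<open>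
  A manifold immersed in a Euclidean space \<^typ>\<open>'e\<close> is a topological space \<^term>\<open>M\<close> with a map
  \<^term>\<open>x\<close> (the position vector).  A local parametrization is a homeomorphism \<^term>\<open>\<phi>\<close> from an
  open set of the parameter space onto an open subset of \<^term>\<open>M\<close> such that \<open>x \<circ> \<phi>\<close> is a smooth
  immersion.  No compatibility condition between parametrizations is needed: any two are related by
  a homeomorphism which is smooth, because \<open>x \<circ> \<phi>\<close> is locally an embedding.  An embedded
  submanifold is the case where \<^term>\<open>x\<close> is the identity.
\<close>
definition local_param ::
  "'m::topological_space set \<Rightarrow> ('m \<Rightarrow> 'e::euclidean_space) \<Rightarrow> 'p::euclidean_space set \<Rightarrow> ('p \<Rightarrow> 'm) \<Rightarrow> bool"
where
  "local_param M x U \<phi> \<longleftrightarrow> open U \<and> openin (top_of_set M) (\<phi> ` U) \<and>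
     (\<exists>\<psi>. homeomorphism U (\<phi> ` U) \<phi> \<psi>) \<and> smooth_on U (x \<circ> \<phi>) \<and>
     (\<forall>u\<in>U. inj (frechet_derivative (x \<circ> \<phi>) (at u)))"

text \<open>The first argument fixes the parameter space, and hence the dimension.\<close>
definition immersed_manifold ::
  "'p::euclidean_space itself \<Rightarrow> 'm::topological_space set \<Rightarrow> ('m \<Rightarrow> 'e::euclidean_space) \<Rightarrow> bool"
where
  "immersed_manifold _ M x \<longleftrightarrow>
     (\<forall>p\<in>M. \<exists>(U :: 'p set) \<phi>. local_param M x U \<phi> \<and> p \<in> \<phi> ` U)"

definition smooth_map ::
  "'p::euclidean_space itself \<Rightarrow> 'm::topological_space set \<Rightarrow> ('m \<Rightarrow> 'e::euclidean_space) \<Rightarrow>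
   ('m \<Rightarrow> 'b::real_normed_vector) \<Rightarrow> bool"
where
  "smooth_map _ M x f \<longleftrightarrow> (\<forall>(U :: 'p set) \<phi>. local_param M x U \<phi> \<longrightarrow> smooth_on U (f \<circ> \<phi>))"

text \<open>Tangent vectors at \<^term>\<open>p\<close> are identified with their images under the differential of
  \<^term>\<open>x\<close>, i.e. with the velocities of \<open>x \<circ> \<gamma>\<close> for smooth curves \<^term>\<open>\<gamma>\<close> in \<^term>\<open>M\<close> through \<^term>\<open>p\<close>.\<close>
definition tangent_curve ::
  "'m::topological_space set \<Rightarrow> ('m \<Rightarrow> 'e::euclidean_space) \<Rightarrow> 'm \<Rightarrow> 'e \<Rightarrow> (real \<Rightarrow> 'm) \<Rightarrow> bool"
where
  "tangent_curve M x p v \<gamma> \<longleftrightarrow> \<gamma> 0 = p \<and>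
     (\<exists>\<epsilon>>0. \<gamma> ` {-\<epsilon><..<\<epsilon>} \<subseteq> M \<and> continuous_on {-\<epsilon><..<\<epsilon>} \<gamma> \<and> smooth_on {-\<epsilon><..<\<epsilon>} (x \<circ> \<gamma>)) \<and>
     (x \<circ> \<gamma> has_vector_derivative v) (at 0)"

definition tangent_space ::
  "'m::topological_space set \<Rightarrow> ('m \<Rightarrow> 'e::euclidean_space) \<Rightarrow> 'm \<Rightarrow> 'e set"
where
  "tangent_space M x p = {v. \<exists>\<gamma>. tangent_curve M x p v \<gamma>}"

text \<open>The derivative \<open>v(f)\<close> at \<^term>\<open>p\<close> of a function on \<^term>\<open>M\<close> along a tangent vector \<^term>\<open>v\<close>.\<close>
definition dir_deriv ::
  "'m::topological_space set \<Rightarrow> ('m \<Rightarrow> 'e::euclidean_space) \<Rightarrow> ('m \<Rightarrow> 'b::real_normed_vector) \<Rightarrow>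
   'm \<Rightarrow> 'e \<Rightarrow> 'b"
where
  "dir_deriv M x f p v =
     (THE d. \<forall>\<gamma>. tangent_curve M x p v \<gamma> \<longrightarrow> (f \<circ> \<gamma> has_vector_derivative d) (at 0))"

section \<open>Space forms\<close>

text \<open>
  \<open>E(n+1,c)\<close> is \<^typ>\<open>real \<times> (real^'d)\<close> with \<^term>\<open>CARD('d) = n + 1\<close>; the first coordinate carries
  the sign \<^term>\<open>c\<close>.  So \<open>ip 1\<close> is the Euclidean inner product, \<open>ip (-1)\<close> is the Lorentzian one.
\<close>
definition ip :: "real \<Rightarrow> real \<times> (real^'d) \<Rightarrow> real \<times> (real^'d) \<Rightarrow> real" where
  "ip c v w = c * (fst v * fst w) + snd v \<bullet> snd w"

definition space_form :: "real \<Rightarrow> (real \<times> (real^'d)) set" where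
  "space_form c = {y. ip c y y = c}"

definition space_form_tangent :: "real \<Rightarrow> real \<times> (real^'d) \<Rightarrow> (real \<times> (real^'d)) set" where
  "space_form_tangent c y = {v. ip c v y = 0}"

text \<open>Orthogonal projection onto a subspace \<^term>\<open>V\<close> on which \<^term>\<open>ip c\<close> is nondegenerate.\<close>
definition orth_proj ::
  "real \<Rightarrow> (real \<times> (real^'d)) set \<Rightarrow> real \<times> (real^'d) \<Rightarrow> real \<times> (real^'d)"
where
  "orth_proj c V w = (THE v. v \<in> V \<and> (\<forall>u\<in>V. ip c (w - v) u = 0))"

section \<open>Oriented hypersurfaces\<close>

definition hypersurface ::
  "'p::euclidean_space itself \<Rightarrow> real \<Rightarrow> 'm::topological_space set \<Rightarrow> ('m \<Rightarrow> real \<times> (real^'d)) \<Rightarrow> bool"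
where
  "hypersurface P c M x \<longleftrightarrow> immersed_manifold P M x \<and> connected M \<and> x ` M \<subseteq> space_form c"

definition unit_normal ::
  "'p::euclidean_space itself \<Rightarrow> real \<Rightarrow> 'm::topological_space set \<Rightarrow> ('m \<Rightarrow> real \<times> (real^'d)) \<Rightarrow>
   ('m \<Rightarrow> real \<times> (real^'d)) \<Rightarrow> bool"
where
  "unit_normal P c M x N \<longleftrightarrow> smooth_map P M x N \<and>
     (\<forall>p\<in>M. N p \<in> space_form_tangent c (x p) \<and> ip c (N p) (N p) = 1 \<and>
            (\<forall>v\<in>tangent_space M x p. ip c (N p) v = 0))"

text \<open>The Levi-Civita connection of the space form is the part of the flat derivative of the ambient
  space which is tangent to the space form.\<close>
definition shape_op ::
  "real \<Rightarrow> 'm::topological_space set \<Rightarrow> ('m \<Rightarrow> real \<times> (real^'d)) \<Rightarrow> ('m \<Rightarrow> real \<times> (real^'d)) \<Rightarrow>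
   'm \<Rightarrow> real \<times> (real^'d) \<Rightarrow> real \<times> (real^'d)"
where
  "shape_op c M x N p v =
     - orth_proj c (space_form_tangent c (x p)) (dir_deriv M x N p v)"

definition trace_on :: "'e::euclidean_space set \<Rightarrow> ('e \<Rightarrow> 'e) \<Rightarrow> real" where
  "trace_on V A =
     (let B = (SOME B. independent B \<and> span B = V) in \<Sum>b\<in>B. representation B (A b) b)"

definition mean_curvature ::
  "nat \<Rightarrow> real \<Rightarrow> 'm::topological_space set \<Rightarrow> ('m \<Rightarrow> real \<times> (real^'d)) \<Rightarrow>
   ('m \<Rightarrow> real \<times> (real^'d)) \<Rightarrow> 'm \<Rightarrow> real"
where
  "mean_curvature n c M x N p = trace_on (tangent_space M x p) (shape_op c M x N p) / real n"

definition grad ::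
  "real \<Rightarrow> 'm::topological_space set \<Rightarrow> ('m \<Rightarrow> real \<times> (real^'d)) \<Rightarrow> ('m \<Rightarrow> real) \<Rightarrow>
   'm \<Rightarrow> real \<times> (real^'d)"
where
  "grad c M x f p = (THE v. v \<in> tangent_space M x p \<and>
     (\<forall>w\<in>tangent_space M x p. ip c v w = dir_deriv M x f p w))"

definition unit_grad ::
  "real \<Rightarrow> 'm::topological_space set \<Rightarrow> ('m \<Rightarrow> real \<times> (real^'d)) \<Rightarrow> ('m \<Rightarrow> real) \<Rightarrow>
   'm \<Rightarrow> real \<times> (real^'d)"
where
  "unit_grad c M x f p =
     (let g = grad c M x f p in (1 / sqrt (ip c g g)) *\<^sub>R g)"

text \<open>The equation is the vanishing of the tangential part of the bitension field.\<close>
definition biconservative ::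
  "nat \<Rightarrow> real \<Rightarrow> 'm::topological_space set \<Rightarrow> ('m \<Rightarrow> real \<times> (real^'d)) \<Rightarrow>
   ('m \<Rightarrow> real \<times> (real^'d)) \<Rightarrow> bool"
where
  "biconservative n c M x N \<longleftrightarrow>
     (\<forall>p\<in>M. let H = mean_curvature n c M x N; g = grad c M x H p
            in shape_op c M x N p g + (real n * H p / 2) *\<^sub>R g = 0)"

section \<open>Integral submanifolds, parallel normal frames, integral curves\<close>

definition orth_distribution ::
  "real \<Rightarrow> 'm::topological_space set \<Rightarrow> ('m \<Rightarrow> real \<times> (real^'d)) \<Rightarrow> ('m \<Rightarrow> real \<times> (real^'d)) \<Rightarrow>
   'm \<Rightarrow> (real \<times> (real^'d)) set"
where
  "orth_distribution c M x e p = {v \<in> tangent_space M x p. ip c v (e p) = 0}"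

text \<open>For \<open>D = orth_distribution c M x (unit_grad c M x f)\<close> the function \<^term>\<open>f\<close> is locally constant
  on integral manifolds, so these are open in a regular level set of \<^term>\<open>f\<close> if connected; the
  subspace topology used here is then the only possible one.\<close>
definition integral_submanifold ::
  "'q::euclidean_space itself \<Rightarrow> 'm::topological_space set \<Rightarrow> ('m \<Rightarrow> 'e::euclidean_space) \<Rightarrow>
   ('m \<Rightarrow> 'e set) \<Rightarrow> 'm set \<Rightarrow> bool"
where
  "integral_submanifold Q M x D L \<longleftrightarrow> L \<subseteq> M \<and> immersed_manifold Q L x \<and>
     (\<forall>p\<in>L. tangent_space L x p = D p)"

definition normal_space ::
  "real \<Rightarrow> 'm::topological_space set \<Rightarrow> ('m \<Rightarrow> real \<times> (real^'d)) \<Rightarrow> 'm \<Rightarrow> (real \<times> (real^'d)) set"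
where
  "normal_space c L x p = {w. \<forall>v\<in>tangent_space L x p. ip c w v = 0}"

text \<open>Covariant derivative, for the normal connection of \<^term>\<open>L\<close> in \<open>E(n+1,c)\<close>, of a normal field
  \<^term>\<open>\<xi>\<close> along a parametrization \<^term>\<open>\<Theta>\<close> of \<^term>\<open>L\<close>, in the direction of \<open>D(x \<circ> \<Theta>)(t)h\<close>.\<close>
definition normal_deriv ::
  "real \<Rightarrow> 'm::topological_space set \<Rightarrow> ('m \<Rightarrow> real \<times> (real^'d)) \<Rightarrow> ('q::euclidean_space \<Rightarrow> 'm) \<Rightarrow>
   ('q \<Rightarrow> real \<times> (real^'d)) \<Rightarrow> 'q \<Rightarrow> 'q \<Rightarrow> real \<times> (real^'d)"
where
  "normal_deriv c L x \<Theta> \<xi> t h =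
     (let w = frechet_derivative \<xi> (at t) h in w - orth_proj c (tangent_space L x (\<Theta> t)) w)"

definition parallel_orthonormal_normal_base ::
  "real \<Rightarrow> 'm::topological_space set \<Rightarrow> ('m \<Rightarrow> real \<times> (real^'d)) \<Rightarrow> 'q::euclidean_space set \<Rightarrow>
   ('q \<Rightarrow> 'm) \<Rightarrow> (3 \<Rightarrow> 'q \<Rightarrow> real \<times> (real^'d)) \<Rightarrow> bool"
where
  "parallel_orthonormal_normal_base c L x U \<Theta> \<xi> \<longleftrightarrow>
     (\<forall>i. smooth_on U (\<xi> i)) \<and>
     (\<forall>t\<in>U. span (range (\<lambda>i. \<xi> i t)) = normal_space c L x (\<Theta> t) \<and>
            (\<forall>i. \<bar>ip c (\<xi> i t) (\<xi> i t)\<bar> = 1) \<and>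
            (\<forall>i j. i \<noteq> j \<longrightarrow> ip c (\<xi> i t) (\<xi> j t) = 0) \<and>
            (\<forall>i h. normal_deriv c L x \<Theta> (\<xi> i) t h = 0))"

definition integral_curve ::
  "'m::topological_space set \<Rightarrow> ('m \<Rightarrow> 'e::euclidean_space) \<Rightarrow> ('m \<Rightarrow> 'e) \<Rightarrow> real set \<Rightarrow>
   (real \<Rightarrow> 'm) \<Rightarrow> bool"
where
  "integral_curve M x e I \<gamma> \<longleftrightarrow> \<gamma> ` I \<subseteq> M \<and> continuous_on I \<gamma> \<and>
     (\<forall>s\<in>I. (x \<circ> \<gamma> has_vector_derivative e (\<gamma> s)) (at s))"

end

theory Submission
  imports Defs
begin

text \<open>
  The curves of \<open>e\<^sub>1\<close> are geodesics of \<open>M\<close>: by the Codazzi equation their tangential acceleration \<open>Z\<close>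
  satisfies \<open>S Z = - (n H / 2) Z\<close>, and differentiating this relation along \<open>e\<^sub>1\<close> gives \<open>e\<^sub>1(H) |Z|\<^sup>2 = 0\<close>.
  Hence the frame \<open>(e\<^sub>1, N, x)\<close> solves a linear system along each such curve with coefficients depending only
  on \<open>H\<close>.  The symmetry of the Hessian of \<open>H\<close> shows that \<open>|\<nabla>H|\<close> is constant on the level sets of \<open>H\<close>, so
  \<open>H\<close> is the same function of arclength on all curves starting from the leaf, and \<open>x\<close> on such a curve is a
  combination of \<open>e\<^sub>1\<close>, \<open>N\<close>, \<open>x\<close> at its starting point with coefficients depending only on \<open>s\<close>.  Along the
  leaf these three fields are normal and parallel, so they have constant coefficients in any parallel
  orthonormal base.

  The flow of \<open>e\<^sub>1\<close> is not obtained from the theory of differential equations but as the inverse of an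
  explicit map: one integral curve gives arclength as a function of \<open>H\<close>, and undoing the motion of the frame
  along that curve sends each point to the foot of its own curve on the leaf.
\<close>

section \<open>Smooth functions\<close>

text \<open>All computations take place in one chart, with flat ambient derivatives of
  \<open>X\<close>, \<open>Nu\<close> and \<open>e\<close>. The Codazzi equation is then the
  symmetry of the second derivatives of \<open>X\<close> and \<open>Nu\<close>, combined with
  derivatives of constant scalar products. With k = nH/2 and S = -dN the frame equations along a
  curve of \<open>e\<close> are e' = -k N - c x, N' = k e, x' = e. They are skew for
  \<open>ip c\<close>, so the linear map carrying the frame of one curve to that of another is
  constant in time as long as H agrees on both. This is used twice: to define the foot of a point
  before any flow is known, and to express the finished flow by the curve through one point of the
  leaf. A flow requires smooth dependence on the initial point, whereas the contraction principle
  gives single solutions. The inverse function theorem supplies the dependence: time and foot are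
  smooth functions of the point, their derivative sends e1 to (1, 0), and the inverse map therefore
  has the curves of e1 as coordinate lines.\<close>

abbreviation FD :: "('a::real_normed_vector \<Rightarrow> 'b::real_normed_vector) \<Rightarrow> 'a \<Rightarrow> 'a \<Rightarrow> 'b"
  where "FD f u \<equiv> frechet_derivative f (at u)"

lemma FD_eqI: "(f has_derivative f') (at u) \<Longrightarrow> FD f u = f'"
  by (metis frechet_derivative_at)

lemma FD_worksD: "f differentiable (at u) \<Longrightarrow> (f has_derivative FD f u) (at u)"
  by (simp add: frechet_derivative_works[symmetric])

lemma FD_cong_open:
  assumes "open U" "u \<in> U" "\<And>z. z \<in> U \<Longrightarrow> f z = g z"
  shows "FD f u = FD g u"
proof -
  have "(f has_derivative d) (at u) \<longleftrightarrow> (g has_derivative d) (at u)" for d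
    using assms by (metis has_derivative_transform_within_open)
  then show ?thesis
    unfolding frechet_derivative_def by simp
qed

section \<open>Closure properties of smooth maps\<close>

lemma Ck_on_subset: "Ck_on k U f \<Longrightarrow> V \<subseteq> U \<Longrightarrow> Ck_on k V f"
proof (induction k arbitrary: f)
  case 0
  then show ?case by (auto intro: continuous_on_subset)
qed auto

lemma Ck_on_cong:
  assumes "open U" "\<And>u. u \<in> U \<Longrightarrow> f u = g u" "Ck_on k U f"
  shows "Ck_on k U g"
  using assms(2,3)
proof (induction k arbitrary: f g)
  case 0
  then show ?case by (metis Ck_on.simps(1) continuous_on_cong)
next
  case (Suc k)
  have "g differentiable (at u)" if "u \<in> U" for u
    using Suc.prems that assms(1) unfolding differentiable_def Ck_on.simps
    by (metis has_derivative_transform_within_open)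
  moreover have "Ck_on k U (\<lambda>u. FD g u v)" for v
  proof (rule Suc.IH[of "\<lambda>u. FD f u v"])
    show "FD f u v = FD g u v" if "u \<in> U" for u
      by (rule fun_cong[OF FD_cong_open[OF assms(1) that]]) (rule Suc.prems(1))
  qed (use Suc.prems in auto)
  ultimately show ?case by simp
qed

lemma Ck_on_SucD: "Ck_on (Suc k) U f \<Longrightarrow> Ck_on k U f"
proof (induction k arbitrary: f)
  case 0
  then show ?case
    by (auto intro!: differentiable_imp_continuous_on simp: differentiable_on_def
        differentiable_at_withinI)
qed auto

lemma Ck_on_const: "Ck_on k U (\<lambda>u. c)"
  by (induction k arbitrary: c) auto

lemma Ck_on_linear: "bounded_linear f \<Longrightarrow> Ck_on k U f"
proof (cases k)
  case 0
  then show "bounded_linear f \<Longrightarrow> ?thesis" by (simp add: linear_continuous_on)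
next
  case (Suc j)
  assume f: "bounded_linear f"
  then have "FD f u = f" for u
    by (intro FD_eqI bounded_linear_imp_has_derivative)
  then show ?thesis
    unfolding Suc using f by (simp add: Ck_on_const bounded_linear_imp_differentiable)
qed

lemma Ck_on_add:
  assumes "open U" "Ck_on k U p" "Ck_on k U q"
  shows "Ck_on k U (\<lambda>u. p u + q u)"
  using assms(2,3)
proof (induction k arbitrary: p q)
  case 0
  then show ?case by (simp add: continuous_on_add)
next
  case (Suc k)
  have d: "((\<lambda>u. p u + q u) has_derivative (\<lambda>v. FD p u v + FD q u v)) (at u)" if "u \<in> U" for u
    using Suc.prems that by (auto intro!: has_derivative_add FD_worksD)
  have "Ck_on k U (\<lambda>u. FD (\<lambda>u. p u + q u) u v)" for v
    by (rule Ck_on_cong[OF \<open>open U\<close> _ Suc.IH[of "\<lambda>u. FD p u v" "\<lambda>u. FD q u v"]])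
      (use Suc.prems FD_eqI[OF d] in auto)
  with d show ?case by (auto simp: differentiable_def)
qed

lemma Ck_on_bilinear:
  assumes B: "bounded_bilinear B" and "open U" "Ck_on k U f" "Ck_on k U g"
  shows "Ck_on k U (\<lambda>u. B (f u) (g u))"
  using assms(3,4)
proof (induction k arbitrary: f g)
  case 0
  then show ?case
    by (simp add: bounded_bilinear.continuous_on[OF B])
next
  case (Suc k)
  have d: "((\<lambda>u. B (f u) (g u)) has_derivative (\<lambda>v. B (f u) (FD g u v) + B (FD f u v) (g u))) (at u)"
    if "u \<in> U" for u
    using Suc.prems that by (auto intro!: bounded_bilinear.FDERIV[OF B] FD_worksD)
  have "Ck_on k U (\<lambda>u. FD (\<lambda>u. B (f u) (g u)) u v)" for v
  proof (rule Ck_on_cong[OF \<open>open U\<close> _ Ck_on_add[OF \<open>open U\<close>, of _ "\<lambda>u. B (f u) (FD g u v)" "\<lambda>u. B (FD f u v) (g u)"]])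
    show "Ck_on k U (\<lambda>u. B (f u) (FD g u v))" "Ck_on k U (\<lambda>u. B (FD f u v) (g u))"
      using Suc.prems Ck_on_SucD by (auto intro!: Suc.IH)
  qed (use FD_eqI[OF d] in auto)
  with d show ?case by (auto simp: differentiable_def)
qed

lemma Ck_on_scaleR:
  "open U \<Longrightarrow> Ck_on k U f \<Longrightarrow> Ck_on k U g \<Longrightarrow> Ck_on k U (\<lambda>u. f u *\<^sub>R g u)"
  by (rule Ck_on_bilinear[OF bounded_bilinear_scaleR])

lemma Ck_on_mult:
  "open U \<Longrightarrow> Ck_on k U f \<Longrightarrow> Ck_on k U g \<Longrightarrow> Ck_on k U (\<lambda>u. f u * g u::real)"
  by (rule Ck_on_bilinear[OF bounded_bilinear_mult])

lemma Ck_on_inner: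
  "open U \<Longrightarrow> Ck_on k U f \<Longrightarrow> Ck_on k U g \<Longrightarrow> Ck_on k U (\<lambda>u. f u \<bullet> g u)"
  by (rule Ck_on_bilinear[OF bounded_bilinear_inner])

lemma Ck_on_bounded_linear:
  assumes "bounded_linear L" "open U" "Ck_on k U f"
  shows "Ck_on k U (\<lambda>u. L (f u))"
  using assms(3)
proof (induction k arbitrary: f)
  case 0
  then show ?case by (simp add: bounded_linear.continuous_on[OF assms(1)])
next
  case (Suc k)
  have d: "((\<lambda>u. L (f u)) has_derivative (\<lambda>v. L (FD f u v))) (at u)" if "u \<in> U" for u
    using Suc.prems that by (auto intro!: bounded_linear.has_derivative[OF assms(1)] FD_worksD)
  have "Ck_on k U (\<lambda>u. FD (\<lambda>u. L (f u)) u v)" for v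
    by (rule Ck_on_cong[OF \<open>open U\<close> _ Suc.IH[of "\<lambda>u. FD f u v"]])
      (use Suc.prems FD_eqI[OF d] in auto)
  with d show ?case by (auto simp: differentiable_def)
qed

lemma Ck_on_sum:
  assumes "open U" "\<And>i. i \<in> I \<Longrightarrow> Ck_on k U (f i)"
  shows "Ck_on k U (\<lambda>u. \<Sum>i\<in>I. f i u)"
  using assms(2)
  by (induction I rule: infinite_finite_induct) (auto intro!: Ck_on_const Ck_on_add assms(1))

text \<open>\<open>Ck_on\<close> controls derivatives in fixed directions. This expansion reduces a
  derivative applied to a varying vector, as in the chain rule or in
  \<open>smooth_on_FD_var\<close>, to finitely many fixed directions.\<close>

lemma linear_basis_expand:
  fixes f :: "'a::euclidean_space \<Rightarrow> 'b::real_vector"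
  assumes "linear f"
  shows "f v = (\<Sum>b\<in>Basis. (v \<bullet> b) *\<^sub>R f b)"
  by (metis (no_types, lifting) assms euclidean_representation linear_scale linear_sum sum.cong)

lemma FD_linear: "f differentiable (at u) \<Longrightarrow> linear (FD f u)"
  by (simp add: linear_frechet_derivative)

lemma Ck_on_compose:
  fixes g :: "'b::euclidean_space \<Rightarrow> 'c::real_normed_vector"
  assumes "open U" "open V" "f ` U \<subseteq> V" "Ck_on k U f" "Ck_on k V g"
  shows "Ck_on k U (\<lambda>u. g (f u))"
  using assms(4,5)
proof (induction k arbitrary: g)
  case 0
  then show ?case using assms(3) by (auto intro: continuous_on_compose2)
next
  case (Suc k)
  have d: "((\<lambda>u. g (f u)) has_derivative (\<lambda>v. FD g (f u) (FD f u v))) (at u)" if "u \<in> U" for u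
    using Suc.prems that assms(3) by (intro has_derivative_compose[of f _ u UNIV g] FD_worksD) auto
  have "Ck_on k U (\<lambda>u. FD (\<lambda>u. g (f u)) u v)" for v
  proof (rule Ck_on_cong[OF \<open>open U\<close>])
    show "Ck_on k U (\<lambda>u. \<Sum>b\<in>Basis. (FD f u v \<bullet> b) *\<^sub>R FD g (f u) b)"
      using Suc.prems Ck_on_SucD[OF Suc.prems(1)]
      by (intro Ck_on_sum Ck_on_scaleR Ck_on_inner Ck_on_const Suc.IH) (auto simp: assms)
    fix u assume u: "u \<in> U"
    then have "g differentiable (at (f u))" using Suc.prems assms(3) by auto
    then show "(\<Sum>b\<in>Basis. (FD f u v \<bullet> b) *\<^sub>R FD g (f u) b) = FD (\<lambda>u. g (f u)) u v"
      using FD_eqI[OF d[OF u]] linear_basis_expand[OF FD_linear] by metis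
  qed
  with d show ?case by (auto simp: differentiable_def)
qed

lemma smooth_on_subset: "smooth_on U f \<Longrightarrow> V \<subseteq> U \<Longrightarrow> smooth_on V f"
  by (auto simp: smooth_on_def intro: Ck_on_subset)

lemma smooth_on_cong:
  "open U \<Longrightarrow> (\<And>u. u \<in> U \<Longrightarrow> f u = g u) \<Longrightarrow> smooth_on U f \<Longrightarrow> smooth_on U g"
  by (auto simp: smooth_on_def intro: Ck_on_cong)

lemma smooth_on_const: "smooth_on U (\<lambda>u. c)"
  by (auto simp: smooth_on_def intro: Ck_on_const)

lemma smooth_on_linear: "bounded_linear f \<Longrightarrow> smooth_on U f"
  by (auto simp: smooth_on_def intro: Ck_on_linear)

lemma smooth_on_add:
  "open U \<Longrightarrow> smooth_on U f \<Longrightarrow> smooth_on U g \<Longrightarrow> smooth_on U (\<lambda>u. f u + g u)"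
  by (auto simp: smooth_on_def intro: Ck_on_add)

lemma smooth_on_sum:
  "open U \<Longrightarrow> (\<And>i. i \<in> I \<Longrightarrow> smooth_on U (f i)) \<Longrightarrow> smooth_on U (\<lambda>u. \<Sum>i\<in>I. f i u)"
  by (auto simp: smooth_on_def intro: Ck_on_sum)

lemma smooth_on_scaleR:
  "open U \<Longrightarrow> smooth_on U f \<Longrightarrow> smooth_on U g \<Longrightarrow> smooth_on U (\<lambda>u. f u *\<^sub>R g u)"
  by (auto simp: smooth_on_def intro: Ck_on_scaleR)

lemma smooth_on_mult:
  "open U \<Longrightarrow> smooth_on U f \<Longrightarrow> smooth_on U g \<Longrightarrow> smooth_on U (\<lambda>u. f u * g u::real)"
  by (auto simp: smooth_on_def intro: Ck_on_mult)

lemma smooth_on_inner: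
  "open U \<Longrightarrow> smooth_on U f \<Longrightarrow> smooth_on U g \<Longrightarrow> smooth_on U (\<lambda>u. f u \<bullet> g u)"
  by (auto simp: smooth_on_def intro: Ck_on_inner)

lemma smooth_on_bounded_linear:
  "bounded_linear L \<Longrightarrow> open U \<Longrightarrow> smooth_on U f \<Longrightarrow> smooth_on U (\<lambda>u. L (f u))"
  by (auto simp: smooth_on_def intro: Ck_on_bounded_linear)

lemma smooth_on_diff:
  assumes "open U" "smooth_on U f" "smooth_on U g"
  shows "smooth_on U (\<lambda>u. f u - g u)"
  using smooth_on_add[OF assms(1,2) smooth_on_bounded_linear[OF _ assms(1,3), of uminus]]
  by (simp add: bounded_linear_minus[OF bounded_linear_ident])

lemma smooth_on_Pair:
  assumes "open U" "smooth_on U f" "smooth_on U g"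
  shows "smooth_on U (\<lambda>u. (f u, g u))"
proof -
  have "smooth_on U (\<lambda>u. (f u, 0) + (0, g u))"
    by (intro smooth_on_add smooth_on_bounded_linear[of "\<lambda>x. (x, 0)"]
        smooth_on_bounded_linear[of "\<lambda>x. (0, x)"] assms
        bounded_linear_Pair bounded_linear_zero bounded_linear_ident)
  then show ?thesis by simp
qed

lemma smooth_on_compose:
  fixes g :: "'b::euclidean_space \<Rightarrow> 'c::real_normed_vector"
  assumes "open U" "open V" "f ` U \<subseteq> V" "smooth_on U f" "smooth_on V g"
  shows "smooth_on U (\<lambda>u. g (f u))"
  using assms by (auto simp: smooth_on_def intro: Ck_on_compose)

lemma smooth_on_FD: "smooth_on U f \<Longrightarrow> smooth_on U (\<lambda>u. FD f u v)"
  unfolding smooth_on_def by (metis Ck_on.simps(2))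

lemma smooth_on_differentiable: "smooth_on U f \<Longrightarrow> u \<in> U \<Longrightarrow> f differentiable (at u)"
  unfolding smooth_on_def by (metis Ck_on.simps(2))

lemma smooth_on_has_derivative: "smooth_on U f \<Longrightarrow> u \<in> U \<Longrightarrow> (f has_derivative FD f u) (at u)"
  by (intro FD_worksD smooth_on_differentiable)

lemma smooth_on_linear_FD: "smooth_on U f \<Longrightarrow> u \<in> U \<Longrightarrow> linear (FD f u)"
  by (intro FD_linear smooth_on_differentiable)

lemma smooth_on_continuous: "smooth_on U f \<Longrightarrow> continuous_on U f"
  unfolding smooth_on_def by (metis Ck_on.simps(1))

lemma smooth_on_FD_var:
  fixes f :: "'a::euclidean_space \<Rightarrow> 'b::real_normed_vector"
  assumes "open U" "smooth_on U f" "smooth_on U g"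
  shows "smooth_on U (\<lambda>u. FD f u (g u))"
proof (rule smooth_on_cong[OF assms(1)])
  show "smooth_on U (\<lambda>u. \<Sum>b\<in>Basis. (g u \<bullet> b) *\<^sub>R FD f u b)"
    by (intro smooth_on_sum smooth_on_scaleR smooth_on_inner smooth_on_const smooth_on_FD assms)
qed (use linear_basis_expand[OF smooth_on_linear_FD] assms in metis)

text \<open>Only continuity of \<^term>\<open>f\<close> is needed, because \<^term>\<open>g\<close> vanishes at \<^term>\<open>u\<close>.\<close>
lemma has_derivative_scaleR_vanishing:
  fixes g :: "'a::real_normed_vector \<Rightarrow> 'b::real_normed_vector"
  assumes f: "isCont f u" and g: "(g has_derivative g') (at u)" and "g u = 0"
  shows "((\<lambda>z. f z *\<^sub>R g z) has_derivative (\<lambda>v. f u *\<^sub>R g' v)) (at u)"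
proof -
  have "((\<lambda>z. (f z - f u) *\<^sub>R g z) has_derivative (\<lambda>v. 0)) (at u)"
    unfolding has_derivative_iff_norm
  proof (intro conjI bounded_linear_zero)
    obtain K where K: "\<And>v. norm (g' v) \<le> norm v * K"
      using bounded_linear.pos_bounded[OF has_derivative_bounded_linear[OF g]] by blast
    have q: "((\<lambda>z. norm (g z - g u - g' (z - u)) / norm (z - u)) \<longlongrightarrow> 0) (at u)"
      using g unfolding has_derivative_iff_norm by blast
    have fc: "((\<lambda>z. norm (f z - f u)) \<longlongrightarrow> 0) (at u)"
      by (intro tendsto_norm_zero LIM_zero f[unfolded isCont_def])
    have "((\<lambda>z. norm (f z - f u) * (norm (g z - g u - g' (z - u)) / norm (z - u) + K)) \<longlongrightarrow> 0 * (0 + K)) (at u)"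
      by (intro tendsto_intros q fc)
    then have lim: "((\<lambda>z. norm (f z - f u) * (norm (g z - g u - g' (z - u)) / norm (z - u) + K)) \<longlongrightarrow> 0) (at u)"
      by simp
    have bnd: "norm (norm ((f z - f u) *\<^sub>R g z - (f u - f u) *\<^sub>R g u - 0) / norm (z - u))
      \<le> norm (f z - f u) * (norm (g z - g u - g' (z - u)) / norm (z - u) + K)" if "z \<noteq> u" for z
    proof -
      have "norm (g z) \<le> norm (g z - g u - g' (z - u)) + norm (g' (z - u))"
        using norm_triangle_ineq[of "g z - g u - g' (z - u)" "g' (z - u)"] \<open>g u = 0\<close> by simp
      also have "\<dots> \<le> norm (g z - g u - g' (z - u)) + norm (z - u) * K"
        using K by simp
      finally have "norm (g z) / norm (z - u) \<le> norm (g z - g u - g' (z - u)) / norm (z - u) + K"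
        using that by (simp add: field_simps)
      then have "norm (f z - f u) * (norm (g z) / norm (z - u))
        \<le> norm (f z - f u) * (norm (g z - g u - g' (z - u)) / norm (z - u) + K)"
        by (intro mult_left_mono) auto
      then show ?thesis by simp
    qed
    show "((\<lambda>z. norm ((f z - f u) *\<^sub>R g z - (f u - f u) *\<^sub>R g u - 0) / norm (z - u)) \<longlongrightarrow> 0) (at u)"
      by (rule Lim_null_comparison[OF _ lim]) (use bnd in \<open>auto simp: eventually_at_filter\<close>)
  qed
  from has_derivative_add[OF this has_derivative_scaleR_right[OF g, of "f u"]]
  show ?thesis by (simp add: algebra_simps)
qed

section \<open>Inverse operators and smoothness of local inverses\<close>

lemma linear_inv:
  assumes f: "linear f" "bij f" shows "linear (inv f)"
proof (rule linearI)
  note surj = surj_f_inv_f[OF bij_is_surj[OF f(2)]] and inj = inv_f_f[OF bij_is_inj[OF f(2)]]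
  show "inv f (x + y) = inv f x + inv f y" for x y
    using inj[of "inv f x + inv f y"] by (simp add: linear_add[OF f(1)] surj)
  show "inv f (r *\<^sub>R x) = r *\<^sub>R inv f x" for r x
    using inj[of "r *\<^sub>R inv f x"] by (simp add: linear_scale[OF f(1)] surj)
qed

text \<open>The identity B z - B u = B u (A u - A z) B z, with B the inverse of A, has a factor
  vanishing at z = u, so continuity of B already makes B differentiable. The resulting derivative is
  built from B and the derivative of A, and regularity climbs by induction.\<close>

lemma smooth_on_inverse_operator:
  fixes A :: "'u::real_normed_vector \<Rightarrow> 'a::euclidean_space \<Rightarrow> 'b::euclidean_space"
  assumes U: "open U" and sm: "\<And>v. smooth_on U (\<lambda>u. A u v)"
    and lin: "\<And>u. u \<in> U \<Longrightarrow> linear (A u)" and bij: "\<And>u. u \<in> U \<Longrightarrow> bij (A u)"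
  shows "smooth_on U (\<lambda>u. inv (A u) w)"
proof -
  define B where "B = (\<lambda>u. inv (A u))"
  have AB: "A u (B u w) = w" if "u \<in> U" for u w
    using bij[OF that] by (simp add: B_def bij_is_surj surj_f_inv_f)
  have BA: "B u (A u v) = v" if "u \<in> U" for u v
    using bij[OF that] by (simp add: B_def bij_is_inj inv_f_f)
  have linB: "linear (B u)" if "u \<in> U" for u
    unfolding B_def by (rule linear_inv[OF lin[OF that] bij[OF that]])
  have cont: "isCont (\<lambda>u. B u w) u0" if u0: "u0 \<in> U" for u0 w
  proof -
    have ev: "eventually (\<lambda>u. u \<in> U) (nhds u0)" using U u0 by (simp add: eventually_nhds_in_open)
    obtain K where "K > 0" and K: "\<And>w. norm (B u0 w) \<le> K * norm w"
      using linear_bounded_pos[OF linB[OF u0]] by blast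
    define q where "q = (\<lambda>u. \<Sum>b\<in>Basis. norm (A u b - A u0 b))"
    have isc: "isCont (\<lambda>u. A u v) u0" for v
      using smooth_on_continuous[OF sm] U u0 continuous_on_eq_continuous_at by blast
    have "(q \<longlongrightarrow> (\<Sum>b\<in>Basis. norm (A u0 b - A u0 b))) (at u0)"
      unfolding q_def by (intro tendsto_intros) (use isc in \<open>simp add: isCont_def\<close>)
    then have "(q \<longlongrightarrow> 0) (at u0)" by simp
    \<comment> \<open>\<open>q u\<close> bounds the operator norm of A u - A u0. Since A u0 v has
      norm at least norm v / K, a perturbation below 1 / (2 * K) leaves the lower bound norm v / (2
      * K) for A u v, which is \<open>low\<close>.\<close>
    then have evq: "eventually (\<lambda>u. q u < 1 / (2 * K)) (at u0)"
      using \<open>K > 0\<close> by (intro order_tendstoD) auto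
    have qb: "norm (A u v - A u0 v) \<le> q u * norm v" if "u \<in> U" for u v
    proof -
      have "linear (\<lambda>v. A u v - A u0 v)"
        using linear_compose_sub[OF lin[OF that] lin[OF u0]] by simp
      from linear_basis_expand[OF this, of v]
      have "norm (A u v - A u0 v) = norm (\<Sum>b\<in>Basis. (v \<bullet> b) *\<^sub>R (A u b - A u0 b))" by simp
      also have "\<dots> \<le> (\<Sum>b\<in>Basis. norm ((v \<bullet> b) *\<^sub>R (A u b - A u0 b)))" by (rule norm_sum)
      also have "\<dots> \<le> (\<Sum>b\<in>Basis. norm v * norm (A u b - A u0 b))"
        by (intro sum_mono) (auto intro!: mult_right_mono simp: Basis_le_norm)
      finally show ?thesis by (simp add: q_def sum_distrib_left mult.commute)
    qed
    have low: "norm v \<le> 2 * K * norm (A u v)" if "u \<in> U" "q u < 1 / (2 * K)" for u v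
    proof -
      have "norm v \<le> K * norm (A u0 v)" using K[of "A u0 v"] BA[OF u0] by simp
      also have "norm (A u0 v) \<le> norm (A u v) + norm (A u v - A u0 v)"
        by (metis norm_minus_commute norm_triangle_sub)
      also have "norm (A u v - A u0 v) \<le> 1 / (2 * K) * norm v"
        using order_trans[OF qb[OF that(1)] mult_right_mono[OF less_imp_le[OF that(2)]]] by simp
      finally show ?thesis using \<open>K > 0\<close> by (simp add: field_simps)
    qed
    have "eventually (\<lambda>u. norm (B u w - B u0 w) \<le> 2 * K * norm (w - A u (B u0 w))) (at u0)"
      using evq ev[THEN eventually_nhds_conv_at[THEN iffD1], THEN conjunct1]
    proof eventually_elim
      case (elim u)
      then show ?case using low[of u "B u w - B u0 w"]
        by (simp add: linear_diff[OF lin] AB)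
    qed
    moreover have "((\<lambda>u. 2 * K * norm (w - A u (B u0 w))) \<longlongrightarrow> 2 * K * norm (w - A u0 (B u0 w))) (at u0)"
      by (intro tendsto_intros) (use isc in \<open>simp add: isCont_def\<close>)
    then have "((\<lambda>u. 2 * K * norm (w - A u (B u0 w))) \<longlongrightarrow> 0) (at u0)"
      by (simp add: AB[OF u0])
    ultimately have "((\<lambda>u. B u w - B u0 w) \<longlongrightarrow> 0) (at u0)"
      by (rule Lim_null_comparison)
    then show ?thesis by (simp add: isCont_def LIM_zero_iff)
  qed
  have der: "((\<lambda>u. B u w) has_derivative
      (\<lambda>v. \<Sum>b\<in>Basis. (B u w \<bullet> b) *\<^sub>R - B u (FD (\<lambda>z. A z b) u v))) (at u)" if u: "u \<in> U" for u w
  proof -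
    have lB: "bounded_linear (B u)" using linB[OF u] by (simp add: linear_conv_bounded_linear)
    have d: "((\<lambda>z. B u (A u b - A z b)) has_derivative (\<lambda>v. - B u (FD (\<lambda>z. A z b) u v))) (at u)" for b
    proof -
      have "((\<lambda>z. A u b - A z b) has_derivative (\<lambda>v. 0 - FD (\<lambda>z. A z b) u v)) (at u)"
        by (intro has_derivative_diff has_derivative_const smooth_on_has_derivative[OF sm u])
      from bounded_linear.has_derivative[OF lB this]
      show ?thesis by (simp add: linear_neg[OF linB[OF u]])
    qed
    \<comment> \<open>Each summand is a continuous coefficient times a vector that vanishes at z =
      u, the situation of \<open>has_derivative_scaleR_vanishing\<close>.\<close>
    have "((\<lambda>z. \<Sum>b\<in>Basis. (B z w \<bullet> b) *\<^sub>R B u (A u b - A z b)) has_derivative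
       (\<lambda>v. \<Sum>b\<in>Basis. (B u w \<bullet> b) *\<^sub>R - B u (FD (\<lambda>z. A z b) u v))) (at u)"
      by (intro has_derivative_sum has_derivative_scaleR_vanishing d continuous_intros cont u)
        (simp add: linear_0[OF linB[OF u]])
    from has_derivative_add[OF this has_derivative_const[of "B u w"]]
    have *: "((\<lambda>z. (\<Sum>b\<in>Basis. (B z w \<bullet> b) *\<^sub>R B u (A u b - A z b)) + B u w) has_derivative
       (\<lambda>v. \<Sum>b\<in>Basis. (B u w \<bullet> b) *\<^sub>R - B u (FD (\<lambda>z. A z b) u v))) (at u)"
      by simp
    show ?thesis
    proof (rule has_derivative_transform_within_open[OF * U u])
      fix z assume z: "z \<in> U"
      have "linear (\<lambda>v. B u (A u v - A z v))"
        using linear_compose[OF linear_compose_sub[OF lin[OF u] lin[OF z]] linB[OF u]]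
        by (simp add: o_def)
      from linear_basis_expand[OF this, of "B z w"]
      have "(\<Sum>b\<in>Basis. (B z w \<bullet> b) *\<^sub>R B u (A u b - A z b)) = B u (A u (B z w) - A z (B z w))"
        by simp
      also have "\<dots> = B z w - B u w"
        by (simp add: linear_diff[OF linB[OF u]] BA[OF u] AB[OF z])
      finally show "(\<Sum>b\<in>Basis. (B z w \<bullet> b) *\<^sub>R B u (A u b - A z b)) + B u w = B z w" by simp
    qed
  qed
  have "Ck_on k U (\<lambda>u. B u w)" for k w
  proof (induction k arbitrary: w)
    case 0
    then show ?case using cont by (simp add: continuous_at_imp_continuous_on)
  next
    case (Suc k)
    have "Ck_on k U (\<lambda>u. FD (\<lambda>u. B u w) u v)" for v
    proof (rule Ck_on_cong[OF U])
      have s: "Ck_on k U (\<lambda>u. FD (\<lambda>z. A z b) u v)" for b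
        using smooth_on_FD[OF sm] by (auto simp: smooth_on_def)
      show "Ck_on k U (\<lambda>u. \<Sum>b\<in>Basis. (B u w \<bullet> b) *\<^sub>R
          (\<Sum>i\<in>Basis. (FD (\<lambda>z. A z b) u v \<bullet> i) *\<^sub>R - 1 *\<^sub>R B u i))"
        by (intro Ck_on_sum Ck_on_scaleR Ck_on_inner Ck_on_const s Suc.IH U)
      fix u assume u: "u \<in> U"
      have "(\<Sum>i\<in>Basis. (FD (\<lambda>z. A z b) u v \<bullet> i) *\<^sub>R - 1 *\<^sub>R B u i) = - B u (FD (\<lambda>z. A z b) u v)" for b
        unfolding linear_basis_expand[OF linB[OF u], of "FD (\<lambda>z. A z b) u v"]
        by (simp add: sum_negf)
      then show "(\<Sum>b\<in>Basis. (B u w \<bullet> b) *\<^sub>R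
          (\<Sum>i\<in>Basis. (FD (\<lambda>z. A z b) u v \<bullet> i) *\<^sub>R - 1 *\<^sub>R B u i)) = FD (\<lambda>u. B u w) u v"
        by (simp only: FD_eqI[OF der[OF u]])
    qed
    with der show ?case by (auto simp: differentiable_def)
  qed
  then show ?thesis by (simp add: smooth_on_def B_def)
qed

text \<open>The function r satisfies r' = - r r r / 2, so its derivative is a polynomial in r and
  induction on the order closes.\<close>

lemma smooth_on_inverse_sqrt: "smooth_on {0<..} (\<lambda>t::real. 1 / sqrt t)"
proof -
  define r where "r = (\<lambda>t::real. 1 / sqrt t)"
  have d: "(r has_derivative (\<lambda>v. v * (- 1 / 2 * (r t * (r t * r t))))) (at t)" if "t \<in> {0<..}" for t
  proof -
    have "(r has_real_derivative (- 1 / 2 * (r t * (r t * r t)))) (at t)"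
      unfolding r_def using that
      by (auto intro!: derivative_eq_intros simp: field_simps)
    then show ?thesis
      unfolding has_field_derivative_def by (rule has_derivative_eq_rhs) (simp add: fun_eq_iff)
  qed
  have "Ck_on k {0<..} r" for k
  proof (induction k)
    case 0
    then show ?case unfolding r_def by (auto intro!: continuous_intros)
  next
    case (Suc k)
    have "Ck_on k {0<..} (\<lambda>t. FD r t v)" for v
    proof (rule Ck_on_cong)
      show "Ck_on k {0<..} (\<lambda>t. v * (- 1 / 2 * (r t * (r t * r t))))"
        by (intro Ck_on_mult Ck_on_const Suc.IH) auto
    qed (use FD_eqI[OF d] in auto)
    with d show ?case by (auto simp: differentiable_def)
  qed
  then show ?thesis by (simp add: smooth_on_def r_def)
qed

text \<open>The derivative of the local inverse G at y is the inverse operator of FD F (G y). If G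
  is k times continuously differentiable, so is this expression, and G gains one order.\<close>

lemma smooth_inverse_function:
  fixes F :: "'a::euclidean_space \<Rightarrow> 'a"
  assumes V: "open V" "u0 \<in> V" and sm: "smooth_on V F" and inj: "inj (FD F u0)"
  obtains V0 W G where "open V0" "u0 \<in> V0" "V0 \<subseteq> V" "open W" "F u0 \<in> W"
    "homeomorphism V0 W F G" "smooth_on W G"
    "\<And>u v. u \<in> V0 \<Longrightarrow> FD G (F u) (FD F u v) = v"
    "\<And>u v. u \<in> V0 \<Longrightarrow> FD F u (FD G (F u) v) = v"
proof -
  have bl: "bounded_linear (FD F u)" if "u \<in> V" for u
    using smooth_on_linear_FD[OF sm that] by (simp add: linear_conv_bounded_linear)
  define f' where "f' u = Blinfun (FD F u)" for u
  have f': "blinfun_apply (f' u) = FD F u" if "u \<in> V" for u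
    unfolding f'_def using bl[OF that] by (simp add: bounded_linear_Blinfun_apply)
  have cont: "continuous_on V f'"
  proof (rule continuous_on_blinfun_componentwise)
    fix i :: 'a
    show "continuous_on V (\<lambda>u. blinfun_apply (f' u) i)"
      using smooth_on_continuous[OF smooth_on_FD[OF sm, of i]]
      by (rule continuous_on_eq) (simp add: f')
  qed
  obtain g where g: "linear g" "g \<circ> FD F u0 = id"
    using linear_injective_left_inverse[OF smooth_on_linear_FD[OF sm V(2)] inj] by blast
  have "Blinfun g o\<^sub>L f' u0 = id_blinfun"
    using g by (intro blinfun_eqI) (simp add: f' V linear_conv_bounded_linear
        bounded_linear_Blinfun_apply pointfree_idE)
  from inverse_function_theorem[OF V(1) _ cont V(2) this]
  obtain V0 W G g' where *: "open V0" "V0 \<subseteq> V" "u0 \<in> V0" "open W" "F u0 \<in> W" "homeomorphism V0 W F G"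
    "\<And>y. y \<in> W \<Longrightarrow> (G has_derivative (g' y)) (at y)"
    "\<And>y. y \<in> W \<Longrightarrow> g' y = inv (blinfun_apply (f'(G y)))"
    "\<And>y. y \<in> W \<Longrightarrow> bij (blinfun_apply (f'(G y)))"
    using smooth_on_has_derivative[OF sm] f' by metis
  have GW: "G y \<in> V0" if "y \<in> W" for y using *(6) that by (auto simp: homeomorphism_def)
  have bij: "bij (FD F u)" if "u \<in> V0" for u
    using *(9)[of "F u"] *(2,6) that f' by (auto simp: homeomorphism_def)
  have dG: "(G has_derivative inv (FD F (G y))) (at y)" if "y \<in> W" for y
    using *(7,8)[OF that] f' GW[OF that] *(2) by auto
  have "Ck_on k W G" for k
  proof (induction k)
    case 0
    then show ?case using *(6) by (simp add: homeomorphism_def)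
  next
    case (Suc k)
    have "Ck_on k W (\<lambda>y. FD G y v)" for v
    proof (rule Ck_on_cong[OF *(4)])
      have "smooth_on V0 (\<lambda>u. inv (FD F u) v)"
        by (rule smooth_on_inverse_operator[OF *(1)])
          (use smooth_on_subset[OF sm *(2)] bij in \<open>auto intro: smooth_on_FD smooth_on_linear_FD\<close>)
      then show "Ck_on k W (\<lambda>y. inv (FD F (G y)) v)"
        by (intro Ck_on_compose[OF *(4) *(1) _ Suc.IH]) (use GW in \<open>auto simp: smooth_on_def\<close>)
    qed (use FD_eqI[OF dG] in auto)
    with dG show ?case by (auto simp: differentiable_def)
  qed
  then have smG: "smooth_on W G" by (simp add: smooth_on_def)
  have FG: "FD G (F u) = inv (FD F u)" if "u \<in> V0" for u
    using FD_eqI[OF dG[of "F u"]] *(6) that by (auto simp: homeomorphism_def)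
  show thesis
  proof (rule that[OF *(1,3,2,4,5,6) smG])
    show "FD G (F u) (FD F u v) = v" if "u \<in> V0" for u v
      using FG[OF that] bij[OF that] by (simp add: bij_is_inj inv_f_f)
    show "FD F u (FD G (F u) v) = v" if "u \<in> V0" for u v
      using FG[OF that] bij[OF that] by (simp add: bij_is_surj surj_f_inv_f)
  qed
qed

section \<open>Symmetry of second derivatives\<close>

lemma has_vector_derivative_line:
  assumes "f differentiable (at (p + s *\<^sub>R v))"
  shows "((\<lambda>s. f (p + s *\<^sub>R v)) has_vector_derivative FD f (p + s *\<^sub>R v) v) (at s)"
proof -
  have "((\<lambda>s. p + s *\<^sub>R v) has_derivative (\<lambda>h. h *\<^sub>R v)) (at s)"
    by (auto intro!: derivative_eq_intros)
  from has_derivative_compose[OF this FD_worksD[OF assms]]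
  show ?thesis
    by (simp add: has_vector_derivative_def linear_scale[OF FD_linear[OF assms]])
qed

text \<open>The second difference is the increment of \<phi> over [0, r]; the mean value theorem in
  direction v and then in direction w turns it into a mixed derivative. Being symmetric in v and w,
  it also yields the mixed derivative in the other order.\<close>

lemma second_difference_mean_value:
  fixes g :: "'a::real_normed_vector \<Rightarrow> real"
  assumes sm: "smooth_on V g" and V: "ball u R \<subseteq> V" and r: "0 < r" "r * (norm v + norm w) < R"
  obtains z where "norm (z - u) \<le> r * (norm v + norm w)"
    "g (u + r *\<^sub>R v + r *\<^sub>R w) - g (u + r *\<^sub>R v) - g (u + r *\<^sub>R w) + g u
      = r * r * FD (\<lambda>z. FD g z v) z w"
proof -
  have inV: "u + s *\<^sub>R v + t *\<^sub>R w \<in> V" and bd: "norm (s *\<^sub>R v + t *\<^sub>R w) \<le> r * (norm v + norm w)"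
    if "0 \<le> s" "s \<le> r" "0 \<le> t" "t \<le> r" for s t
  proof -
    have "norm (s *\<^sub>R v + t *\<^sub>R w) \<le> s * norm v + t * norm w"
      using norm_triangle_ineq[of "s *\<^sub>R v" "t *\<^sub>R w"] that by simp
    also have "\<dots> \<le> r * norm v + r * norm w"
      using that by (intro add_mono mult_right_mono) auto
    finally show "norm (s *\<^sub>R v + t *\<^sub>R w) \<le> r * (norm v + norm w)"
      by (simp add: algebra_simps)
    then have "norm (u + s *\<^sub>R v + t *\<^sub>R w - u) < R"
      using r by (simp add: add.assoc)
    then have "dist u (u + s *\<^sub>R v + t *\<^sub>R w) < R"
      by (simp only: dist_norm norm_minus_commute)
    then show "u + s *\<^sub>R v + t *\<^sub>R w \<in> V" using V by auto
  qed
  have dg: "g differentiable (at z)" if "z \<in> V" for z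
    using smooth_on_differentiable[OF sm that] .
  have ddg: "(\<lambda>z. FD g z v) differentiable (at z)" if "z \<in> V" for z
    using smooth_on_differentiable[OF smooth_on_FD[OF sm] that] .
  define \<phi> where "\<phi> = (\<lambda>s. g (u + r *\<^sub>R w + s *\<^sub>R v) - g (u + s *\<^sub>R v))"
  have d\<phi>: "(\<phi> has_real_derivative
      (FD g (u + r *\<^sub>R w + s *\<^sub>R v) v - FD g (u + s *\<^sub>R v) v)) (at s)" if "0 \<le> s" "s \<le> r" for s
    unfolding \<phi>_def has_real_derivative_iff_has_vector_derivative
  proof (intro has_vector_derivative_diff has_vector_derivative_line dg)
    show "u + r *\<^sub>R w + s *\<^sub>R v \<in> V" using inV[of s r] that r by (simp add: algebra_simps)
    show "u + s *\<^sub>R v \<in> V" using inV[of s 0] that r by simp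
  qed
  obtain s where s: "0 < s" "s < r"
    and e1: "\<phi> r - \<phi> 0 = (r - 0) * (FD g (u + r *\<^sub>R w + s *\<^sub>R v) v - FD g (u + s *\<^sub>R v) v)"
    using MVT2[OF r(1) d\<phi>] by blast
  have d2: "((\<lambda>t. FD g (u + s *\<^sub>R v + t *\<^sub>R w) v) has_real_derivative
      FD (\<lambda>z. FD g z v) (u + s *\<^sub>R v + t *\<^sub>R w) w) (at t)" if "0 \<le> t" "t \<le> r" for t
    unfolding has_real_derivative_iff_has_vector_derivative
    using inV[of s t] that s by (intro has_vector_derivative_line ddg) auto
  obtain t where t: "0 < t" "t < r"
    and e2: "FD g (u + s *\<^sub>R v + r *\<^sub>R w) v - FD g (u + s *\<^sub>R v + 0 *\<^sub>R w) v =
      (r - 0) * FD (\<lambda>z. FD g z v) (u + s *\<^sub>R v + t *\<^sub>R w) w"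
    using MVT2[OF r(1) d2] by blast
  show thesis
  proof (rule that[of "u + s *\<^sub>R v + t *\<^sub>R w"])
    show "norm (u + s *\<^sub>R v + t *\<^sub>R w - u) \<le> r * (norm v + norm w)"
      using bd[of s t] s t by (simp add: add.assoc)
    show "g (u + r *\<^sub>R v + r *\<^sub>R w) - g (u + r *\<^sub>R v) - g (u + r *\<^sub>R w) + g u
      = r * r * FD (\<lambda>z. FD g z v) (u + s *\<^sub>R v + t *\<^sub>R w) w"
      using e1 e2 by (simp add: \<phi>_def algebra_simps)
  qed
qed

lemma FD_symmetric_real:
  fixes g :: "'a::real_normed_vector \<Rightarrow> real"
  assumes V: "open V" "u \<in> V" and sm: "smooth_on V g"
  shows "FD (\<lambda>z. FD g z v) u w = FD (\<lambda>z. FD g z w) u v"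
proof (rule ccontr)
  define p where "p = (\<lambda>z. FD (\<lambda>z. FD g z v) z w)"
  define q where "q = (\<lambda>z. FD (\<lambda>z. FD g z w) z v)"
  assume "FD (\<lambda>z. FD g z v) u w \<noteq> FD (\<lambda>z. FD g z w) u v"
  then have e: "dist (p u) (q u) > 0" by (simp add: p_def q_def)
  obtain R where R: "R > 0" "ball u R \<subseteq> V" using V open_contains_ball by blast
  have "continuous_on V p" "continuous_on V q"
    unfolding p_def q_def by (intro smooth_on_continuous smooth_on_FD sm)+
  then have "isCont p u" "isCont q u" using V continuous_on_eq_continuous_at by blast+
  then obtain d1 d2 where d: "d1 > 0" "d2 > 0"
    "\<And>z. dist z u < d1 \<Longrightarrow> dist (p z) (p u) < dist (p u) (q u) / 2"
    "\<And>z. dist z u < d2 \<Longrightarrow> dist (q z) (q u) < dist (p u) (q u) / 2"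
    unfolding continuous_at_eps_delta using e by (metis half_gt_zero)
  \<comment> \<open>The summand 1 keeps s positive when v and w both vanish.\<close>
  define s where "s = norm v + norm w + 1"
  have s: "s > 0" unfolding s_def by (simp add: add_nonneg_pos)
  define r where "r = min R (min d1 d2) / (2 * s)"
  have r: "r > 0" using R d s by (simp add: r_def)
  have "r * (norm v + norm w) < r * s" using r by (simp add: s_def)
  also have "r * s = min R (min d1 d2) / 2" using s by (simp add: r_def)
  also have "\<dots> < min R (min d1 d2)" using R d by auto
  finally have rs: "r * (norm v + norm w) < R" "r * (norm v + norm w) < d1"
    "r * (norm v + norm w) < d2" by auto
  obtain z1 where z1: "norm (z1 - u) \<le> r * (norm v + norm w)"
    "g (u + r *\<^sub>R v + r *\<^sub>R w) - g (u + r *\<^sub>R v) - g (u + r *\<^sub>R w) + g u = r * r * p z1"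
    unfolding p_def using second_difference_mean_value[OF sm R(2) r rs(1)] by blast
  obtain z2 where z2: "norm (z2 - u) \<le> r * (norm w + norm v)"
    "g (u + r *\<^sub>R w + r *\<^sub>R v) - g (u + r *\<^sub>R w) - g (u + r *\<^sub>R v) + g u = r * r * q z2"
    unfolding q_def using second_difference_mean_value[OF sm R(2) r, of w v] rs(1)
    by (metis add.commute)
  have "r * r * p z1 = r * r * q z2" using z1(2) z2(2) by (simp add: algebra_simps)
  then have "p z1 = q z2" using r by simp
  moreover have "dist (p z1) (p u) < dist (p u) (q u) / 2"
    using z1(1) rs by (intro d) (simp add: dist_norm)
  moreover have "dist (q z2) (q u) < dist (p u) (q u) / 2"
    using z2(1) rs by (intro d) (simp add: dist_norm add.commute)
  ultimately show False by (metis dist_triangle_half_l dist_commute less_irrefl)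
qed

lemma FD_bounded_linear:
  "bounded_linear L \<Longrightarrow> f differentiable (at u) \<Longrightarrow> FD (\<lambda>z. L (f z)) u v = L (FD f u v)"
  using FD_eqI[OF bounded_linear.has_derivative[OF _ FD_worksD]] by metis

lemma FD_symmetric:
  fixes f :: "'a::real_normed_vector \<Rightarrow> 'b::euclidean_space"
  assumes V: "open V" "u \<in> V" and sm: "smooth_on V f"
  shows "FD (\<lambda>z. FD f z v) u w = FD (\<lambda>z. FD f z w) u v"
proof (rule euclidean_eqI)
  fix b :: 'b
  have L: "bounded_linear (\<lambda>x. x \<bullet> b)" by (rule bounded_linear_inner_left)
  have *: "FD (\<lambda>z. FD f z v) u w \<bullet> b = FD (\<lambda>z. FD (\<lambda>z. f z \<bullet> b) z v) u w" for v w
  proof -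
    have "FD (\<lambda>z. FD f z v) u w \<bullet> b = FD (\<lambda>z. FD f z v \<bullet> b) u w"
      by (rule FD_bounded_linear[OF L, symmetric])
        (rule smooth_on_differentiable[OF smooth_on_FD[OF sm] V(2)])
    also have "\<dots> = FD (\<lambda>z. FD (\<lambda>z. f z \<bullet> b) z v) u w"
      by (rule fun_cong[OF FD_cong_open[OF V]])
        (simp add: FD_bounded_linear[OF L] smooth_on_differentiable[OF sm])
    finally show ?thesis .
  qed
  show "FD (\<lambda>z. FD f z v) u w \<bullet> b = FD (\<lambda>z. FD f z w) u v \<bullet> b"
    unfolding * by (rule FD_symmetric_real[OF V smooth_on_bounded_linear[OF L V(1) sm]])
qed

section \<open>Functions constant on level sets, and lifting of derivatives\<close>

lemma FD_const_line:
  fixes f :: "'a::real_normed_vector \<Rightarrow> 'b::real_normed_vector"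
  assumes "\<And>t. t \<in> {0..1} \<Longrightarrow> f differentiable (at (p + t *\<^sub>R v))"
    "\<And>t. t \<in> {0..1} \<Longrightarrow> FD f (p + t *\<^sub>R v) v = 0"
  shows "f (p + v) = f p"
proof -
  have "((\<lambda>s. f (p + s *\<^sub>R v)) has_derivative (\<lambda>h. 0)) (at t within {0..1})" if "t \<in> {0..1}" for t
    using has_vector_derivative_line[OF assms(1)[OF that]] assms(2)[OF that]
    by (auto simp: has_vector_derivative_def intro: has_derivative_at_withinI)
  from has_derivative_zero_constant[OF convex_real_interval(5) this]
  obtain c where "\<forall>t\<in>{0..1}. f (p + t *\<^sub>R v) = c" by blast
  from this[rule_format, of 0] this[rule_format, of 1] show ?thesis by simp
qed

text \<open>Once the level sets of f are straightened into parallel hyperplanes, dw = \<mu> df makes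
  the derivative of w vanish along segments of such a hyperplane.\<close>

lemma level_set_constancy:
  fixes f w :: "'a::euclidean_space \<Rightarrow> real"
  assumes V: "open V" "u0 \<in> V" and f: "smooth_on V f" and w: "smooth_on V w"
    and nz: "FD f u0 v \<noteq> 0" and dep: "\<And>u v. u \<in> V \<Longrightarrow> FD w u v = \<mu> u * FD f u v"
  obtains V' where "open V'" "u0 \<in> V'" "V' \<subseteq> V"
    "\<And>u u'. u \<in> V' \<Longrightarrow> u' \<in> V' \<Longrightarrow> f u = f u' \<Longrightarrow> w u = w u'"
proof -
  define l\<^sub>0 where "l\<^sub>0 = FD f u0"
  have lin: "linear l\<^sub>0" unfolding l\<^sub>0_def using smooth_on_linear_FD[OF f V(2)] .
  then have bl: "bounded_linear l\<^sub>0" by (simp add: linear_conv_bounded_linear)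
  define v0 where "v0 = (1 / l\<^sub>0 v) *\<^sub>R v"
  have v0: "l\<^sub>0 v0 = 1" unfolding v0_def linear_scale[OF lin] using nz by (simp add: l\<^sub>0_def)
  \<comment> \<open>F moves u only along \<open>v0\<close>, by the amount that makes the linear
    coordinate \<open>l\<^sub>0\<close> of F u equal to f u; its derivative at u0 is the
    identity.\<close>
  define F where "F u = u + (f u - l\<^sub>0 u) *\<^sub>R v0" for u
  have smF: "smooth_on V F"
    unfolding F_def by (intro smooth_on_add smooth_on_scaleR smooth_on_diff smooth_on_const V f
        smooth_on_linear bl bounded_linear_ident)
  have lF: "l\<^sub>0 (F u) = f u" for u
    using v0 by (simp add: F_def linear_add[OF lin] linear_scale[OF lin])
  have "(F has_derivative (\<lambda>v. v + (FD f u0 v - l\<^sub>0 v) *\<^sub>R v0)) (at u0)"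
    unfolding F_def by (intro has_derivative_add has_derivative_scaleR_left has_derivative_diff
        has_derivative_ident smooth_on_has_derivative[OF f V(2)] bounded_linear_imp_has_derivative bl)
  then have "FD F u0 = (\<lambda>v. v)" by (simp add: FD_eqI l\<^sub>0_def)
  then have "inj (FD F u0)" by (simp add: inj_on_def)
  from smooth_inverse_function[OF V smF this]
  obtain V0 W G where G: "open V0" "u0 \<in> V0" "V0 \<subseteq> V" "open W" "F u0 \<in> W"
    "homeomorphism V0 W F G" "smooth_on W G"
    "\<And>u v. u \<in> V0 \<Longrightarrow> FD F u (FD G (F u) v) = v"
    by metis
  obtain r where r: "r > 0" "ball (F u0) r \<subseteq> W" using G(4,5) open_contains_ball by blast
  have GW: "G y \<in> V0" "F (G y) = y" if "y \<in> W" for y using G(6) that by (auto simp: homeomorphism_def)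
  have dfG: "FD (\<lambda>y. w (G y)) y v = \<mu> (G y) * l\<^sub>0 v" "(\<lambda>y. w (G y)) differentiable (at y)"
    if "y \<in> W" for y v
  proof -
    have GyV: "G y \<in> V" using GW(1)[OF that] G(3) by blast
    have dG: "(G has_derivative FD G y) (at y)" by (rule smooth_on_has_derivative[OF G(7) that])
    have 1: "((\<lambda>y. w (G y)) has_derivative (\<lambda>v. FD w (G y) (FD G y v))) (at y)"
      by (rule has_derivative_compose[OF dG smooth_on_has_derivative[OF w GyV]])
    have 2: "((\<lambda>y. f (G y)) has_derivative (\<lambda>v. FD f (G y) (FD G y v))) (at y)"
      by (rule has_derivative_compose[OF dG smooth_on_has_derivative[OF f GyV]])
    have 3: "((\<lambda>y. f (G y)) has_derivative l\<^sub>0) (at y)"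
      by (rule has_derivative_transform_within_open[OF bounded_linear_imp_has_derivative[OF bl] G(4) that])
        (metis lF GW(2))
    show "FD (\<lambda>y. w (G y)) y v = \<mu> (G y) * l\<^sub>0 v"
      using FD_eqI[OF 1] dep[OF GyV] has_derivative_unique[OF 2 3] by metis
    show "(\<lambda>y. w (G y)) differentiable (at y)" using 1 by (auto simp: differentiable_def)
  qed
  show thesis
  \<comment> \<open>The preimage of a ball is taken so that the segment between two image points
    stays in W, the domain of G.\<close>
  proof (rule that[of "V0 \<inter> F -` ball (F u0) r"])
    show "open (V0 \<inter> F -` ball (F u0) r)"
      using smooth_on_continuous[OF smooth_on_subset[OF smF G(3)]] G(1)
      by (simp add: continuous_on_open_vimage Int_commute)
    show "u0 \<in> V0 \<inter> F -` ball (F u0) r" using G r by simp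
    show "V0 \<inter> F -` ball (F u0) r \<subseteq> V" using G by auto
    fix u u' assume u: "u \<in> V0 \<inter> F -` ball (F u0) r" "u' \<in> V0 \<inter> F -` ball (F u0) r" "f u = f u'"
    have GF: "G (F u) = u" "G (F u') = u'" using u G(6) by (auto simp: homeomorphism_def)
    have seg: "F u + t *\<^sub>R (F u' - F u) \<in> W" if "t \<in> {0..1}" for t
    proof -
      have "(1 - t) *\<^sub>R F u + t *\<^sub>R F u' \<in> ball (F u0) r"
        using u that by (intro convexD[OF convex_ball]) auto
      then show ?thesis using r(2) by (auto simp: algebra_simps)
    qed
    have "l\<^sub>0 (F u' - F u) = 0" using u lF by (simp add: linear_diff[OF lin])
    then have "w (G (F u + (F u' - F u))) = w (G (F u))"
      by (intro FD_const_line[where f = "\<lambda>y. w (G y)"]) (use seg dfG in auto)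
    then show "w u = w u'" using GF by simp
  qed
qed

text \<open>Meant for a coordinate expression g known to be continuous, with f an immersion and f (g
  z) differentiable. The linearization error of f is small relative to g z - g y; absorbing part of
  it gives a Lipschitz estimate for g at y, which then makes the error small relative to z -
  y.\<close>

lemma has_derivative_lift:
  fixes f :: "'a::real_normed_vector \<Rightarrow> 'b::real_normed_vector"
    and g :: "'c::real_normed_vector \<Rightarrow> 'a"
  assumes f: "(f has_derivative f') (at (g y))" and q: "bounded_linear q" "\<And>v. q (f' v) = v"
    and g: "isCont g y" and k: "((\<lambda>z. f (g z)) has_derivative k') (at y)"
  shows "(g has_derivative (\<lambda>v. q (k' v))) (at y)"
  unfolding has_derivative_within_alt2
proof (intro conjI allI impI)
  show "bounded_linear (\<lambda>v. q (k' v))"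
    by (rule bounded_linear_compose[OF q(1) has_derivative_bounded_linear[OF k]])
  fix e :: real assume e: "e > 0"
  obtain Q where Q: "Q > 0" "\<And>v. norm (q v) \<le> norm v * Q" using bounded_linear.pos_bounded[OF q(1)] by blast
  obtain K where K: "K > 0" "\<And>v. norm (k' v) \<le> norm v * K"
    using bounded_linear.pos_bounded[OF has_derivative_bounded_linear[OF k]] by blast
  \<comment> \<open>The entries 1 / (2 * Q) here and 1 in \<open>e2\<close> serve the estimate
    \<open>gl\<close>: the first absorbs half of norm (g z - g y), the second bounds
    \<open>q S\<close>. The other two entries make the final contributions of \<open>q R\<close>,
    through \<open>gl\<close>, and of \<open>q S\<close> at most half of e * norm (z - y)
    each.\<close>
  define e1 where "e1 = min (1 / (2 * Q)) (e / (4 * Q * Q * (1 + K)))"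
  define e2 where "e2 = min 1 (e / (2 * Q))"
  have e12: "e1 > 0" "e2 > 0" using Q K e by (auto simp: e1_def e2_def)
  have "eventually (\<lambda>x. norm (f x - f (g y) - f' (x - g y)) \<le> e1 * norm (x - g y)) (at (g y))"
    using f e12 unfolding has_derivative_within_alt2 by blast
  then have "eventually (\<lambda>x. norm (f x - f (g y) - f' (x - g y)) \<le> e1 * norm (x - g y)) (nhds (g y))"
    unfolding eventually_nhds_conv_at
    using linear_0[OF bounded_linear.linear[OF has_derivative_bounded_linear[OF f]]] by simp
  then have ev1: "eventually (\<lambda>z. norm (f (g z) - f (g y) - f' (g z - g y)) \<le> e1 * norm (g z - g y)) (at y)"
    using g by (auto simp: isCont_def filterlim_iff)
  have ev2: "eventually (\<lambda>z. norm (f (g z) - f (g y) - k' (z - y)) \<le> e2 * norm (z - y)) (at y)"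
    using k e12 unfolding has_derivative_within_alt2 by blast
  show "eventually (\<lambda>z. norm (g z - g y - q (k' (z - y))) \<le> e * norm (z - y)) (at y)"
    using ev1 ev2
  proof eventually_elim
    case (elim z)
    define R where "R = f (g z) - f (g y) - f' (g z - g y)"
    define S where "S = f (g z) - f (g y) - k' (z - y)"
    have "q S - q R = q (f' (g z - g y)) - q (k' (z - y))"
      by (simp add: R_def S_def linear_diff[OF bounded_linear.linear[OF q(1)]])
    then have eq: "g z - g y - q (k' (z - y)) = q S - q R" by (simp add: q(2))
    have R1: "norm (q R) \<le> e1 * norm (g z - g y) * Q"
      using order_trans[OF Q(2) mult_right_mono[OF elim(1)]] Q(1) by (simp add: R_def)
    have S1: "norm (q S) \<le> e2 * norm (z - y) * Q"
      using order_trans[OF Q(2) mult_right_mono[OF elim(2)]] Q(1) by (simp add: S_def)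
    have qk: "norm (q (k' (z - y))) \<le> norm (z - y) * K * Q"
      using order_trans[OF Q(2) mult_right_mono[OF K(2)]] Q(1) by simp
    have "norm (g z - g y) \<le> norm (q S) + norm (q R) + norm (q (k' (z - y)))"
      using eq norm_triangle_ineq4[of "q S" "q R"] norm_triangle_ineq[of "q S - q R" "q (k' (z - y))"]
      by (simp add: eq[symmetric])
    also have "\<dots> \<le> 1 * norm (z - y) * Q + 1 / (2 * Q) * norm (g z - g y) * Q + norm (z - y) * K * Q"
    proof (intro add_mono qk)
      show "norm (q S) \<le> 1 * norm (z - y) * Q"
        using S1 by (rule order_trans) (use Q(1) in \<open>intro mult_right_mono, auto simp: e2_def\<close>)
      show "norm (q R) \<le> 1 / (2 * Q) * norm (g z - g y) * Q"
        using R1 by (rule order_trans) (use Q(1) in \<open>intro mult_right_mono, auto simp: e1_def\<close>)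
    qed
    finally have gl: "norm (g z - g y) \<le> 2 * Q * (1 + K) * norm (z - y)"
      using Q(1) by (simp add: field_simps)
    have "norm (q R) \<le> e / (4 * Q * Q * (1 + K)) * (2 * Q * (1 + K) * norm (z - y)) * Q"
      by (rule order_trans[OF R1], intro mult_right_mono mult_mono gl) (use Q K e in \<open>auto simp: e1_def\<close>)
    also have "\<dots> = e / 2 * norm (z - y)"
    proof -
      have "e / (4 * Q * Q * (1 + K)) * (2 * Q * (1 + K)) * Q = e / 2"
        using Q K by (simp add: divide_simps)
      then have "e / (4 * Q * Q * (1 + K)) * (2 * Q * (1 + K)) * Q * norm (z - y) = e / 2 * norm (z - y)"
        by (rule arg_cong)
      then show ?thesis by (simp only: ac_simps)
    qed
    finally have "norm (q R) \<le> e / 2 * norm (z - y)" .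
    moreover have "norm (q S) \<le> e / 2 * norm (z - y)"
    proof -
      have "e2 * Q \<le> e / (2 * Q) * Q" using Q by (intro mult_right_mono) (auto simp: e2_def)
      then have "e2 * Q \<le> e / 2" using Q by simp
      then have "e2 * Q * norm (z - y) \<le> e / 2 * norm (z - y)" by (intro mult_right_mono) auto
      then show ?thesis using S1 by (simp add: algebra_simps)
    qed
    ultimately show ?case
      unfolding eq using norm_triangle_ineq4[of "q S" "q R"] by (simp add: field_simps)
  qed
qed

section \<open>Local solutions of autonomous differential equations\<close>

lemma ode_local_solution:
  fixes f :: "'a::euclidean_space \<Rightarrow> 'a"
  assumes V: "open V" "u0 \<in> V" and f: "smooth_on V f"
  obtains \<delta> \<gamma> where "\<delta> > 0" "\<gamma> 0 = u0" "\<And>s. s \<in> {-\<delta><..<\<delta>} \<Longrightarrow> \<gamma> s \<in> V"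
    "\<And>s. s \<in> {-\<delta><..<\<delta>} \<Longrightarrow> (\<gamma> has_vector_derivative f (\<gamma> s)) (at s)"
proof -
  obtain r where r: "r > 0" "cball u0 r \<subseteq> V" using V open_contains_cball by blast
  let ?C = "cball u0 r"
  define q where "q u = (\<Sum>b\<in>Basis. norm (FD f u b))" for u
  have "continuous_on ?C q"
    unfolding q_def
    by (intro continuous_intros continuous_on_subset[OF smooth_on_continuous[OF smooth_on_FD[OF f]] r(2)])
  from compact_imp_bounded[OF compact_continuous_image[OF this compact_cball]]
  obtain K where K: "K > 0" "\<And>u. u \<in> ?C \<Longrightarrow> q u \<le> K"
    unfolding bounded_pos by force
  have "norm (FD f u v) \<le> K * norm v" if "u \<in> ?C" for u v
  proof -
    have lin: "linear (FD f u)" using smooth_on_linear_FD[OF f] that r by blast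
    have "norm (FD f u v) \<le> (\<Sum>b\<in>Basis. norm ((v \<bullet> b) *\<^sub>R FD f u b))"
      by (subst linear_basis_expand[OF lin]) (rule norm_sum)
    also have "\<dots> \<le> (\<Sum>b\<in>Basis. norm v * norm (FD f u b))"
      by (intro sum_mono) (auto intro!: mult_right_mono simp: Basis_le_norm)
    also have "\<dots> = q u * norm v" by (simp add: q_def sum_distrib_left mult.commute)
    also have "\<dots> \<le> K * norm v" using K(2)[OF that] by (intro mult_right_mono) auto
    finally show ?thesis .
  qed
  then have on: "onorm (FD f u) \<le> K" if "u \<in> ?C" for u
    using that by (intro onorm_le) auto
  have lip: "norm (f a - f b) \<le> K * norm (a - b)" if "a \<in> ?C" "b \<in> ?C" for a b
  proof (rule differentiable_bound[OF convex_cball _ on that])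
    show "(f has_derivative FD f u) (at u within ?C)" if "u \<in> ?C" for u
      using smooth_on_has_derivative[OF f] that r by (blast intro: has_derivative_at_withinI)
  qed
  \<comment> \<open>Composing with the nearest-point projection onto the ball makes the field
    Lipschitz and bounded everywhere, so that the contraction acts on all bounded continuous curves.
    The fixed point stays in the ball, where F is f.\<close>
  define F where "F u = f (closest_point ?C u)" for u
  have ne: "?C \<noteq> {}" using r by auto
  have cp: "closest_point ?C u \<in> ?C" for u
    by (rule closest_point_in_set[OF closed_cball ne])
  have Flip: "norm (F a - F b) \<le> K * norm (a - b)" for a b
  proof -
    have "norm (F a - F b) \<le> K * norm (closest_point ?C a - closest_point ?C b)"
      unfolding F_def by (rule lip[OF cp cp])
    also have "\<dots> \<le> K * norm (a - b)"
      using K closest_point_lipschitz[OF convex_cball closed_cball ne, of a b]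
      by (intro mult_left_mono) (auto simp: dist_norm)
    finally show ?thesis .
  qed
  have Fc: "continuous_on UNIV F"
  proof (rule continuous_onI)
    fix u :: 'a and e :: real assume "e > 0"
    then show "\<exists>d>0. \<forall>u'\<in>UNIV. dist u' u < d \<longrightarrow> dist (F u') (F u) \<le> e"
      using K Flip by (intro exI[of _ "e / K"])
        (auto simp: dist_norm field_simps intro: order_trans[OF Flip])
  qed
  have "continuous_on ?C f" using smooth_on_continuous[OF f] r continuous_on_subset by blast
  from compact_imp_bounded[OF compact_continuous_image[OF this compact_cball]]
  obtain M where M: "M > 0" "\<And>u. u \<in> ?C \<Longrightarrow> norm (f u) \<le> M"
    unfolding bounded_pos by force
  have FM: "norm (F u) \<le> M" for u unfolding F_def by (rule M(2)[OF cp])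
  \<comment> \<open>Two integrals over intervals of length at most 2 * \<delta> are estimated,
    whence the factor 4. The first entry gives the contraction factor 1 / 2, the second keeps the
    curve within distance r of u0.\<close>
  define \<delta> where "\<delta> = min (1 / (8 * K)) (r / (4 * M))"
  have \<delta>: "\<delta> > 0" "4 * \<delta> * K \<le> 1 / 2" "4 * \<delta> * M \<le> r"
  proof -
    show "\<delta> > 0" using K M r by (simp add: \<delta>_def)
    have "\<delta> * (8 * K) \<le> 1" "\<delta> * (4 * M) \<le> r"
      using K M by (simp_all add: \<delta>_def pos_le_divide_eq[symmetric])
    then show "4 * \<delta> * K \<le> 1 / 2" "4 * \<delta> * M \<le> r" by auto
  qed
  \<comment> \<open>Clamping time to [-\<delta>, \<delta>] gives curves on the whole line. The
    integral starts at -\<delta> and \<open>J g 0\<close> is subtracted, which treats negative and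
    positive times alike.\<close>
  define cl where "cl s = max (-\<delta>) (min \<delta> s)" for s
  have cl: "cl s \<in> {-\<delta>..\<delta>}" "continuous_on UNIV cl" for s
    using \<delta>(1) by (auto simp: cl_def intro!: continuous_intros)
  define J where "J g s = integral {-\<delta>..s} (\<lambda>t. F (g t))" for g s
  define P where "P g s = u0 + (J g (cl s) - J g 0)" for g s
  have Fg: "continuous_on S (\<lambda>t. F (g t))" if "continuous_on UNIV g" for g :: "real \<Rightarrow> 'a" and S
    by (rule continuous_on_compose2[OF Fc continuous_on_subset[OF that]]) auto
  have Jc: "continuous_on {-\<delta>..\<delta>} (J g)" if "continuous_on UNIV g" for g
    unfolding J_def by (intro indefinite_integral_continuous_1 integrable_continuous_real Fg that)
  have Jb: "norm (J g s) \<le> 2 * \<delta> * M" if "continuous_on UNIV g" "s \<in> {-\<delta>..\<delta>}" for g s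
  proof -
    have "norm (J g s) \<le> M * (s - (-\<delta>))"
      unfolding J_def using that FM by (intro integral_bound Fg) auto
    also have "\<dots> \<le> M * (2 * \<delta>)" using M that by (intro mult_left_mono) auto
    finally show ?thesis by (simp add: algebra_simps)
  qed
  have Pb: "norm (P g s - u0) \<le> r" if "continuous_on UNIV g" for g s
  proof -
    have "norm (P g s - u0) \<le> norm (J g (cl s)) + norm (J g 0)"
      by (simp add: P_def norm_triangle_ineq4)
    also have "\<dots> \<le> 2 * \<delta> * M + 2 * \<delta> * M"
      using \<delta>(1) cl(1) by (intro add_mono Jb that) auto
    also have "\<dots> = 4 * \<delta> * M" by simp
    finally show ?thesis using \<delta>(3) by linarith
  qed
  have Pc: "P g \<in> bcontfun" if "continuous_on UNIV g" for g
  proof (rule bcontfun_normI)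
    show "continuous_on UNIV (P g)"
      unfolding P_def
      by (intro continuous_intros continuous_on_compose2[OF Jc[OF that] cl(2)]) (use cl(1) in auto)
    show "norm (P g s) \<le> norm u0 + r" for s
      using Pb[OF that, of s] norm_triangle_sub[of "P g s" u0] by simp
  qed
  define T where "T g = Bcontfun (P (apply_bcontfun g))" for g
  have T: "apply_bcontfun (T g) = P (apply_bcontfun g)" for g
    unfolding T_def by (intro Bcontfun_inverse Pc) simp
  have "dist (T g) (T h) \<le> 1 / 2 * dist g h" for g h
  proof (rule dist_bound)
    fix s
    let ?g = "apply_bcontfun g" and ?h = "apply_bcontfun h"
    have J2: "norm (J ?g s - J ?h s) \<le> 2 * \<delta> * (K * dist g h)" if "s \<in> {-\<delta>..\<delta>}" for s
    proof -
      have "J ?g s - J ?h s = integral {-\<delta>..s} (\<lambda>t. F (?g t) - F (?h t))"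
        unfolding J_def by (intro integral_diff[symmetric] integrable_continuous_real Fg) auto
      also have "norm \<dots> \<le> (K * dist g h) * (s - (-\<delta>))"
      proof (intro integral_bound ballI)
        fix t
        have "norm (F (?g t) - F (?h t)) \<le> K * dist (?g t) (?h t)"
          unfolding dist_norm by (rule Flip)
        also have "\<dots> \<le> K * dist g h" using K dist_bounded by (intro mult_left_mono) auto
        finally show "norm (F (?g t) - F (?h t)) \<le> K * dist g h" .
      qed (use that in \<open>auto intro!: continuous_intros Fg\<close>)
      also have "\<dots> \<le> (K * dist g h) * (2 * \<delta>)"
        using that K by (intro mult_left_mono) auto
      finally show ?thesis by (simp add: algebra_simps)
    qed
    have "dist (apply_bcontfun (T g) s) (apply_bcontfun (T h) s) =
        norm ((J ?g (cl s) - J ?h (cl s)) - (J ?g 0 - J ?h 0))"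
      by (simp add: T P_def dist_norm algebra_simps)
    also have "\<dots> \<le> 2 * \<delta> * (K * dist g h) + 2 * \<delta> * (K * dist g h)"
      using \<delta>(1) cl(1) by (intro order_trans[OF norm_triangle_ineq4] add_mono J2) auto
    also have "\<dots> = (4 * \<delta> * K) * dist g h" by simp
    also have "\<dots> \<le> 1 / 2 * dist g h" using \<delta>(2) by (intro mult_right_mono) auto
    finally show "dist (apply_bcontfun (T g) s) (apply_bcontfun (T h) s) \<le> 1 / 2 * dist g h" .
  qed
  then have "\<exists>!g. T g = g"
    by (intro banach_fix_type[of "1/2" T] allI) simp_all
  then obtain g where "T g = g" by blast
  define \<gamma> where "\<gamma> = apply_bcontfun g"
  have \<gamma>c: "continuous_on UNIV \<gamma>" by (simp add: \<gamma>_def)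
  have \<gamma>: "\<gamma> s = P \<gamma> s" for s using T[of g] \<open>T g = g\<close> by (simp add: \<gamma>_def)
  have \<gamma>C: "\<gamma> s \<in> ?C" for s
    using Pb[OF \<gamma>c, of s] \<gamma>[of s] by (simp add: dist_norm norm_minus_commute)
  show thesis
  proof (rule that[OF \<delta>(1)])
    show "\<gamma> 0 = u0" using \<gamma>[of 0] \<delta>(1) by (simp add: P_def cl_def)
    show "\<gamma> s \<in> V" for s using \<gamma>C r by blast
    fix s assume s: "s \<in> {-\<delta><..<\<delta>}"
    have "(J \<gamma> has_vector_derivative F (\<gamma> s)) (at s within {-\<delta>..\<delta>})"
      unfolding J_def by (rule integral_has_vector_derivative[OF Fg[OF \<gamma>c]]) (use s in auto)
    then have "(J \<gamma> has_vector_derivative F (\<gamma> s)) (at s)"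
      using s by (simp add: at_within_Icc_at)
    then have "((\<lambda>s. u0 + (J \<gamma> s - J \<gamma> 0)) has_vector_derivative 0 + (F (\<gamma> s) - 0)) (at s)"
      by (intro derivative_intros)
    then have "((\<lambda>s. u0 + (J \<gamma> s - J \<gamma> 0)) has_vector_derivative f (\<gamma> s)) (at s)"
      using \<gamma>C by (simp add: F_def closest_point_self)
    then show "(\<gamma> has_vector_derivative f (\<gamma> s)) (at s)"
      by (rule has_vector_derivative_transform_within_open[where S = "{-\<delta><..<\<delta>}"])
        (use s \<gamma> in \<open>auto simp: P_def cl_def\<close>)
  qed
qed

section \<open>The scalar products\<close>

lemma ip_commute: "ip c v w = ip c w v"
  by (simp add: ip_def inner_commute)

lemma bounded_bilinear_ip: "bounded_bilinear (ip c)"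
proof (rule bounded_bilinear.intro)
  show "\<exists>K. \<forall>a b. norm (ip c a b) \<le> norm a * norm b * K"
  proof (intro exI allI)
    fix a b :: "real \<times> (real^'d)"
    have n: "\<bar>fst a\<bar> \<le> norm a" "\<bar>fst b\<bar> \<le> norm b" "norm (snd a) \<le> norm a" "norm (snd b) \<le> norm b"
      using norm_fst_le[of "fst a" "snd a"] norm_fst_le[of "fst b" "snd b"]
        norm_snd_le[of "snd a" "fst a"] norm_snd_le[of "snd b" "fst b"] by simp_all
    have "norm (ip c a b) \<le> \<bar>c\<bar> * (\<bar>fst a\<bar> * \<bar>fst b\<bar>) + norm (snd a) * norm (snd b)"
      unfolding ip_def
      using norm_triangle_ineq[of "c * (fst a * fst b)" "snd a \<bullet> snd b"]
        Cauchy_Schwarz_ineq2[of "snd a" "snd b"] by (simp add: abs_mult)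
    also have "\<dots> \<le> \<bar>c\<bar> * (norm a * norm b) + norm a * norm b"
      using n by (intro add_mono mult_left_mono mult_mono) auto
    finally show "norm (ip c a b) \<le> norm a * norm b * (\<bar>c\<bar> + 1)"
      by (simp add: algebra_simps)
  qed
qed (auto simp: ip_def algebra_simps inner_simps)

interpretation ip: bounded_bilinear "ip c" for c
  by (rule bounded_bilinear_ip)

lemmas ip_simps = ip.add_left ip.add_right ip.diff_left ip.diff_right ip.scaleR_left ip.scaleR_right
  ip.minus_left ip.minus_right ip.zero_left ip.zero_right

lemma ip_nondegenerate:
  assumes "c \<in> {-1, 1}" "\<And>z. ip c v z = 0"
  shows "v = 0"
proof -
  \<comment> \<open>Testing v against itself with the first coordinate multiplied by c yields its
    Euclidean square norm.\<close>
  have "c * (fst v * (c * fst v)) + snd v \<bullet> snd v = 0"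
    using assms(2)[of "(c * fst v, snd v)"] by (simp add: ip_def)
  moreover have "c * (fst v * (c * fst v)) = (fst v)\<^sup>2"
    using assms(1) by (auto simp: power2_eq_square)
  ultimately have "(fst v)\<^sup>2 + (norm (snd v))\<^sup>2 = 0" by (simp add: power2_norm_eq_inner)
  then show ?thesis by (simp add: prod_eq_iff add_nonneg_eq_0_iff)
qed

text \<open>For c = -1 the vector x is timelike, and its complement is spacelike by Cauchy-Schwarz
  in the remaining coordinates, where the square norm of snd x is one less than the square of fst x.
  This makes the metric of M positive definite for both signs of c.\<close>

lemma ip_positive:
  assumes c: "c \<in> {-1, 1}" and x: "ip c x x = c" and v: "ip c v x = 0" "v \<noteq> 0"
  shows "ip c v v > 0"
proof (cases "c = 1")
  case True
  have "fst v \<noteq> 0 \<or> snd v \<noteq> 0" using v by (simp add: prod_eq_iff)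
  then have "0 < fst v * fst v \<or> 0 < snd v \<bullet> snd v"
    by (metis inner_gt_zero_iff not_real_square_gt_zero)
  then show ?thesis
    using True inner_ge_zero[of "snd v"] zero_le_square[of "fst v"]
    unfolding ip_def by (metis add_nonneg_pos add_pos_nonneg mult_1)
next
  case False
  then have [simp]: "c = -1" using c by auto
  have x1: "(fst x)\<^sup>2 = (norm (snd x))\<^sup>2 + 1"
    using x by (simp add: ip_def dot_square_norm power2_eq_square)
  have "fst v * fst x = snd v \<bullet> snd x" using v by (simp add: ip_def)
  then have "(fst v)\<^sup>2 * (fst x)\<^sup>2 = (snd v \<bullet> snd x)\<^sup>2" by (metis power_mult_distrib)
  also have "\<dots> \<le> (norm (snd v))\<^sup>2 * (norm (snd x))\<^sup>2"
    using Cauchy_Schwarz_ineq[of "snd v" "snd x"] by (simp add: power2_norm_eq_inner)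
  finally have *: "(fst v)\<^sup>2 * ((norm (snd x))\<^sup>2 + 1) \<le> (norm (snd v))\<^sup>2 * (norm (snd x))\<^sup>2"
    by (simp add: x1)
  show ?thesis
  proof (rule ccontr)
    assume "\<not> ip c v v > 0"
    then have le: "(norm (snd v))\<^sup>2 \<le> (fst v)\<^sup>2"
      by (simp add: ip_def dot_square_norm power2_eq_square)
    then have "(norm (snd v))\<^sup>2 * (norm (snd x))\<^sup>2 \<le> (fst v)\<^sup>2 * (norm (snd x))\<^sup>2"
      by (intro mult_right_mono) auto
    with * have "(fst v)\<^sup>2 + (fst v)\<^sup>2 * (norm (snd x))\<^sup>2 \<le> (fst v)\<^sup>2 * (norm (snd x))\<^sup>2"
      by (simp only: distrib_left mult_1_right add.commute)
    then have "(fst v)\<^sup>2 \<le> 0" by linarith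
    with le have "fst v = 0" "snd v = 0" by auto
    with v show False by (simp add: prod_eq_iff)
  qed
qed

section \<open>Derivatives of products and of moving directions\<close>

lemma smooth_on_ip:
  "open U \<Longrightarrow> smooth_on U f \<Longrightarrow> smooth_on U g \<Longrightarrow> smooth_on U (\<lambda>u. ip c (f u) (g u))"
  unfolding smooth_on_def using Ck_on_bilinear[OF bounded_bilinear_ip] by blast

lemma FD_ip:
  assumes "f differentiable (at u)" "g differentiable (at u)"
  shows "FD (\<lambda>z. ip c (f z) (g z)) u w = ip c (FD f u w) (g u) + ip c (f u) (FD g u w)"
  using FD_eqI[OF ip.FDERIV[OF FD_worksD[OF assms(1)] FD_worksD[OF assms(2)]]]
  by (simp add: fun_eq_iff)

lemma FD_scaleR:
  assumes "f differentiable (at u)" "g differentiable (at u)"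
  shows "FD (\<lambda>z. f z *\<^sub>R g z) u w = FD f u w *\<^sub>R g u + f u *\<^sub>R FD g u w"
  using FD_eqI[OF bounded_bilinear.FDERIV[OF bounded_bilinear_scaleR FD_worksD[OF assms(1)] FD_worksD[OF assms(2)]]]
  by (simp add: fun_eq_iff add.commute)

lemma FD_FD_var:
  fixes f :: "'a::euclidean_space \<Rightarrow> 'b::real_normed_vector"
  assumes V: "open V" "u \<in> V" and f: "smooth_on V f" and g: "smooth_on V g"
  shows "FD (\<lambda>z. FD f z (g z)) u w = FD (\<lambda>z. FD f z (g u)) u w + FD f u (FD g u w)"
proof -
  have ex: "(\<Sum>b\<in>Basis. (v \<bullet> b) *\<^sub>R FD f z b) = FD f z v" if "z \<in> V" for z v
    using linear_basis_expand[OF smooth_on_linear_FD[OF f that]] by metis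
  have dg: "g differentiable (at u)" using smooth_on_differentiable[OF g V(2)] .
  have ddf: "((\<lambda>z. FD f z v) has_derivative FD (\<lambda>z. FD f z v) u) (at u)" for v
    using smooth_on_has_derivative[OF smooth_on_FD[OF f] V(2)] .
  have A: "((\<lambda>z. \<Sum>b\<in>Basis. (g z \<bullet> b) *\<^sub>R FD f z b) has_derivative
      (\<lambda>w. \<Sum>b\<in>Basis. (g u \<bullet> b) *\<^sub>R FD (\<lambda>z. FD f z b) u w + (FD g u w \<bullet> b) *\<^sub>R FD f u b)) (at u)"
    by (intro has_derivative_sum has_derivative_scaleR has_derivative_inner_left FD_worksD[OF dg] ddf)
  have B: "((\<lambda>z. \<Sum>b\<in>Basis. (g u \<bullet> b) *\<^sub>R FD f z b) has_derivative
      (\<lambda>w. \<Sum>b\<in>Basis. (g u \<bullet> b) *\<^sub>R FD (\<lambda>z. FD f z b) u w)) (at u)"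
    by (intro has_derivative_sum has_derivative_scaleR_right ddf)
  have "FD (\<lambda>z. FD f z (g z)) u w = FD (\<lambda>z. \<Sum>b\<in>Basis. (g z \<bullet> b) *\<^sub>R FD f z b) u w"
    by (rule fun_cong[OF FD_cong_open[OF V]]) (simp add: ex)
  also have "\<dots> = FD (\<lambda>z. \<Sum>b\<in>Basis. (g u \<bullet> b) *\<^sub>R FD f z b) u w + FD f u (FD g u w)"
    unfolding FD_eqI[OF A] FD_eqI[OF B] by (simp add: sum.distrib ex[OF V(2)])
  also have "FD (\<lambda>z. \<Sum>b\<in>Basis. (g u \<bullet> b) *\<^sub>R FD f z b) u w = FD (\<lambda>z. FD f z (g u)) u w"
    by (rule fun_cong[OF FD_cong_open[OF V]]) (simp add: ex)
  finally show ?thesis .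
qed

section \<open>Hypersurfaces of space forms in a chart\<close>

locale hypersurface_chart =
  fixes c :: real and V :: "'p::euclidean_space set" and X Nu :: "'p \<Rightarrow> real \<times> (real^'d)"
  assumes open_V: "open V" and c: "c \<in> {-1, 1}"
    and smX: "smooth_on V X" and smN: "smooth_on V Nu"
    and XX: "u \<in> V \<Longrightarrow> ip c (X u) (X u) = c"
    and inj_FD_X: "u \<in> V \<Longrightarrow> inj (FD X u)"
    and NN: "u \<in> V \<Longrightarrow> ip c (Nu u) (Nu u) = 1"
    and NX: "u \<in> V \<Longrightarrow> ip c (Nu u) (X u) = 0"
    and NDX: "u \<in> V \<Longrightarrow> ip c (Nu u) (FD X u v) = 0"
    and dim: "DIM('p) + 1 = CARD('d)"
begin

lemma cc: "c * c = 1" and c_ne_0: "c \<noteq> 0"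
  using c by auto

lemma FD_ip_V:
  assumes "u \<in> V" "smooth_on V f" "smooth_on V g"
  shows "FD (\<lambda>z. ip c (f z) (g z)) u w = ip c (FD f u w) (g u) + ip c (f u) (FD g u w)"
  using assms by (intro FD_ip smooth_on_differentiable)

lemma FD_ip_const:
  assumes "u \<in> V" "smooth_on V f" "smooth_on V g" "\<And>z. z \<in> V \<Longrightarrow> ip c (f z) (g z) = k"
  shows "ip c (FD f u w) (g u) + ip c (f u) (FD g u w) = 0"
proof -
  have "FD (\<lambda>z. ip c (f z) (g z)) u = FD (\<lambda>z. k) u"
    by (rule FD_cong_open[OF open_V assms(1)]) (rule assms(4))
  then show ?thesis using FD_ip_V[OF assms(1-3), of w] by simp
qed

lemma FD_eq_on_V:
  "u \<in> V \<Longrightarrow> (\<And>z. z \<in> V \<Longrightarrow> g z = h z) \<Longrightarrow> FD g u w = FD h u w"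
  using FD_cong_open[OF open_V] by metis

lemma DXX: "u \<in> V \<Longrightarrow> ip c (FD X u v) (X u) = 0"
  using FD_ip_const[OF _ smX smX XX, of u v] by (simp add: ip_commute)

lemma DNN: "u \<in> V \<Longrightarrow> ip c (FD Nu u v) (Nu u) = 0"
  using FD_ip_const[OF _ smN smN NN, of u v] by (simp add: ip_commute)

lemma DNX: "u \<in> V \<Longrightarrow> ip c (FD Nu u v) (X u) = 0"
  using FD_ip_const[OF _ smN smX NX, of u v] NDX[of u v] by simp

lemma DXN: "u \<in> V \<Longrightarrow> ip c (FD X u v) (Nu u) = 0"
  using NDX by (simp add: ip_commute)

text \<open>Differentiating <Nu, dX w> = 0 along v expresses both sides by second derivatives of X,
  which are symmetric.\<close>

lemma second_fundamental_form_symmetric: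
  assumes "u \<in> V"
  shows "ip c (FD Nu u v) (FD X u w) = ip c (FD Nu u w) (FD X u v)"
proof -
  have "ip c (FD Nu u v) (FD X u w) = - ip c (Nu u) (FD (\<lambda>z. FD X z w) u v)" for v w
    using FD_ip_const[OF assms smN smooth_on_FD[OF smX, of w] NDX, of v] by simp
  then show ?thesis using FD_symmetric[OF open_V assms smX] by simp
qed

lemma linX: "u \<in> V \<Longrightarrow> linear (FD X u)" and linN: "u \<in> V \<Longrightarrow> linear (FD Nu u)"
  using smooth_on_linear_FD smX smN by blast+

text \<open>The splitting of the ambient space into tangent space, normal line and position line.
  Its inverse gives tangential coordinates that depend smoothly on u by
  \<open>smooth_on_inverse_operator\<close>.\<close>

definition frame_map :: "'p \<Rightarrow> 'p \<times> real \<times> real \<Rightarrow> real \<times> (real^'d)" where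
  "frame_map u = (\<lambda>(v, a, b). FD X u v + a *\<^sub>R Nu u + b *\<^sub>R X u)"

lemma linear_frame_map: "u \<in> V \<Longrightarrow> linear (frame_map u)"
  unfolding frame_map_def
  by (rule linearI) (auto simp: linear_add[OF linX] linear_scale[OF linX] algebra_simps)

lemma bij_frame_map:
  assumes u: "u \<in> V" shows "bij (frame_map u)"
proof -
  have "inj (frame_map u)"
    unfolding linear_injective_0[OF linear_frame_map[OF u]]
  proof (intro allI impI)
    fix y :: "'p \<times> real \<times> real" assume y: "frame_map u y = 0"
    obtain v a b where [simp]: "y = (v, a, b)" by (cases y) auto
    have z: "FD X u v + a *\<^sub>R Nu u + b *\<^sub>R X u = 0" using y by (simp add: frame_map_def)
    have "a = ip c (Nu u) (FD X u v + a *\<^sub>R Nu u + b *\<^sub>R X u)"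
      by (simp add: ip_simps NDX NN NX u)
    then have a: "a = 0" unfolding z by (simp add: ip_simps)
    have "b * c = ip c (X u) (FD X u v + a *\<^sub>R Nu u + b *\<^sub>R X u)"
      using DXX[OF u, of v] NX[OF u] by (simp add: ip_simps XX u ip_commute)
    then have b: "b = 0" unfolding z using c_ne_0 by (simp add: ip_simps)
    have "FD X u v = FD X u 0" using z a b by (simp add: linear_0[OF linX[OF u]])
    then have "v = 0" using inj_FD_X[OF u] by (simp add: inj_eq)
    with a b show "y = 0" by (simp add: zero_prod_def)
  qed
  moreover have "DIM('p \<times> real \<times> real) = DIM(real \<times> (real^'d))" using dim by simp
  ultimately have "surj (frame_map u)"
    using linear_injective_imp_surjective[OF linear_frame_map[OF u]] by simp
  with \<open>inj (frame_map u)\<close> show ?thesis by (rule bijI)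
qed

text \<open>Coordinates in the parameter space of the tangential part of an ambient vector.\<close>
definition tc :: "'p \<Rightarrow> real \<times> (real^'d) \<Rightarrow> 'p" where
  "tc u z = fst (inv (frame_map u) z)"

lemma tc_frame: "u \<in> V \<Longrightarrow> tc u (FD X u v + a *\<^sub>R Nu u + b *\<^sub>R X u) = v"
  using inv_f_f[OF bij_is_inj[OF bij_frame_map], of u "(v, a, b)"] by (simp add: tc_def frame_map_def)

lemma tc_FD: "u \<in> V \<Longrightarrow> tc u (FD X u v) = v"
  using tc_frame[of u v 0 0] by simp

lemma FD_tc:
  assumes u: "u \<in> V" and z: "ip c z (Nu u) = 0" "ip c z (X u) = 0"
  shows "FD X u (tc u z) = z"
proof -
  obtain v a b where vab: "inv (frame_map u) z = (v, a, b)" by (metis prod_cases3)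
  have fz: "z = FD X u v + a *\<^sub>R Nu u + b *\<^sub>R X u"
    using surj_f_inv_f[OF bij_is_surj[OF bij_frame_map[OF u]], of z] vab by (simp add: frame_map_def)
  have "a = 0" using z(1) unfolding fz by (simp add: ip_simps DXN NN NX u ip_commute[of _ "X u" "Nu u"])
  moreover have "b = 0" using z(2) c_ne_0 unfolding fz by (simp add: ip_simps DXX NX XX u)
  ultimately show ?thesis using fz vab by (simp add: tc_def)
qed

lemma smooth_on_tc:
  assumes "smooth_on V z" shows "smooth_on V (\<lambda>u. tc u (z u))"
proof -
  have lin: "linear (inv (frame_map u))" if "u \<in> V" for u
    by (rule linear_inv[OF linear_frame_map[OF that] bij_frame_map[OF that]])
  have s: "smooth_on V (\<lambda>u. frame_map u v)" for v
    unfolding frame_map_def using smX smN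
    by (cases v) (auto intro!: smooth_on_add smooth_on_scaleR smooth_on_const open_V smooth_on_FD)
  have "smooth_on V (\<lambda>u. \<Sum>b\<in>Basis. (z u \<bullet> b) *\<^sub>R inv (frame_map u) b)"
    by (intro smooth_on_sum smooth_on_scaleR smooth_on_inner smooth_on_const open_V assms
        smooth_on_inverse_operator s linear_frame_map bij_frame_map)
  then have sm: "smooth_on V (\<lambda>u. fst (\<Sum>b\<in>Basis. (z u \<bullet> b) *\<^sub>R inv (frame_map u) b))"
    by (rule smooth_on_bounded_linear[OF bounded_linear_fst open_V])
  show ?thesis
  proof (rule smooth_on_cong[OF open_V _ sm])
    fix u assume "u \<in> V"
    from linear_basis_expand[OF lin[OF this], of "z u"]
    show "fst (\<Sum>b\<in>Basis. (z u \<bullet> b) *\<^sub>R inv (frame_map u) b) = tc u (z u)"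
      unfolding tc_def by (rule arg_cong[OF sym])
  qed
qed

lemma linear_tc:
  assumes "u \<in> V" shows "linear (tc u)"
proof -
  have "linear (inv (frame_map u))"
    by (rule linear_inv[OF linear_frame_map[OF assms] bij_frame_map[OF assms]])
  from linear_compose[OF this bounded_linear.linear[OF bounded_linear_fst]]
  show ?thesis by (simp add: tc_def[abs_def] o_def)
qed

lemma tangent_positive:
  "u \<in> V \<Longrightarrow> ip c v (X u) = 0 \<Longrightarrow> v \<noteq> 0 \<Longrightarrow> ip c v v > 0"
  using ip_positive[OF c XX] by blast

text \<open>z is itself tangent, so w may be its own coordinate vector \<open>tc u z\<close>, and
  positivity applies.\<close>

lemma tangent_eq_0:
  assumes u: "u \<in> V" and z: "ip c z (Nu u) = 0" "ip c z (X u) = 0"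
    and o: "\<And>w. ip c z (FD X u w) = 0"
  shows "z = 0"
  using tangent_positive[OF u z(2)] o[of "tc u z"] FD_tc[OF u z] by fastforce

end

section \<open>The biconservative equation in a chart\<close>

locale biconservative_chart = hypersurface_chart c V X Nu
  for c V and X Nu :: "'p::euclidean_space \<Rightarrow> real \<times> (real^'d)" +
  fixes f W :: "'p \<Rightarrow> real" and e :: "'p \<Rightarrow> real \<times> (real^'d)" and a :: real
  assumes smf: "smooth_on V f" and smW: "smooth_on V W" and sme: "smooth_on V e"
    and W: "u \<in> V \<Longrightarrow> W u > 0" and ee: "u \<in> V \<Longrightarrow> ip c (e u) (e u) = 1"
    and eN: "u \<in> V \<Longrightarrow> ip c (e u) (Nu u) = 0" and eX: "u \<in> V \<Longrightarrow> ip c (e u) (X u) = 0"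
    and Df: "u \<in> V \<Longrightarrow> FD f u v = W u * ip c (e u) (FD X u v)"
    and a: "a \<noteq> 0"
    and biconservative: "u \<in> V \<Longrightarrow> FD Nu u (tc u (e u)) = (a * f u) *\<^sub>R e u"
begin

definition \<eta> :: "'p \<Rightarrow> 'p" where "\<eta> u = tc u (e u)"
text \<open>In the application f is H, a is n / 2 and W is |grad H|. As \<open>FD Nu\<close> is
  minus the shape operator, the biconservative equation says that e is a principal direction with
  curvature -k.\<close>

definition k :: "'p \<Rightarrow> real" where "k u = a * f u"
text \<open>The derivative of e along its own curves has scalar product -k with Nu and -1 with X.
  The added terms cancel these components, using c * c = 1, and leave the part tangent to M.\<close>

definition Z :: "'p \<Rightarrow> real \<times> (real^'d)" where
  "Z u = FD e u (\<eta> u) + k u *\<^sub>R Nu u + c *\<^sub>R X u"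
definition \<zeta> :: "'p \<Rightarrow> 'p" where "\<zeta> u = tc u (Z u)"

lemma sm_\<eta>: "smooth_on V \<eta>"
  unfolding \<eta>_def by (intro smooth_on_tc sme)

lemma sm_k: "smooth_on V k"
  unfolding k_def by (intro smooth_on_mult smooth_on_const smf open_V)

lemma sm_Z: "smooth_on V Z"
  unfolding Z_def
  by (intro smooth_on_add smooth_on_scaleR smooth_on_const smooth_on_FD_var open_V sme sm_\<eta> sm_k smX smN)

lemma sm_\<zeta>: "smooth_on V \<zeta>"
  unfolding \<zeta>_def by (intro smooth_on_tc sm_Z)

lemma DX\<eta>: "u \<in> V \<Longrightarrow> FD X u (\<eta> u) = e u"
  unfolding \<eta>_def by (intro FD_tc eN eX)

lemma DN\<eta>: "u \<in> V \<Longrightarrow> FD Nu u (\<eta> u) = k u *\<^sub>R e u"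
  unfolding \<eta>_def k_def by (rule biconservative)

lemma Dk: "u \<in> V \<Longrightarrow> FD k u v = a * W u * ip c (e u) (FD X u v)"
  unfolding k_def[abs_def] using FD_bounded_linear[OF bounded_linear_mult_right smooth_on_differentiable[OF smf]] Df
  by simp

lemma DNe: "u \<in> V \<Longrightarrow> ip c (FD Nu u v) (e u) = k u * ip c (e u) (FD X u v)"
  using second_fundamental_form_symmetric[of u v "\<eta> u"] by (simp add: DX\<eta> DN\<eta> ip_simps)

lemma Dee: "u \<in> V \<Longrightarrow> ip c (FD e u v) (e u) = 0"
  using FD_ip_const[OF _ sme sme ee, of u v] by (simp add: ip_commute)

lemma DeN: "u \<in> V \<Longrightarrow> ip c (FD e u v) (Nu u) = - (k u * ip c (e u) (FD X u v))"
  using FD_ip_const[OF _ sme smN eN, of u v] DNe[of u v] by (simp add: ip_commute)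

lemma DeX: "u \<in> V \<Longrightarrow> ip c (FD e u v) (X u) = - ip c (e u) (FD X u v)"
  using FD_ip_const[OF _ sme smX eX, of u v] by simp

lemma ZN: "u \<in> V \<Longrightarrow> ip c (Z u) (Nu u) = 0"
  by (simp add: Z_def ip_simps DeN DX\<eta> ee NN NX ip_commute[of c "X u" "Nu u"])

lemma ZX: "u \<in> V \<Longrightarrow> ip c (Z u) (X u) = 0"
  by (simp add: Z_def ip_simps DeX DX\<eta> ee NX XX cc)

lemma Ze: "u \<in> V \<Longrightarrow> ip c (Z u) (e u) = 0"
  using eN[of u] eX[of u] Dee[of u "\<eta> u"] by (simp add: Z_def ip_simps ip_commute)

lemma DX\<zeta>: "u \<in> V \<Longrightarrow> FD X u (\<zeta> u) = Z u"
  unfolding \<zeta>_def by (intro FD_tc ZN ZX)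

lemma Dk\<eta>: "u \<in> V \<Longrightarrow> FD k u (\<eta> u) = a * W u"
  by (simp add: Dk DX\<eta> ee)

lemma De_expand:
  assumes "u \<in> V"
  shows "FD e u w = FD (\<lambda>z. FD X z (\<eta> u)) u w + FD X u (FD \<eta> u w)"
proof -
  have "FD e u w = FD (\<lambda>z. FD X z (\<eta> z)) u w"
    by (rule FD_eq_on_V[OF assms]) (simp add: DX\<eta>)
  then show ?thesis by (simp add: FD_FD_var[OF open_V assms smX sm_\<eta>])
qed

lemma DZ_expand:
  assumes "u \<in> V"
  shows "FD Z u w = FD (\<lambda>z. FD X z (\<zeta> u)) u w + FD X u (FD \<zeta> u w)"
proof -
  have "FD Z u w = FD (\<lambda>z. FD X z (\<zeta> z)) u w"
    by (rule FD_eq_on_V[OF assms]) (simp add: DX\<zeta>)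
  then show ?thesis by (simp add: FD_FD_var[OF open_V assms smX sm_\<zeta>])
qed

text \<open>An eigenvector relation of the shape operator, differentiated in direction w. It serves
  for the pairs (\<eta>, e) and (\<zeta>, Z).\<close>

lemma DDN_eigen:
  assumes u: "u \<in> V" and y: "smooth_on V y" and Y: "smooth_on V Y"
    and eig: "\<And>z. z \<in> V \<Longrightarrow> FD Nu z (y z) = k z *\<^sub>R Y z"
  shows "FD (\<lambda>z. FD Nu z (y u)) u w + FD Nu u (FD y u w) = FD k u w *\<^sub>R Y u + k u *\<^sub>R FD Y u w"
proof -
  have "FD (\<lambda>z. FD Nu z (y z)) u w = FD (\<lambda>z. k z *\<^sub>R Y z) u w"
    by (rule FD_eq_on_V[OF u eig])
  then show ?thesis
    using FD_FD_var[OF open_V u smN y, of w]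
      FD_scaleR[OF smooth_on_differentiable[OF sm_k u] smooth_on_differentiable[OF Y u], of w]
    by simp
qed

lemmas DDN\<eta> = DDN_eigen[OF _ sm_\<eta> sme DN\<eta>]

text \<open>The \<open>e\<^sub>1\<close>-component of the Codazzi equation: \<^term>\<open>Z\<close>, the tangential acceleration of the
  curves of \<open>e\<^sub>1\<close>, is an eigenvector of the shape operator for the same eigenvalue as \<open>e\<^sub>1\<close>.\<close>
lemma DN\<zeta>:
  assumes u: "u \<in> V" shows "FD Nu u (\<zeta> u) = k u *\<^sub>R Z u"
proof -
  \<comment> \<open>The relation \<open>DNe\<close> is differentiated along \<open>\<eta> u\<close>;
    the eigenvector relation of e is differentiated along w and paired with e. By symmetry both
    contain the same second derivatives of Nu and X, and the terms with dk cancel because both equal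
    a W <e, dX w>.\<close>
  have main: "ip c (FD Nu u w) (Z u) = k u * ip c (Z u) (FD X u w)" for w
  proof -
    let ?h = "\<eta> u"
    have "ip c (FD (\<lambda>z. FD Nu z w) u ?h) (e u) + ip c (FD Nu u w) (FD e u ?h) =
        FD (\<lambda>z. ip c (FD Nu z w) (e z)) u ?h"
      by (rule FD_ip_V[OF u smooth_on_FD[OF smN] sme, symmetric])
    also have "\<dots> = FD (\<lambda>z. k z *\<^sub>R ip c (e z) (FD X z w)) u ?h"
      by (rule FD_eq_on_V[OF u]) (simp add: DNe)
    also have "\<dots> = FD k u ?h * ip c (e u) (FD X u w)
        + k u * (ip c (FD e u ?h) (FD X u w) + ip c (e u) (FD (\<lambda>z. FD X z w) u ?h))"
      using FD_scaleR[OF smooth_on_differentiable[OF sm_k u]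
          smooth_on_differentiable[OF smooth_on_ip[OF open_V sme smooth_on_FD[OF smX, of w]] u], of c ?h]
        FD_ip_V[OF u sme smooth_on_FD[OF smX, of w], of ?h]
      by simp
    finally have 1: "ip c (FD (\<lambda>z. FD Nu z w) u ?h) (e u) + ip c (FD Nu u w) (FD e u ?h) = \<dots>" .
    have 2: "FD (\<lambda>z. FD Nu z w) u ?h = FD (\<lambda>z. FD Nu z ?h) u w"
      "FD (\<lambda>z. FD X z w) u ?h = FD (\<lambda>z. FD X z ?h) u w"
      using FD_symmetric[OF open_V u] smN smX by blast+
    have 3: "ip c (FD (\<lambda>z. FD Nu z ?h) u w) (e u) + k u * ip c (e u) (FD X u (FD \<eta> u w)) = FD k u w"
      using arg_cong[OF DDN\<eta>[OF u, of w], of "\<lambda>z. ip c z (e u)"]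
      by (simp add: ip_simps DNe ee Dee u)
    have 4: "ip c (e u) (FD (\<lambda>z. FD X z ?h) u w) + ip c (e u) (FD X u (FD \<eta> u w)) = 0"
      using Dee[OF u, of w] De_expand[OF u, of w] by (simp add: ip_simps ip_commute)
    have "ip c (FD Nu u w) (FD e u ?h) = k u * ip c (FD e u ?h) (FD X u w)"
    proof -
      have "ip c (e u) (FD (\<lambda>z. FD X z ?h) u w) = - ip c (e u) (FD X u (FD \<eta> u w))"
        using 4 by simp
      then show ?thesis using 1 3 Dk[OF u, of w] Dk\<eta>[OF u] unfolding 2 by (simp add: algebra_simps)
    qed
    moreover have "FD e u ?h = Z u - k u *\<^sub>R Nu u - c *\<^sub>R X u" by (simp add: Z_def)
    ultimately show ?thesis
      using DXX[OF u, of w] NDX[OF u, of w]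
      by (simp add: ip_simps DNN DNX u ip_commute[of c "X u"])
  qed
  have "FD Nu u (\<zeta> u) - k u *\<^sub>R Z u = 0"
  proof (rule tangent_eq_0[OF u])
    show "ip c (FD Nu u (\<zeta> u) - k u *\<^sub>R Z u) (FD X u w) = 0" for w
      using main[of w] second_fundamental_form_symmetric[OF u, of "\<zeta> u" w]
      by (simp add: ip_simps DX\<zeta> u)
  qed (simp_all add: ip_simps DNN DNX ZN ZX u)
  then show ?thesis by simp
qed

text \<open>The relation for Z is differentiated along e, and the one for e along Z, where k is
  stationary because Z is orthogonal to e. In the difference the second derivatives cancel and the
  bracket b of the two fields remains: dN b = dk(\<eta>) Z + k dX b. Paired with Z, self-adjointness
  removes both terms with b, and dk(\<eta>) = a W is nonzero.\<close>

lemma Z_eq_0: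
  assumes u: "u \<in> V" shows "Z u = 0"
proof -
  let ?h = "\<eta> u" and ?z = "\<zeta> u"
  define b where "b = FD \<zeta> u ?h - FD \<eta> u ?z"
  have 1: "FD (\<lambda>z. FD Nu z ?z) u ?h + FD Nu u (FD \<zeta> u ?h) = FD k u ?h *\<^sub>R Z u + k u *\<^sub>R FD Z u ?h"
    by (rule DDN_eigen[OF u sm_\<zeta> sm_Z DN\<zeta>])
  have 2: "FD (\<lambda>z. FD Nu z ?h) u ?z + FD Nu u (FD \<eta> u ?z) = k u *\<^sub>R FD e u ?z"
    using DDN\<eta>[OF u, of ?z] Ze[OF u] by (simp add: Dk DX\<zeta> u ip_commute)
  have 3: "FD (\<lambda>z. FD Nu z ?z) u ?h = FD (\<lambda>z. FD Nu z ?h) u ?z"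
    "FD (\<lambda>z. FD X z ?z) u ?h = FD (\<lambda>z. FD X z ?h) u ?z"
    using FD_symmetric[OF open_V u] smN smX by blast+
  have 4: "FD Z u ?h = FD e u ?z + FD X u b"
    unfolding DZ_expand[OF u] De_expand[OF u] 3 b_def by (simp add: linear_diff[OF linX[OF u]])
  have "FD Nu u b = FD k u ?h *\<^sub>R Z u + k u *\<^sub>R FD X u b"
  proof -
    have "FD Nu u (FD \<zeta> u ?h) = FD k u ?h *\<^sub>R Z u + k u *\<^sub>R (FD e u ?z + FD X u b)
        - FD (\<lambda>z. FD Nu z ?h) u ?z"
      using 1 unfolding 3 4 by (simp add: eq_diff_eq add.commute)
    moreover have "FD Nu u (FD \<eta> u ?z) = k u *\<^sub>R FD e u ?z - FD (\<lambda>z. FD Nu z ?h) u ?z"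
      using 2 by (simp add: eq_diff_eq add.commute)
    moreover have "FD Nu u b = FD Nu u (FD \<zeta> u ?h) - FD Nu u (FD \<eta> u ?z)"
      by (simp add: b_def linear_diff[OF linN[OF u]])
    ultimately show ?thesis by (simp add: scaleR_add_right)
  qed
  then have "ip c (FD Nu u b) (Z u) = FD k u ?h * ip c (Z u) (Z u) + k u * ip c (FD X u b) (Z u)"
    by (simp add: ip_simps)
  moreover have "ip c (FD Nu u b) (Z u) = k u * ip c (Z u) (FD X u b)"
    using second_fundamental_form_symmetric[OF u, of b ?z] by (simp add: DX\<zeta> DN\<zeta> u ip_simps)
  ultimately have "a * W u * ip c (Z u) (Z u) = 0"
    by (simp add: Dk\<eta> u ip_commute)
  then have "ip c (Z u) (Z u) = 0" using a W[OF u] by simp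
  then show ?thesis using tangent_positive[OF u ZX[OF u]] by force
qed

lemma De\<eta>: "u \<in> V \<Longrightarrow> FD e u (\<eta> u) = - k u *\<^sub>R Nu u - c *\<^sub>R X u"
  using Z_eq_0[of u] by (simp add: Z_def algebra_simps add_eq_0_iff2)

text \<open>The second derivative of f on \<eta> and w is computed in both orders. The term
  <de(\<eta>), dX w> vanishes because, by \<open>De\<eta>\<close>, the derivative of e along \<eta>
  is a combination of Nu and X. Thus dW is a multiple of df, as \<open>level_set_constancy\<close>
  asks.\<close>

lemma DW:
  assumes u: "u \<in> V"
  shows "FD W u w = FD W u (\<eta> u) * ip c (e u) (FD X u w)"
proof -
  have *: "FD (\<lambda>z. FD f z v) u w = FD W u w * ip c (e u) (FD X u v)
    + W u * (ip c (FD e u w) (FD X u v) + ip c (e u) (FD (\<lambda>z. FD X z v) u w))" for v w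
  proof -
    have "FD (\<lambda>z. FD f z v) u w = FD (\<lambda>z. W z *\<^sub>R ip c (e z) (FD X z v)) u w"
      by (rule FD_eq_on_V[OF u]) (simp add: Df)
    then show ?thesis
      using FD_scaleR[OF smooth_on_differentiable[OF smW u]
          smooth_on_differentiable[OF smooth_on_ip[OF open_V sme smooth_on_FD[OF smX, of v]] u], of c w]
        FD_ip_V[OF u sme smooth_on_FD[OF smX, of v], of w] by simp
  qed
  have "ip c (FD e u (\<eta> u)) (FD X u w) = 0"
    using DXX[OF u, of w] by (simp add: De\<eta> u ip_simps NDX ip_commute[of c "X u"])
  then show ?thesis
    using *[of "\<eta> u" w] *[of w "\<eta> u"] FD_symmetric[OF open_V u smf, of w "\<eta> u"]
      FD_symmetric[OF open_V u smX, of w "\<eta> u"]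
    by (simp add: DX\<eta> ee Dee u)
qed

end

section \<open>The flow box\<close>

text \<open>The derivative of \<gamma> is g after \<gamma>, hence as regular as \<gamma> itself, and
  induction on the order applies.\<close>

lemma smooth_on_solution:
  fixes \<gamma> :: "real \<Rightarrow> 'a::euclidean_space"
  assumes V: "open V" "smooth_on V g" and I: "open I" "\<gamma> ` I \<subseteq> V"
    and d: "\<And>s. s \<in> I \<Longrightarrow> (\<gamma> has_vector_derivative g (\<gamma> s)) (at s)"
  shows "smooth_on I \<gamma>"
proof -
  have FD\<gamma>: "FD \<gamma> s v = v *\<^sub>R g (\<gamma> s)" if "s \<in> I" for s v
    using FD_eqI[OF d[OF that, unfolded has_vector_derivative_def]] by simp
  have "Ck_on k I \<gamma>" for k
  proof (induction k)
    case 0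
    then show ?case
      using d by (auto intro!: continuous_at_imp_continuous_on has_vector_derivative_continuous)
  next
    case (Suc k)
    have "Ck_on k I (\<lambda>s. FD \<gamma> s v)" for v
    proof (rule Ck_on_cong[OF I(1)])
      show "Ck_on k I (\<lambda>s. v *\<^sub>R g (\<gamma> s))"
        using V(2) by (intro Ck_on_scaleR Ck_on_const Ck_on_compose[OF I(1) V(1) I(2) Suc.IH] I(1))
          (simp add: smooth_on_def)
    qed (simp add: FD\<gamma>)
    moreover have "\<gamma> differentiable (at s)" if "s \<in> I" for s
      using d[OF that] by (auto simp: has_vector_derivative_def differentiable_def)
    ultimately show ?case by simp
  qed
  then show ?thesis by (simp add: smooth_on_def)
qed

context biconservative_chart
begin

text \<open>The frame \<open>(e\<^sub>1, N, x)\<close> is orthonormal up to the sign of the last vector; \<^term>\<open>transport p q\<close>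
  takes the frame at \<^term>\<open>p\<close> to the frame at \<^term>\<open>q\<close> and kills the orthogonal complement.\<close>
definition transport :: "'p \<Rightarrow> 'p \<Rightarrow> real \<times> (real^'d) \<Rightarrow> real \<times> (real^'d)" where
  "transport p q z = ip c z (e p) *\<^sub>R e q + ip c z (Nu p) *\<^sub>R Nu q + (c * ip c z (X p)) *\<^sub>R X q"

lemma transport_X: "p \<in> V \<Longrightarrow> transport p q (X p) = X q"
  using eX[of p] NX[of p] by (simp add: transport_def XX cc ip_commute)

lemma FD_transport:
  assumes p: "(p has_derivative p') (at t)" "p t \<in> V" and q: "(q has_derivative q') (at t)" "q t \<in> V"
  shows "((\<lambda>t. transport (p t) (q t) z) has_derivative (\<lambda>v.
     ip c z (e (p t)) *\<^sub>R FD e (q t) (q' v) + ip c z (FD e (p t) (p' v)) *\<^sub>R e (q t)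
   + (ip c z (Nu (p t)) *\<^sub>R FD Nu (q t) (q' v) + ip c z (FD Nu (p t) (p' v)) *\<^sub>R Nu (q t))
   + ((c * ip c z (X (p t))) *\<^sub>R FD X (q t) (q' v) + (c * ip c z (FD X (p t) (p' v))) *\<^sub>R X (q t)))) (at t)"
proof -
  note h = has_derivative_compose[OF p(1) smooth_on_has_derivative[OF _ p(2)]]
    has_derivative_compose[OF q(1) smooth_on_has_derivative[OF _ q(2)]]
  note ipd = bounded_linear.has_derivative[OF ip.bounded_linear_right]
  show ?thesis
    unfolding transport_def
    by (intro has_derivative_add has_derivative_scaleR has_derivative_mult_right ipd h sme smN smX)
qed

text \<open>The frame equations along curves of \<open>e\<^sub>1\<close> have skew coefficients depending only on the mean
  curvature.\<close>
lemma transport_derivative_0: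
  assumes "(p has_derivative p') (at t)" "p t \<in> V" "(q has_derivative q') (at t)" "q t \<in> V"
    and "p' v = \<eta> (p t)" "q' v = \<eta> (q t)" "f (p t) = f (q t)"
  shows "FD (\<lambda>t. transport (p t) (q t) z) t v = 0"
  unfolding FD_eqI[OF FD_transport[OF assms(1-4)]] using assms
  by (simp add: De\<eta> DN\<eta> DX\<eta> ip_simps k_def algebra_simps)

end

text \<open>\<beta> is the coordinate expression of a map into M, such as the parametrized leaf. X
  being an immersion, differentiability passes from X after \<beta> to \<beta> by
  \<open>has_derivative_lift\<close>.\<close>

lemma (in hypersurface_chart) chart_lift_derivative:
  assumes \<beta>: "isCont \<beta> t" "\<beta> t \<in> V" and T: "open T" "t \<in> T" "\<And>t. t \<in> T \<Longrightarrow> X (\<beta> t) = Y t"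
    and Y: "(Y has_derivative Y') (at t)"
  obtains \<beta>' where "(\<beta> has_derivative \<beta>') (at t)" "\<And>v. FD X (\<beta> t) (\<beta>' v) = Y' v"
proof -
  obtain q where q: "linear q" "q \<circ> FD X (\<beta> t) = id"
    using linear_injective_left_inverse[OF linX[OF \<beta>(2)] inj_FD_X[OF \<beta>(2)]] by blast
  have XY: "((\<lambda>t. X (\<beta> t)) has_derivative Y') (at t)"
    by (rule has_derivative_transform_within_open[OF Y T(1,2)]) (simp add: T(3))
  have d: "(\<beta> has_derivative (\<lambda>v. q (Y' v))) (at t)"
    by (rule has_derivative_lift[OF smooth_on_has_derivative[OF smX \<beta>(2)] _ _ \<beta>(1) XY])
      (use q in \<open>auto simp: linear_conv_bounded_linear[symmetric] pointfree_idE\<close>)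
  from has_derivative_compose[OF d smooth_on_has_derivative[OF smX \<beta>(2)]]
  have "(\<lambda>v. FD X (\<beta> t) (q (Y' v))) = Y'"
    using XY has_derivative_unique by blast
  then show ?thesis using that[OF d] by metis
qed

text \<open>The leaf enters through its position vector Y and its coordinate expression \<beta>;
  \<open>rangeY\<close> says that its tangent space is the complement of e in that of M. The
  coefficients in the last conclusion depend on s alone, being read off from the curve through
  t0.\<close>

lemma flow_box:
  fixes V :: "(real \<times> 'q::euclidean_space) set" and \<beta> :: "'q \<Rightarrow> real \<times> 'q"
    and X Nu e :: "real \<times> 'q \<Rightarrow> real \<times> (real^'d)"
  assumes bc: "biconservative_chart c V X Nu f W e a"
    and T: "open T" "t0 \<in> T" and smY: "smooth_on T Y" and injY: "inj (FD Y t0)"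
    and \<beta>: "\<And>t. t \<in> T \<Longrightarrow> \<beta> t \<in> V" "\<And>t. t \<in> T \<Longrightarrow> isCont \<beta> t" "\<And>t. t \<in> T \<Longrightarrow> X (\<beta> t) = Y t"
    and rangeY: "\<And>t. t \<in> T \<Longrightarrow> range (FD Y t) = {v \<in> range (FD X (\<beta> t)). ip c v (e (\<beta> t)) = 0}"
  obtains \<delta> r G F where "\<delta> > 0" "r > 0" "ball t0 r \<subseteq> T"
    "G ` ({-\<delta><..<\<delta>} \<times> ball t0 r) \<subseteq> V" "open (G ` ({-\<delta><..<\<delta>} \<times> ball t0 r))"
    "homeomorphism ({-\<delta><..<\<delta>} \<times> ball t0 r) (G ` ({-\<delta><..<\<delta>} \<times> ball t0 r)) G F"
    "smooth_on ({-\<delta><..<\<delta>} \<times> ball t0 r) G"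
    "\<And>y. y \<in> {-\<delta><..<\<delta>} \<times> ball t0 r \<Longrightarrow> inj (FD G y)"
    "\<And>t. t \<in> ball t0 r \<Longrightarrow> G (0, t) = \<beta> t"
    "\<And>s t. s \<in> {-\<delta><..<\<delta>} \<Longrightarrow> t \<in> ball t0 r \<Longrightarrow>
       ((\<lambda>s. X (G (s, t))) has_vector_derivative e (G (s, t))) (at s)"
    "\<And>s t. s \<in> {-\<delta><..<\<delta>} \<Longrightarrow> t \<in> ball t0 r \<Longrightarrow> X (G (s, t)) =
       ip c (X (G (s, t0))) (e (\<beta> t0)) *\<^sub>R e (\<beta> t) + ip c (X (G (s, t0))) (Nu (\<beta> t0)) *\<^sub>R Nu (\<beta> t)
       + (c * ip c (X (G (s, t0))) (X (\<beta> t0))) *\<^sub>R X (\<beta> t)"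
proof -
  interpret biconservative_chart c V X Nu f W e a by (rule bc)
  define u0 where "u0 = \<beta> t0"
  have u0: "u0 \<in> V" using \<beta>(1) T by (simp add: u0_def)
  have nz: "FD f u0 (\<eta> u0) \<noteq> 0" using W[OF u0] by (simp add: Df DX\<eta> ee u0)
  have dep: "FD W u v = (FD W u (\<eta> u) / W u) * FD f u v" if "u \<in> V" for u v
    using DW[OF that, of v] W[OF that] Df[OF that, of v] by simp
  \<comment> \<open>On V' the length W of the gradient is a function of f, so f grows at the same
    rate on all curves of e at equal values of f.\<close>
  obtain V' where V': "open V'" "u0 \<in> V'" "V' \<subseteq> V"
    and lev: "\<And>u u'. u \<in> V' \<Longrightarrow> u' \<in> V' \<Longrightarrow> f u = f u' \<Longrightarrow> W u = W u'"
    by (rule level_set_constancy[OF open_V u0 smf smW nz dep]) (assumption, rule that)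

  obtain \<epsilon> \<gamma> where \<epsilon>: "\<epsilon> > 0" and \<gamma>0: "\<gamma> 0 = u0" and \<gamma>V: "\<And>s. s \<in> {-\<epsilon><..<\<epsilon>} \<Longrightarrow> \<gamma> s \<in> V'"
    and d\<gamma>: "\<And>s. s \<in> {-\<epsilon><..<\<epsilon>} \<Longrightarrow> (\<gamma> has_vector_derivative \<eta> (\<gamma> s)) (at s)"
    by (rule ode_local_solution[OF V'(1,2) smooth_on_subset[OF sm_\<eta> V'(3)]]) (rule that)
  let ?I = "{-\<epsilon><..<\<epsilon>}"
  have sm\<gamma>: "smooth_on ?I \<gamma>"
    using \<gamma>V by (intro smooth_on_solution[OF V'(1) smooth_on_subset[OF sm_\<eta> V'(3)] _ _ d\<gamma>]) auto
  \<comment> \<open>The values of f along the sample curve. Its derivative W is positive, so the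
    local inverse \<open>hi\<close> returns the time at which a value of f is reached.\<close>
  define h where "h s = f (\<gamma> s)" for s
  have smh: "smooth_on ?I h"
    unfolding h_def using \<gamma>V V'(3)
    by (intro smooth_on_compose[OF _ open_V _ sm\<gamma> smf]) auto
  have dh: "FD h s v = v * W (\<gamma> s)" if "s \<in> ?I" for s v
  proof -
    have \<gamma>sV: "\<gamma> s \<in> V" using \<gamma>V[OF that] V'(3) by blast
    have "(h has_derivative (\<lambda>v. FD f (\<gamma> s) (v *\<^sub>R \<eta> (\<gamma> s)))) (at s)"
      unfolding h_def
      by (rule has_derivative_compose[OF d\<gamma>[OF that, unfolded has_vector_derivative_def]
            smooth_on_has_derivative[OF smf \<gamma>sV]])
    from FD_eqI[OF this] show ?thesis
      using \<gamma>sV by (simp add: Df DX\<eta> ee linear_scale[OF linX] ip_simps)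
  qed
  have "inj (FD h 0)"
    using \<epsilon> W[OF u0] by (auto simp: inj_on_def dh \<gamma>0)
  moreover have "open ?I" "0 \<in> ?I" using \<epsilon> by auto
  ultimately obtain S W0 hi where S: "0 \<in> S" "S \<subseteq> ?I" "open W0" "h 0 \<in> W0" "homeomorphism S W0 h hi"
    "smooth_on W0 hi" and hi: "\<And>s v. s \<in> S \<Longrightarrow> FD hi (h s) (FD h s v) = v"
    using smooth_inverse_function[OF _ _ smh] by metis
  have hiS: "hi y \<in> S" "h (hi y) = y" if "y \<in> W0" for y
    using S(5) that by (auto simp: homeomorphism_def)
  have hih: "hi (h s) = s" if "s \<in> S" for s
    using S(5) that by (auto simp: homeomorphism_def)

  define V1 where "V1 = V' \<inter> f -` W0"
  define \<sigma> where "\<sigma> u = hi (f u)" for u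
  have V1: "open V1" "u0 \<in> V1" "V1 \<subseteq> V" "V1 \<subseteq> V'"
    using V' S(3,4) continuous_open_preimage[OF smooth_on_continuous[OF smooth_on_subset[OF smf V'(3)]] V'(1) S(3)]
    by (auto simp: V1_def h_def \<gamma>0)
  have sm\<sigma>: "smooth_on V1 \<sigma>"
    unfolding \<sigma>_def by (rule smooth_on_compose[OF V1(1) S(3) _ smooth_on_subset[OF smf V1(3)] S(6)])
      (auto simp: V1_def)
  have \<sigma>S: "\<sigma> u \<in> S" "\<sigma> u \<in> ?I" "f (\<gamma> (\<sigma> u)) = f u" if "u \<in> V1" for u
    using hiS[of "f u"] that S(2) by (auto simp: V1_def \<sigma>_def h_def)
  have \<gamma>\<sigma>V: "\<gamma> (\<sigma> u) \<in> V" if "u \<in> V1" for u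
    using \<gamma>V[OF \<sigma>S(2)[OF that]] V'(3) by blast
  have W\<sigma>: "W (\<gamma> (\<sigma> u)) = W u" if "u \<in> V1" for u
    using that V1(4) \<sigma>S(2,3)[OF that] \<gamma>V by (intro lev) auto
  \<comment> \<open>The derivative of \<open>hi\<close> divides by W at \<gamma> (\<sigma> u), while
    df contributes the factor W u; these agree by \<open>W\<sigma>\<close>. So \<sigma> has unit
    speed along every curve of e.\<close>
  have d\<sigma>: "FD \<sigma> u v = ip c (e u) (FD X u v)" if u: "u \<in> V1" for u v
  proof -
    have uV: "u \<in> V" using u V1 by blast
    have "f u \<in> W0" using u by (simp add: V1_def)
    have "(\<sigma> has_derivative (\<lambda>v. FD hi (f u) (FD f u v))) (at u)"
      unfolding \<sigma>_def
      by (rule has_derivative_compose[OF smooth_on_has_derivative[OF smf uV]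
            smooth_on_has_derivative[OF S(6) \<open>f u \<in> W0\<close>]])
    then have "FD \<sigma> u v = FD hi (f u) (W u * ip c (e u) (FD X u v))"
      by (simp add: FD_eqI Df uV)
    also have "\<dots> = FD hi (h (\<sigma> u)) (FD h (\<sigma> u) (ip c (e u) (FD X u v)))"
      using \<sigma>S[OF u] W\<sigma>[OF u] by (simp add: dh h_def mult.commute)
    finally show ?thesis using hi[OF \<sigma>S(1)[OF u]] by simp
  qed

  \<comment> \<open>X u0 is the position of the sample curve at time 0. If the curve of e through u
    leaves the level f = f u0 at p, then X u0 has the same components in the frame at \<gamma>
    (\<sigma> u) as X p in the frame at u. So y u is the position of the foot p, written without the
    curve through u.\<close>
  define y where "y u = transport (\<gamma> (\<sigma> u)) u (X u0)" for u
  have sm\<gamma>\<sigma>: "smooth_on V1 (\<lambda>u. \<gamma> (\<sigma> u))"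
    by (rule smooth_on_compose[OF V1(1) _ _ sm\<sigma> sm\<gamma>]) (use \<sigma>S in auto)
  have comp: "smooth_on V1 (\<lambda>u. g (\<gamma> (\<sigma> u)))" if "smooth_on V g" for g :: "real \<times> 'q \<Rightarrow> real \<times> (real^'d)"
    by (rule smooth_on_compose[OF V1(1) open_V _ sm\<gamma>\<sigma> that]) (use \<gamma>\<sigma>V in auto)
  have smy: "smooth_on V1 y"
    unfolding y_def transport_def
    by (intro smooth_on_add smooth_on_scaleR smooth_on_ip smooth_on_mult smooth_on_const comp sme smN smX
        smooth_on_subset[OF _ V1(3)] V1(1))
  have d\<gamma>\<sigma>: "((\<lambda>u. \<gamma> (\<sigma> u)) has_derivative (\<lambda>v. ip c (e u) (FD X u v) *\<^sub>R \<eta> (\<gamma> (\<sigma> u)))) (at u)"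
    if u: "u \<in> V1" for u
    using has_derivative_compose[OF smooth_on_has_derivative[OF sm\<sigma> u]
        d\<gamma>[OF \<sigma>S(2)[OF u], unfolded has_vector_derivative_def]] by (simp add: d\<sigma>[OF u])
  have dy0: "FD y u (\<eta> u) = 0" if u: "u \<in> V1" for u
    unfolding y_def[abs_def]
    by (rule transport_derivative_0[OF d\<gamma>\<sigma>[OF u] \<gamma>\<sigma>V[OF u] has_derivative_ident])
      (use u V1 \<sigma>S in \<open>auto simp: DX\<eta> ee\<close>)
  have \<sigma>0: "\<sigma> u = 0" if "f u = f u0" for u
    using hih[OF S(1)] that by (simp add: \<sigma>_def h_def \<gamma>0)
  have yX: "y u = X u" if "f u = f u0" for u
    using transport_X[OF u0] by (simp add: y_def \<sigma>0[OF that] \<gamma>0)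
  \<comment> \<open>For such w the time \<sigma> is stationary and only the target frame of the
    transport moves. X u0 has X as its single frame component, whose derivative is dX w.\<close>
  have dy: "FD y u0 w = FD X u0 w" if "ip c (e u0) (FD X u0 w) = 0" for w
  proof -
    have s0: "\<sigma> u0 = 0" by (simp add: \<sigma>0)
    have o: "ip c (X u0) (e u0) = 0" "ip c (X u0) (Nu u0) = 0"
      using eX[OF u0] NX[OF u0] by (simp_all only: ip_commute)
    have L: "FD e u0 0 = 0" "FD Nu u0 0 = 0" "FD X u0 0 = 0"
      using linear_0 smooth_on_linear_FD[OF _ u0] sme smN smX by blast+
    note * = FD_transport[OF d\<gamma>\<sigma>[OF V1(2)] \<gamma>\<sigma>V[OF V1(2)] has_derivative_ident u0, of "X u0"]
    show ?thesis
      unfolding y_def[abs_def] FD_eqI[OF *] s0 \<gamma>0 that scaleR_zero_left L o XX[OF u0] cc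
      by (simp add: ip.zero_right)
  qed

  \<comment> \<open>Y followed by a left inverse of its derivative is a local diffeomorphism of the
    parameter space. Inverting it assigns a leaf parameter to any ambient vector near Y t0, in
    particular to y u.\<close>
  obtain q where q: "linear q" "q \<circ> FD Y t0 = id"
    using linear_injective_left_inverse[OF smooth_on_linear_FD[OF smY T(2)] injY] by (elim exE conjE)
  have blq: "bounded_linear q" using q(1) by (simp add: linear_conv_bounded_linear)
  define Q where "Q t = q (Y t)" for t
  have smQ: "smooth_on T Q" unfolding Q_def by (rule smooth_on_bounded_linear[OF blq T(1) smY])
  have dQ: "FD Q t0 v = v" for v
    using FD_bounded_linear[OF blq smooth_on_differentiable[OF smY T(2)], of v] q(2)
    by (simp add: Q_def[abs_def] pointfree_idE)
  then have "inj (FD Q t0)" by (simp add: inj_on_def)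
  from smooth_inverse_function[OF T smQ this]
  obtain T0 WQ Qi where T0: "open T0" "t0 \<in> T0" "T0 \<subseteq> T" "open WQ" "Q t0 \<in> WQ" "homeomorphism T0 WQ Q Qi"
    "smooth_on WQ Qi" and Qi: "\<And>u v. u \<in> T0 \<Longrightarrow> FD Qi (Q u) (FD Q u v) = v"
    by metis
  have QiQ: "Qi (Q t) = t" if "t \<in> T0" for t using T0(6) that by (auto simp: homeomorphism_def)

  define V2 where "V2 = V1 \<inter> (\<lambda>u. q (y u)) -` WQ"
  have smqy: "smooth_on V1 (\<lambda>u. q (y u))" by (rule smooth_on_bounded_linear[OF blq V1(1) smy])
  have qy0: "q (y u0) = Q t0" using yX[of u0] \<beta>(3)[OF T(2)] by (simp add: Q_def u0_def)
  have V2: "open V2" "u0 \<in> V2" "V2 \<subseteq> V1"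
    using continuous_open_preimage[OF smooth_on_continuous[OF smqy] V1(1) T0(4)] T0(5) qy0 V1
    by (auto simp: V2_def)
  \<comment> \<open>Time and foot parameter: the inverse of F will be the flow started on the
    leaf.\<close>
  define F where "F u = (\<sigma> u, Qi (q (y u)))" for u
  have smQi: "smooth_on V2 (\<lambda>u. Qi (q (y u)))"
    by (rule smooth_on_compose[OF V2(1) T0(4) _ smooth_on_subset[OF smqy V2(3)] T0(7)]) (auto simp: V2_def)
  have smF: "smooth_on V2 F"
    unfolding F_def by (intro smooth_on_Pair smQi smooth_on_subset[OF sm\<sigma>] V2)
  have dF: "FD F u w = (ip c (e u) (FD X u w), FD Qi (q (y u)) (q (FD y u w)))" if u: "u \<in> V2" for u w
  proof -
    have u1: "u \<in> V1" using u V2 by blast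
    have qW: "q (y u) \<in> WQ" using u by (simp add: V2_def)
    have "(F has_derivative (\<lambda>w. (FD \<sigma> u w, FD Qi (q (y u)) (q (FD y u w))))) (at u)"
      unfolding F_def
      by (intro has_derivative_Pair smooth_on_has_derivative[OF sm\<sigma> u1]
          has_derivative_compose[OF bounded_linear.has_derivative[OF blq smooth_on_has_derivative[OF smy u1]]
            smooth_on_has_derivative[OF T0(7) qW]])
    from FD_eqI[OF this] show ?thesis by (simp add: d\<sigma>[OF u1])
  qed
  have dF\<eta>: "FD F u (\<eta> u) = (1, 0)" if u: "u \<in> V2" for u
  proof -
    have u1: "u \<in> V1" using u V2 by blast
    then have "u \<in> V" using V1 by blast
    have "linear (FD Qi (q (y u)))"
      using u by (intro smooth_on_linear_FD[OF T0(7)]) (simp add: V2_def)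
    then show ?thesis
      using \<open>u \<in> V\<close> by (simp add: dF u dy0 u1 DX\<eta> ee linear_0 q(1))
  qed
  \<comment> \<open>A vector in the kernel is orthogonal to e, hence tangent to the leaf by
    \<open>rangeY\<close>; on such vectors the second component of dF recovers the leaf
    parameter.\<close>
  have "inj (FD F u0)"
    unfolding linear_injective_0[OF smooth_on_linear_FD[OF smF V2(2)]]
  proof (intro allI impI)
    fix w assume "FD F u0 w = 0"
    then have z: "ip c (e u0) (FD X u0 w) = 0" "FD Qi (Q t0) (q (FD y u0 w)) = 0"
      using dF[OF V2(2), of w] by (auto simp: qy0 zero_prod_def)
    then have "FD X u0 w \<in> range (FD Y t0)"
      using rangeY[OF T(2)] by (simp add: u0_def ip_commute)
    then obtain v where v: "FD X u0 w = FD Y t0 v" by blast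
    have "q (FD y u0 w) = FD Q t0 v" using dy[OF z(1)] v q(2) by (simp add: dQ pointfree_idE)
    then have "v = 0" using z(2) Qi[OF T0(2)] by simp
    then have "FD X u0 w = FD X u0 0"
      using v by (simp add: linear_0[OF smooth_on_linear_FD[OF smY T(2)]] linear_0[OF linX[OF u0]])
    then show "w = 0" using inj_FD_X[OF u0] by (simp add: inj_eq)
  qed
  from smooth_inverse_function[OF V2(1,2) smF this]
  obtain V3 WF G where V3: "open V3" "u0 \<in> V3" "V3 \<subseteq> V2" "open WF" "F u0 \<in> WF"
    "homeomorphism V3 WF F G" "smooth_on WF G"
    and GF: "\<And>u v. u \<in> V3 \<Longrightarrow> FD G (F u) (FD F u v) = v" "\<And>u v. u \<in> V3 \<Longrightarrow> FD F u (FD G (F u) v) = v"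
    by metis
  have G: "G z \<in> V3" "F (G z) = z" if "z \<in> WF" for z
    using V3(6) that by (auto simp: homeomorphism_def)
  have GF': "G (F u) = u" if "u \<in> V3" for u
    using V3(6) that by (auto simp: homeomorphism_def)
  have V3V: "V3 \<subseteq> V" "V3 \<subseteq> V1" using V3 V2 V1 by auto

  have F0: "F u0 = (0, t0)" using QiQ[OF T0(2)] by (simp add: F_def \<sigma>0 qy0)
  obtain r0 where r0: "r0 > 0" "ball t0 r0 \<subseteq> T" using T open_contains_ball by blast
  \<comment> \<open>The leaf is tangent to the kernel of df, so f is constant on a ball in it. Its
    points there have \<sigma> = 0 and are their own feet, which gives \<open>G0\<close>.\<close>
  have f\<beta>: "f (\<beta> t) = f u0" if "t \<in> ball t0 r0" for t
  proof -
    have "((\<lambda>t. f (\<beta> t)) has_derivative (\<lambda>v. 0)) (at t)" if t: "t \<in> T" for t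
    proof -
      obtain \<beta>' where \<beta>': "(\<beta> has_derivative \<beta>') (at t)" "\<And>v. FD X (\<beta> t) (\<beta>' v) = FD Y t v"
        using chart_lift_derivative[OF \<beta>(2)[OF t] \<beta>(1)[OF t] T(1) t \<beta>(3) smooth_on_has_derivative[OF smY t]]
        by metis
      have "FD Y t v \<in> {v \<in> range (FD X (\<beta> t)). ip c v (e (\<beta> t)) = 0}" for v
        using rangeY[OF t] by blast
      then have "FD f (\<beta> t) (\<beta>' v) = 0" for v
        using Df[OF \<beta>(1)[OF t]] \<beta>'(2)[of v] by (simp add: ip_commute)
      then show ?thesis
        using has_derivative_compose[OF \<beta>'(1) smooth_on_has_derivative[OF smf \<beta>(1)[OF t]]] by simp
    qed
    then have "\<exists>k. \<forall>t\<in>ball t0 r0. f (\<beta> t) = k"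
      using r0(2) by (intro has_derivative_zero_constant convex_ball) (blast intro: has_derivative_at_withinI)
    then show ?thesis using that r0 by (metis u0_def centre_in_ball)
  qed
  have "eventually (\<lambda>t. \<beta> t \<in> V3) (nhds t0)"
  proof -
    have "filterlim \<beta> (nhds u0) (nhds t0)"
      using \<beta>(2)[OF T(2)] by (simp add: u0_def isCont_def tendsto_at_iff_tendsto_nhds)
    from this[unfolded filterlim_iff, rule_format, OF eventually_nhds_in_open[OF V3(1,2)]]
    show ?thesis .
  qed
  then obtain B1 where B1: "open B1" "t0 \<in> B1" "\<And>t. t \<in> B1 \<Longrightarrow> \<beta> t \<in> V3"
    unfolding eventually_nhds by blast
  have "(0, t0) \<in> WF" using V3(5) by (simp add: F0)
  then obtain A B where AB: "open A" "open B" "(0, t0) \<in> A \<times> B" "A \<times> B \<subseteq> WF"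
    by (rule open_prod_elim[OF V3(4)])
  obtain \<delta> where \<delta>: "\<delta> > 0" "{-\<delta><..<\<delta>} \<subseteq> A"
  proof -
    obtain d where "d > 0" "ball 0 d \<subseteq> A" using AB(1,3) open_contains_ball by blast
    moreover have "{-d<..<d} = ball 0 d" by (auto simp: dist_real_def)
    ultimately show ?thesis using that by simp
  qed
  have "open (B \<inter> B1 \<inter> T0 \<inter> ball t0 r0)" "t0 \<in> B \<inter> B1 \<inter> T0 \<inter> ball t0 r0"
    using AB B1 T0 r0 by auto
  then obtain r where r: "r > 0" "ball t0 r \<subseteq> B \<inter> B1 \<inter> T0 \<inter> ball t0 r0"
    using open_contains_ball by blast
  let ?D = "{-\<delta><..<\<delta>} \<times> ball t0 r"
  have D: "?D \<subseteq> WF" using \<delta> r AB by blast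
  have oD: "open ?D" by (intro open_Times) auto
  have t0r: "t0 \<in> ball t0 r" and z\<delta>: "0 \<in> {-\<delta><..<\<delta>}" using r \<delta> by auto
  have G0: "G (0, t) = \<beta> t" if "t \<in> ball t0 r" for t
  proof -
    have t: "t \<in> B1" "t \<in> T0" "t \<in> ball t0 r0" using that r by auto
    have "F (\<beta> t) = (0, t)"
      using f\<beta>[OF t(3)] QiQ[OF t(2)] \<beta>(3)[of t] t T0(3) by (auto simp: F_def \<sigma>0 yX Q_def[symmetric])
    then show ?thesis using GF'[OF B1(3)[OF t(1)]] by simp
  qed
  have GD: "G z \<in> V3" "G z \<in> V2" "G z \<in> V1" "G z \<in> V" "F (G z) = z" if "z \<in> ?D" for z
    using G[of z] D that V3V V3(3) by auto
  have dG: "((\<lambda>s. G (s, t)) has_vector_derivative \<eta> (G (s, t))) (at s)"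
    if st: "s \<in> {-\<delta><..<\<delta>}" "t \<in> ball t0 r" for s t
  proof -
    have z: "(s, t) \<in> ?D" using st by simp
    have "((\<lambda>s. (s, t)) has_derivative (\<lambda>v. (v, 0))) (at s)"
      by (intro has_derivative_Pair has_derivative_ident has_derivative_const)
    moreover have "(G has_derivative FD G (s, t)) (at (s, t))"
      using z D by (intro smooth_on_has_derivative[OF V3(7)]) auto
    ultimately have "((\<lambda>s. G (s, t)) has_derivative (\<lambda>v. FD G (s, t) (v, 0))) (at s)"
      by (rule has_derivative_compose)
    moreover have "FD G (s, t) (v, 0) = v *\<^sub>R \<eta> (G (s, t))" for v
    proof -
      have lin: "linear (FD G (s, t))"
        using z D by (intro smooth_on_linear_FD[OF V3(7)]) auto
      have "FD G (s, t) (1, 0) = \<eta> (G (s, t))"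
        using GF(1)[OF GD(1)[OF z], of "\<eta> (G (s, t))"] dF\<eta>[OF GD(2)[OF z]] GD(5)[OF z] by simp
      then show ?thesis using linear_scale[OF lin, of v "(1, 0)"] by simp
    qed
    ultimately show ?thesis by (simp add: has_vector_derivative_def)
  qed
  \<comment> \<open>All curves reach the same value of f at the same time, as
    \<open>transport_derivative_0\<close> requires.\<close>
  have fG: "f (G (s, t)) = h s" if st: "s \<in> {-\<delta><..<\<delta>}" "t \<in> ball t0 r" for s t
  proof -
    have z: "(s, t) \<in> ?D" using st by simp
    have "\<sigma> (G (s, t)) = s" using GD(5)[OF z] by (simp add: F_def)
    then show ?thesis using \<sigma>S(3)[OF GD(3)[OF z]] by (simp add: h_def)
  qed
  show thesis
  proof (rule that[OF \<delta>(1) r(1)])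
    show "ball t0 r \<subseteq> T" using r T0 by blast
    show "G ` ?D \<subseteq> V" using GD(4) by blast
    have "G ` ?D = V3 \<inter> F -` ?D"
    proof
      show "G ` ?D \<subseteq> V3 \<inter> F -` ?D" using GD(1,5) by auto
      show "V3 \<inter> F -` ?D \<subseteq> G ` ?D"
      proof
        fix u assume "u \<in> V3 \<inter> F -` ?D"
        then show "u \<in> G ` ?D" using GF'[of u] by (metis IntD1 IntD2 imageI vimageD)
      qed
    qed
    then show "open (G ` ?D)"
      using continuous_open_preimage[OF smooth_on_continuous[OF smooth_on_subset[OF smF V3(3)]] V3(1) oD]
      by simp
    show "homeomorphism ?D (G ` ?D) G F"
      by (rule homeomorphism_of_subsets[OF homeomorphism_symD[OF V3(6)] D]) (use GD(1) in auto)
    show "smooth_on ?D G" by (rule smooth_on_subset[OF V3(7) D])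
    show "inj (FD G z)" if "z \<in> ?D" for z
      using GF(2)[OF GD(1)[OF that]] GD(5)[OF that] by (metis injI)
    show "G (0, t) = \<beta> t" if "t \<in> ball t0 r" for t by (rule G0[OF that])
    fix s t assume st: "s \<in> {-\<delta><..<\<delta>}" "t \<in> ball t0 r"
    have z: "(s, t) \<in> ?D" using st by simp
    have "((\<lambda>s. X (G (s, t))) has_derivative (\<lambda>v. FD X (G (s, t)) (v *\<^sub>R \<eta> (G (s, t))))) (at s)"
      by (rule has_derivative_compose[OF dG[OF st, unfolded has_vector_derivative_def]
            smooth_on_has_derivative[OF smX GD(4)[OF z]]])
    then show "((\<lambda>s. X (G (s, t))) has_vector_derivative e (G (s, t))) (at s)"
      by (simp add: has_vector_derivative_def linear_scale[OF linX[OF GD(4)[OF z]]] DX\<eta>[OF GD(4)[OF z]])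
    \<comment> \<open>The vector z stays fixed while \<tau> moves both frames. Then z is taken to be
      the position at time s on the curve through t0: at \<tau> = s its transport is X (G (s, t)),
      at \<tau> = 0 a combination of the frame at \<beta> t.\<close>
    define Rz where "Rz z \<tau> = transport (G (\<tau>, t0)) (G (\<tau>, t)) z" for z \<tau>
    have dR: "(Rz z has_derivative (\<lambda>v. 0)) (at \<tau>)" if \<tau>: "\<tau> \<in> {-\<delta><..<\<delta>}" for z \<tau>
    proof -
      note d1 = dG[OF \<tau> t0r, unfolded has_vector_derivative_def]
      note d2 = dG[OF \<tau> st(2), unfolded has_vector_derivative_def]
      have in_V: "G (\<tau>, t0) \<in> V" "G (\<tau>, t) \<in> V" using \<tau> t0r st(2) by (auto intro: GD(4))
      note D = FD_transport[OF d1 in_V(1) d2 in_V(2), of z]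
      have dif: "Rz z differentiable (at \<tau>)"
        unfolding Rz_def[abs_def] differentiable_def by (rule exI) (rule D)
      have "FD (Rz z) \<tau> 1 = 0"
        unfolding Rz_def[abs_def]
        by (rule transport_derivative_0[OF d1 in_V(1) d2 in_V(2)])
          (use \<tau> t0r st(2) fG in auto)
      then have "FD (Rz z) \<tau> = (\<lambda>v. 0)"
        using linear_scale[OF FD_linear[OF dif], of _ 1] by (simp add: fun_eq_iff)
      then show ?thesis using FD_worksD[OF dif] by simp
    qed
    have "Rz z s = Rz z 0" for z
    proof -
      have "\<exists>k. \<forall>\<tau>\<in>{-\<delta><..<\<delta>}. Rz z \<tau> = k"
        by (intro has_derivative_zero_constant convex_real_interval)
          (auto intro: has_derivative_at_withinI[OF dR])
      then show ?thesis using st(1) z\<delta> by metis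
    qed
    then have "transport (G (s, t0)) (G (s, t)) (X (G (s, t0))) = transport (\<beta> t0) (\<beta> t) (X (G (s, t0)))"
      unfolding Rz_def by (simp add: G0[OF t0r] G0[OF st(2)])
    then show "X (G (s, t)) =
       ip c (X (G (s, t0))) (e (\<beta> t0)) *\<^sub>R e (\<beta> t) + ip c (X (G (s, t0))) (Nu (\<beta> t0)) *\<^sub>R Nu (\<beta> t)
       + (c * ip c (X (G (s, t0))) (X (\<beta> t0))) *\<^sub>R X (\<beta> t)"
      using transport_X[of "G (s, t0)" "G (s, t)"] GD(4)[of "(s, t0)"] st(1) t0r
      by (simp add: transport_def)
  qed
qed

section \<open>Local parametrizations\<close>

lemma local_param_subset: "local_param M x U \<phi> \<Longrightarrow> \<phi> ` U \<subseteq> M"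
  unfolding local_param_def by (auto dest: openin_imp_subset)

lemma local_param_pullback:
  assumes lp: "local_param M x U \<phi>" and S: "open S" "z \<in> S" and \<kappa>: "continuous_on S \<kappa>" "\<kappa> ` S \<subseteq> M"
    and z: "\<kappa> z \<in> \<phi> ` U"
  obtains R \<beta> where "open R" "z \<in> R" "R \<subseteq> S" "continuous_on R \<beta>"
    "\<And>t. t \<in> R \<Longrightarrow> \<beta> t \<in> U" "\<And>t. t \<in> R \<Longrightarrow> \<phi> (\<beta> t) = \<kappa> t"
proof -
  obtain \<psi> where \<psi>: "homeomorphism U (\<phi> ` U) \<phi> \<psi>" and op: "openin (top_of_set M) (\<phi> ` U)"
    using lp unfolding local_param_def by blast
  define R where "R = S \<inter> \<kappa> -` (\<phi> ` U)"
  have sub: "\<kappa> ` R \<subseteq> \<phi> ` U" by (auto simp: R_def)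
  show thesis
  proof (rule that[of R "\<psi> \<circ> \<kappa>"])
    have "openin (top_of_set S) R"
      unfolding R_def using \<kappa> by (intro continuous_openin_preimage[OF _ _ op]) auto
    then show "open R" using S(1) by (metis openin_open_trans)
    show "z \<in> R" "R \<subseteq> S" using S z by (auto simp: R_def)
    then have "continuous_on R \<kappa>" using \<kappa>(1) continuous_on_subset by blast
    then show "continuous_on R (\<psi> \<circ> \<kappa>)"
      using \<psi> sub by (metis continuous_on_compose continuous_on_subset homeomorphism_def)
    fix t assume "t \<in> R"
    then have "\<kappa> t \<in> \<phi> ` U" using sub by blast
    then show "(\<psi> \<circ> \<kappa>) t \<in> U" "\<phi> ((\<psi> \<circ> \<kappa>) t) = \<kappa> t"
      using \<psi> by (auto simp: homeomorphism_def)
  qed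
qed

text \<open>A curve in M is smooth after composition with x; its coordinate expression is
  continuous, and \<open>has_derivative_lift\<close> makes it differentiable at 0. Together with
  \<open>tangent_curve_param\<close> this turns tangent spaces and \<open>dir_deriv\<close> into
  derivatives in the chart.\<close>

lemma tangent_curve_lift:
  assumes lp: "local_param M x U \<phi>" and u: "u \<in> U" and \<gamma>: "tangent_curve M x (\<phi> u) v \<gamma>"
  obtains \<beta> w where "\<beta> 0 = u" "(\<beta> has_vector_derivative w) (at 0)" "FD (x \<circ> \<phi>) u w = v"
    "eventually (\<lambda>t. \<phi> (\<beta> t) = \<gamma> t) (nhds 0)"
proof -
  have smX: "smooth_on U (x \<circ> \<phi>)" and injX: "inj (FD (x \<circ> \<phi>) u)" and inj: "inj_on \<phi> U"
    using lp u unfolding local_param_def homeomorphism_def by (auto intro: inj_on_inverseI)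
  obtain \<epsilon> where \<epsilon>: "\<epsilon> > 0" "\<gamma> ` {-\<epsilon><..<\<epsilon>} \<subseteq> M" "continuous_on {-\<epsilon><..<\<epsilon>} \<gamma>"
    and \<gamma>0: "\<gamma> 0 = \<phi> u" and d: "(x \<circ> \<gamma> has_vector_derivative v) (at 0)"
    using \<gamma> unfolding tangent_curve_def by blast
  have "\<gamma> 0 \<in> \<phi> ` U" "0 \<in> {-\<epsilon><..<\<epsilon>}" using \<gamma>0 u \<epsilon> by auto
  then obtain S \<beta> where S: "open S" "0 \<in> S" "continuous_on S \<beta>"
    "\<And>t. t \<in> S \<Longrightarrow> \<beta> t \<in> U" "\<And>t. t \<in> S \<Longrightarrow> \<phi> (\<beta> t) = \<gamma> t"
    using local_param_pullback[OF lp open_greaterThanLessThan _ \<epsilon>(3,2)] by metis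
  have \<beta>0: "\<beta> 0 = u" using S(4,5)[OF S(2)] \<gamma>0 inj u by (simp add: inj_on_eq_iff)
  obtain q where q: "linear q" "q \<circ> FD (x \<circ> \<phi>) u = id"
    using linear_injective_left_inverse[OF smooth_on_linear_FD[OF smX u] injX] by blast
  have k: "((\<lambda>t. (x \<circ> \<phi>) (\<beta> t)) has_derivative (\<lambda>h. h *\<^sub>R v)) (at 0)"
    by (rule has_derivative_transform_within_open[OF d[unfolded has_vector_derivative_def] S(1,2)])
      (simp add: S(5))
  have cont: "isCont \<beta> 0" using S by (simp add: continuous_on_eq_continuous_at)
  have X: "((x \<circ> \<phi>) has_derivative FD (x \<circ> \<phi>) u) (at (\<beta> 0))"
    using smooth_on_has_derivative[OF smX u] \<beta>0 by simp
  have d\<beta>: "(\<beta> has_derivative (\<lambda>h. q (h *\<^sub>R v))) (at 0)"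
    by (rule has_derivative_lift[OF X _ _ cont k])
      (use q in \<open>auto simp: linear_conv_bounded_linear[symmetric] pointfree_idE\<close>)
  have "(\<lambda>h. FD (x \<circ> \<phi>) u (q (h *\<^sub>R v))) = (\<lambda>h. h *\<^sub>R v)"
    using has_derivative_unique[OF has_derivative_compose[OF d\<beta> X] k] .
  from fun_cong[OF this, of 1] have "FD (x \<circ> \<phi>) u (q v) = v" by simp
  moreover have "(\<beta> has_vector_derivative q v) (at 0)"
    using d\<beta> by (simp add: has_vector_derivative_def linear_scale[OF q(1)])
  moreover have "eventually (\<lambda>t. \<phi> (\<beta> t) = \<gamma> t) (nhds 0)"
    using S unfolding eventually_nhds by blast
  ultimately show ?thesis using that \<beta>0 by blast
qed

lemma tangent_curve_param:
  assumes lp: "local_param M x U \<phi>" and u: "u \<in> U"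
  shows "tangent_curve M x (\<phi> u) (FD (x \<circ> \<phi>) u w) (\<lambda>t. \<phi> (u + t *\<^sub>R w))"
proof -
  have smX: "smooth_on U (x \<circ> \<phi>)" and U: "open U" and cont: "continuous_on U \<phi>"
    using lp unfolding local_param_def homeomorphism_def by auto
  define l where "l t = u + t *\<^sub>R w" for t
  have l: "smooth_on A l" for A
    unfolding l_def
    by (rule smooth_on_subset[of UNIV]) 
      (intro smooth_on_add[OF open_UNIV smooth_on_const smooth_on_linear] bounded_linear_scaleR_left subset_UNIV)+
  have "open (l -` U)"
    using continuous_open_preimage[OF smooth_on_continuous[OF l[of UNIV]] open_UNIV U] by simp
  moreover have "0 \<in> l -` U" using u by (simp add: l_def)
  ultimately obtain \<epsilon> where "\<epsilon> > 0" "ball 0 \<epsilon> \<subseteq> l -` U" using open_contains_ball by blast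
  moreover have "ball 0 \<epsilon> = {-\<epsilon><..<\<epsilon>}" by (auto simp: dist_real_def)
  ultimately have \<epsilon>: "\<epsilon> > 0" "l ` {-\<epsilon><..<\<epsilon>} \<subseteq> U" by auto
  show ?thesis
    unfolding tangent_curve_def
  proof (intro conjI exI[of _ \<epsilon>])
    show "(\<lambda>t. \<phi> (u + t *\<^sub>R w)) ` {-\<epsilon><..<\<epsilon>} \<subseteq> M"
      using \<epsilon>(2) local_param_subset[OF lp] by (auto simp: l_def)
    show "continuous_on {-\<epsilon><..<\<epsilon>} (\<lambda>t. \<phi> (u + t *\<^sub>R w))"
      using continuous_on_compose2[OF cont smooth_on_continuous[OF l] \<epsilon>(2)] by (simp add: l_def)
    show "smooth_on {-\<epsilon><..<\<epsilon>} (x \<circ> (\<lambda>t. \<phi> (u + t *\<^sub>R w)))"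
      using smooth_on_compose[OF open_greaterThanLessThan U \<epsilon>(2) l smX] by (simp add: l_def o_def)
    show "(x \<circ> (\<lambda>t. \<phi> (u + t *\<^sub>R w)) has_vector_derivative FD (x \<circ> \<phi>) u w) (at 0)"
      using has_vector_derivative_line[of "x \<circ> \<phi>" u 0 w] smooth_on_differentiable[OF smX u]
      by (simp add: o_def)
  qed (use \<epsilon> in auto)
qed

lemma tangent_space_param:
  assumes lp: "local_param M x U \<phi>" and u: "u \<in> U"
  shows "tangent_space M x (\<phi> u) = range (FD (x \<circ> \<phi>) u)"
proof
  show "tangent_space M x (\<phi> u) \<subseteq> range (FD (x \<circ> \<phi>) u)"
  proof
    fix v assume "v \<in> tangent_space M x (\<phi> u)"
    then obtain \<gamma> where "tangent_curve M x (\<phi> u) v \<gamma>" unfolding tangent_space_def by blast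
    from tangent_curve_lift[OF lp u this] show "v \<in> range (FD (x \<circ> \<phi>) u)" by blast
  qed
  show "range (FD (x \<circ> \<phi>) u) \<subseteq> tangent_space M x (\<phi> u)"
    unfolding tangent_space_def using tangent_curve_param[OF lp u] by blast
qed

lemma dir_deriv_param:
  assumes lp: "local_param M x U \<phi>" and u: "u \<in> U" and f: "(f \<circ> \<phi>) differentiable (at u)"
  shows "dir_deriv M x f (\<phi> u) (FD (x \<circ> \<phi>) u w) = FD (f \<circ> \<phi>) u w"
  unfolding dir_deriv_def
proof (rule the_equality)
  have injX: "inj (FD (x \<circ> \<phi>) u)" using lp u by (simp add: local_param_def)
  show main: "\<forall>\<gamma>. tangent_curve M x (\<phi> u) (FD (x \<circ> \<phi>) u w) \<gamma> \<longrightarrow>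
    (f \<circ> \<gamma> has_vector_derivative FD (f \<circ> \<phi>) u w) (at 0)"
  proof (intro allI impI)
    fix \<gamma> assume "tangent_curve M x (\<phi> u) (FD (x \<circ> \<phi>) u w) \<gamma>"
    from tangent_curve_lift[OF lp u this]
    obtain \<beta> w' where \<beta>: "\<beta> 0 = u" "(\<beta> has_vector_derivative w') (at 0)"
      "FD (x \<circ> \<phi>) u w' = FD (x \<circ> \<phi>) u w" "eventually (\<lambda>t. \<phi> (\<beta> t) = \<gamma> t) (nhds 0)"
      by metis
    have "w' = w" using \<beta>(3) injX by (simp add: inj_eq)
    then have "((\<lambda>t. (f \<circ> \<phi>) (\<beta> t)) has_derivative (\<lambda>h. FD (f \<circ> \<phi>) u (h *\<^sub>R w))) (at 0)"
      using has_derivative_compose[OF \<beta>(2)[unfolded has_vector_derivative_def], of "f \<circ> \<phi>" "FD (f \<circ> \<phi>) u"]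
        FD_worksD[OF f] \<beta>(1) by simp
    then have d: "((\<lambda>t. (f \<circ> \<phi>) (\<beta> t)) has_vector_derivative FD (f \<circ> \<phi>) u w) (at 0)"
      by (simp add: has_vector_derivative_def linear_scale[OF FD_linear[OF f]])
    obtain S where "open S" "0 \<in> S" "\<And>t. t \<in> S \<Longrightarrow> \<phi> (\<beta> t) = \<gamma> t"
      using \<beta>(4) unfolding eventually_nhds by blast
    then show "(f \<circ> \<gamma> has_vector_derivative FD (f \<circ> \<phi>) u w) (at 0)"
      by (intro has_vector_derivative_transform_within_open[OF d, of S]) auto
  qed
  fix d assume "\<forall>\<gamma>. tangent_curve M x (\<phi> u) (FD (x \<circ> \<phi>) u w) \<gamma> \<longrightarrow> (f \<circ> \<gamma> has_vector_derivative d) (at 0)"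
  with main show "d = FD (f \<circ> \<phi>) u w"
    using tangent_curve_param[OF lp u] vector_derivative_unique_at by blast
qed

section \<open>Traces and orthogonal projections on images of linear maps\<close>

lemma trace_on_range:
  fixes A :: "'p::euclidean_space \<Rightarrow> 'e::euclidean_space"
  assumes A: "linear A" "inj A" and S: "linear S" and T: "\<And>v. T (A v) = A (S v)"
  shows "trace_on (range A) T = (\<Sum>i\<in>Basis. S i \<bullet> i)"
proof -
  have "\<exists>B. independent B \<and> span B = range A"
  proof -
    obtain B where "B \<subseteq> range A" "independent B" "range A \<subseteq> span B"
      using maximal_independent_subset by blast
    moreover have "span B \<subseteq> range A"
      using \<open>B \<subseteq> range A\<close> linear_subspace_image[OF A(1) subspace_UNIV] by (rule span_minimal)
    ultimately show ?thesis by blast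
  qed
  then obtain B where B: "B = (SOME B. independent B \<and> span B = range A)" "independent B" "span B = range A"
    by (metis (mono_tags, lifting) someI_ex)
  have fB: "finite B" using B(2) by (rule finiteI_independent)
  obtain q where q: "linear q" "q \<circ> A = id" using linear_injective_left_inverse[OF A] by blast
  have qA: "q (A v) = v" for v using q(2) by (simp add: pointfree_idE)
  have Aq: "A (q b) = b" if "b \<in> B" for b
    using that B(3) span_base qA by (metis imageE)
  have AS: "linear (\<lambda>v. A (S v))" using linear_compose[OF S A(1)] by (simp add: o_def)
  have "representation B (T b) b = (\<Sum>i\<in>Basis. (q b \<bullet> i) * representation B (A (S i)) b)" if "b \<in> B" for b
  proof -
    have "T b = A (S (q b))" using T[of "q b"] Aq[OF that] by simp
    also have "\<dots> = (\<Sum>i\<in>Basis. (q b \<bullet> i) *\<^sub>R A (S i))" by (rule linear_basis_expand[OF AS])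
    finally have Tb: "T b = \<dots>" .
    have sp: "A (S i) \<in> span B" for i using B(3) by blast
    show ?thesis
      unfolding Tb by (subst representation_sum[OF B(2)]) (auto intro: span_scale sp simp: representation_scale[OF B(2) sp])
  qed
  \<comment> \<open>\<open>trace_on\<close> chooses an arbitrary basis B. Exchanging the two sums,
    as in tr (PQ) = tr (QP), eliminates it.\<close>
  then have "(\<Sum>b\<in>B. representation B (T b) b)
      = (\<Sum>b\<in>B. \<Sum>i\<in>Basis. (q b \<bullet> i) * representation B (A (S i)) b)" by simp
  also have "\<dots> = (\<Sum>i\<in>Basis. \<Sum>b\<in>B. (q b \<bullet> i) * representation B (A (S i)) b)" by (rule sum.swap)
  also have "\<dots> = (\<Sum>i\<in>Basis. S i \<bullet> i)"
  proof (rule sum.cong)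
    fix i :: 'p
    have "(\<Sum>b\<in>B. (q b \<bullet> i) * representation B (A (S i)) b)
        = q (\<Sum>b\<in>B. representation B (A (S i)) b *\<^sub>R b) \<bullet> i"
      by (simp add: linear_sum[OF q(1)] linear_scale[OF q(1)] inner_sum_left mult.commute)
    also have "(\<Sum>b\<in>B. representation B (A (S i)) b *\<^sub>R b) = A (S i)"
      using B(3) by (intro sum_representation_eq[OF B(2) _ fB]) auto
    finally show "(\<Sum>b\<in>B. (q b \<bullet> i) * representation B (A (S i)) b) = S i \<bullet> i" by (simp add: qA)
  qed simp
  finally show ?thesis unfolding trace_on_def B(1)[symmetric] by simp
qed

lemma orth_proj_space_form_tangent:
  assumes c: "c \<in> {-1, 1}" and y: "ip c y y = c" and w: "w \<in> space_form_tangent c y"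
  shows "orth_proj c (space_form_tangent c y) w = w"
  unfolding orth_proj_def
proof (rule the_equality)
  show "w \<in> space_form_tangent c y \<and> (\<forall>u\<in>space_form_tangent c y. ip c (w - w) u = 0)"
    using w by (simp add: ip.zero_left)
  fix v assume v: "v \<in> space_form_tangent c y \<and> (\<forall>u\<in>space_form_tangent c y. ip c (w - v) u = 0)"
  have cc: "c * c = 1" using c by auto
  have "ip c (w - v) z = 0" for z
  proof -
    have wy: "ip c (w - v) y = 0" using v w by (simp add: space_form_tangent_def ip_simps)
    \<comment> \<open>The y-component of z is removed; c stands for its own inverse, as ip c y y =
      c.\<close>
    have "z - (c * ip c z y) *\<^sub>R y \<in> space_form_tangent c y"
      using cc by (simp add: space_form_tangent_def ip_simps y)
    then have "ip c (w - v) (z - (c * ip c z y) *\<^sub>R y) = 0" using v by blast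
    then show ?thesis using wy by (simp add: ip_simps)
  qed
  then show "v = w" using ip_nondegenerate[OF c, of "w - v"] by simp
qed

text \<open>The Gram operator g of A is injective by positivity, hence surjective, and this produces
  the projection. Positivity also gives its uniqueness, so that \<open>THE\<close> denotes
  it.\<close>

lemma orth_proj_range:
  fixes A :: "'q::euclidean_space \<Rightarrow> real \<times> (real^'d)"
  assumes A: "linear A" and pos: "\<And>v. v \<noteq> 0 \<Longrightarrow> ip c (A v) (A v) > 0"
  shows "orth_proj c (range A) w \<in> range A"
proof -
  define g where "g v = (\<Sum>b\<in>Basis. ip c (A v) (A b) *\<^sub>R b)" for v
  have ipA: "linear (\<lambda>v. ip c z (A v))" for z
    using linear_compose[OF A bounded_linear.linear[OF ip.bounded_linear_right]] by (simp add: o_def)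
  have g: "ip c (A v) (A w) = g v \<bullet> w" for v w
    unfolding linear_basis_expand[OF ipA, of _ w] g_def
    by (simp add: inner_sum_left inner_commute[of w] mult.commute)
  have ling: "linear g"
    unfolding g_def by (intro linearI)
      (simp_all add: linear_add[OF A] linear_scale[OF A] ip_simps scaleR_add_left sum.distrib scaleR_sum_right)
  have "inj g"
    unfolding linear_injective_0[OF ling]
  proof (intro allI impI)
    fix v assume "g v = 0"
    then have "ip c (A v) (A v) = 0" by (simp add: g)
    then show "v = 0" using pos by force
  qed
  then have "surj g" by (rule linear_inj_imp_surj[OF ling])
  then obtain v where v: "g v = (\<Sum>b\<in>Basis. ip c w (A b) *\<^sub>R b)" by (metis surjD)
  have w: "ip c w (A z) = ip c (A v) (A z)" for z
    unfolding g v linear_basis_expand[OF ipA, of w z] by (simp add: inner_sum_left inner_commute[of z] mult.commute)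
  have "orth_proj c (range A) w = A v"
    unfolding orth_proj_def
  proof (rule the_equality)
    show "A v \<in> range A \<and> (\<forall>u\<in>range A. ip c (w - A v) u = 0)"
      using w by (auto simp: ip_simps)
    fix y assume y: "y \<in> range A \<and> (\<forall>u\<in>range A. ip c (w - y) u = 0)"
    then obtain v' where v': "y = A v'" by blast
    have "ip c (A (v - v')) (A (v - v')) = 0"
      using y w[of "v - v'"] unfolding v' by (simp add: linear_diff[OF A] ip_simps)
    then have "v - v' = 0" using pos[of "v - v'"] by (cases "v - v' = 0") simp_all
    then show "y = A v" using v' by simp
  qed
  then show ?thesis by blast
qed

section \<open>From the hypersurface to its charts\<close>

context hypersurface_chart
begin

text \<open>This is n H in the chart, the trace of the shape operator in parameter coordinates; in
  this form its smoothness is visible.\<close>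

definition mc :: "'p \<Rightarrow> real" where
  "mc u = (\<Sum>i\<in>Basis. - tc u (FD Nu u i) \<bullet> i)"

lemma smooth_mc: "smooth_on V mc"
proof -
  have "smooth_on V (\<lambda>u. \<Sum>i\<in>Basis. (- 1) * (tc u (FD Nu u i) \<bullet> i))"
    by (intro smooth_on_sum smooth_on_mult smooth_on_const smooth_on_inner smooth_on_tc smooth_on_FD
        smN open_V)
  then show ?thesis by (simp add: mc_def[abs_def])
qed

text \<open>The vector representing \<open>Df \<circ> tc\<close> with respect to \<^term>\<open>ip c\<close>; the sign in the first coordinate
  compensates the one in \<^term>\<open>ip c\<close>.\<close>
definition gr :: "('p \<Rightarrow> real) \<Rightarrow> 'p \<Rightarrow> real \<times> (real^'d)" where
  "gr f u = (\<lambda>z. (c * fst z, snd z)) (\<Sum>i\<in>Basis. FD f u (tc u i) *\<^sub>R i)"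

lemma smooth_gr:
  assumes "smooth_on V f" shows "smooth_on V (gr f)"
proof -
  have "smooth_on V (\<lambda>u. \<Sum>i\<in>Basis. FD f u (tc u i) *\<^sub>R i)"
    by (intro smooth_on_sum smooth_on_scaleR smooth_on_const smooth_on_FD_var smooth_on_tc open_V assms)
  then show ?thesis
    unfolding gr_def[abs_def]
    by (intro smooth_on_bounded_linear[of "\<lambda>z. (c * fst z, snd z)"] open_V
        bounded_linear_Pair bounded_linear_const_mult bounded_linear_fst bounded_linear_snd)
qed

lemma ip_gr:
  assumes "u \<in> V" "smooth_on V f"
  shows "ip c (gr f u) z = FD f u (tc u z)"
proof -
  have lin: "linear (\<lambda>z. FD f u (tc u z))"
    using linear_compose[OF linear_tc[OF assms(1)] smooth_on_linear_FD[OF assms(2,1)]] by (simp add: o_def)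
  have "ip c (c * fst y, snd y) z = y \<bullet> z" for y
    using cc by (simp add: ip_def inner_prod_def mult.assoc[symmetric])
  then have "ip c (gr f u) z = (\<Sum>i\<in>Basis. FD f u (tc u i) *\<^sub>R i) \<bullet> z" unfolding gr_def by simp
  also have "\<dots> = FD f u (tc u z)"
    unfolding linear_basis_expand[OF lin, of z] by (simp add: inner_sum_left inner_commute[of z] mult.commute)
  finally show ?thesis .
qed

lemma gr_tangent:
  assumes u: "u \<in> V" and f: "smooth_on V f"
  shows "ip c (gr f u) (Nu u) = 0" "ip c (gr f u) (X u) = 0" "ip c (gr f u) (FD X u v) = FD f u v"
  using tc_frame[OF u, of 0 1 0] tc_frame[OF u, of 0 0 1] tc_FD[OF u, of v]
  by (simp_all add: ip_gr[OF u f] linear_0[OF linX[OF u]] linear_0[OF smooth_on_linear_FD[OF f u]])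

lemma range_FD_X_iff: "u \<in> V \<Longrightarrow> v \<in> range (FD X u) \<longleftrightarrow> ip c v (Nu u) = 0 \<and> ip c v (X u) = 0"
  using FD_tc[of u v, symmetric] by (auto simp: DXN DXX)

end

lemma hypersurface_chartI:
  fixes x N :: "'m::topological_space \<Rightarrow> real \<times> (real^'d)"
  assumes c: "c \<in> {-1, 1}" and M: "hypersurface TYPE('p::euclidean_space) c M x"
    and N: "unit_normal TYPE('p) c M x N" and lp: "local_param M x (V :: 'p set) \<phi>"
    and dim: "DIM('p) + 1 = CARD('d)"
  shows "hypersurface_chart c V (x \<circ> \<phi>) (N \<circ> \<phi>)"
proof
  have sub: "\<phi> u \<in> M" if "u \<in> V" for u using local_param_subset[OF lp] that by blast
  show "open V" "smooth_on V (x \<circ> \<phi>)" using lp by (auto simp: local_param_def)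
  show "smooth_on V (N \<circ> \<phi>)" using N lp by (auto simp: unit_normal_def smooth_map_def)
  fix u assume u: "u \<in> V"
  show "ip c ((x \<circ> \<phi>) u) ((x \<circ> \<phi>) u) = c"
    using M sub[OF u] by (auto simp: hypersurface_def space_form_def)
  show "inj (FD (x \<circ> \<phi>) u)" using lp u by (auto simp: local_param_def)
  show "ip c ((N \<circ> \<phi>) u) ((N \<circ> \<phi>) u) = 1" "ip c ((N \<circ> \<phi>) u) ((x \<circ> \<phi>) u) = 0"
    using N sub[OF u] by (auto simp: unit_normal_def space_form_tangent_def)
  show "ip c ((N \<circ> \<phi>) u) (FD (x \<circ> \<phi>) u v) = 0" for v
    using N sub[OF u] tangent_space_param[OF lp u] by (auto simp: unit_normal_def)
qed (use c dim in auto)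

text \<open>Smoothness of H and of its unit gradient is derived here: in a chart they are given by
  the smooth expressions \<open>mc\<close> and \<open>gr\<close>.\<close>

lemma biconservative_chartI:
  fixes x N :: "'m::topological_space \<Rightarrow> real \<times> (real^'d)"
  assumes c: "c \<in> {-1, 1}" and M: "hypersurface TYPE('p::euclidean_space) c M x"
    and N: "unit_normal TYPE('p) c M x N" and lp: "local_param M x (V :: 'p set) \<phi>"
    and dim: "DIM('p) + 1 = CARD('d)" and n: "n > 0"
    and bc: "biconservative n c M x N" and H: "H = mean_curvature n c M x N"
    and nz: "\<And>p. p \<in> M \<Longrightarrow> grad c M x H p \<noteq> 0" and e: "e = unit_grad c M x H"
  obtains W where "biconservative_chart c V (x \<circ> \<phi>) (N \<circ> \<phi>) (H \<circ> \<phi>) W (e \<circ> \<phi>) (n / 2)"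
proof -
  interpret hypersurface_chart c V "x \<circ> \<phi>" "N \<circ> \<phi>"
    by (rule hypersurface_chartI[OF c M N lp dim])
  let ?X = "x \<circ> \<phi>" and ?N = "N \<circ> \<phi>"
  have sub: "\<phi> u \<in> M" if "u \<in> V" for u using local_param_subset[OF lp] that by blast
  have shape: "shape_op c M x N (\<phi> u) (FD ?X u v) = - FD ?N u v" if u: "u \<in> V" for u v
  proof -
    have "FD ?N u v \<in> space_form_tangent c (x (\<phi> u))"
      using DNX[OF u, of v] by (simp add: space_form_tangent_def)
    moreover have "ip c (x (\<phi> u)) (x (\<phi> u)) = c" using XX[OF u] by simp
    ultimately show ?thesis
      unfolding shape_op_def dir_deriv_param[OF lp u smooth_on_differentiable[OF smN u]]
      by (simp add: orth_proj_space_form_tangent[OF c])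
  qed
  have Hmc: "(H \<circ> \<phi>) u = mc u / n" if u: "u \<in> V" for u
  proof -
    have "trace_on (range (FD ?X u)) (shape_op c M x N (\<phi> u)) = mc u"
      unfolding mc_def
    proof (rule trace_on_range[OF linX[OF u] inj_FD_X[OF u]])
      show "linear (\<lambda>v. - tc u (FD ?N u v))"
        using linear_compose_neg[OF linear_compose[OF linN[OF u] linear_tc[OF u]]] by (simp add: o_def)
      show "shape_op c M x N (\<phi> u) (FD ?X u v) = FD ?X u (- tc u (FD ?N u v))" for v
        by (simp add: shape u linear_neg[OF linX[OF u]] FD_tc DNN DNX del: o_apply)
    qed
    then show ?thesis by (simp add: H mean_curvature_def tangent_space_param[OF lp u])
  qed
  have smH: "smooth_on V (H \<circ> \<phi>)"
  proof (rule smooth_on_cong[OF open_V])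
    show "smooth_on V (\<lambda>u. (1 / n) * mc u)"
      by (intro smooth_on_mult smooth_on_const smooth_mc open_V)
  qed (simp add: Hmc del: o_apply)
  define g where "g = gr (H \<circ> \<phi>)"
  have smg: "smooth_on V g" unfolding g_def by (rule smooth_gr[OF smH])
  note g_tan = gr_tangent[OF _ smH, folded g_def]
  have gg: "grad c M x H (\<phi> u) = g u" if u: "u \<in> V" for u
    unfolding grad_def tangent_space_param[OF lp u]
  proof (rule the_equality)
    have dd: "dir_deriv M x H (\<phi> u) (FD ?X u w) = FD (H \<circ> \<phi>) u w" for w
      by (rule dir_deriv_param[OF lp u smooth_on_differentiable[OF smH u]])
    show gt: "g u \<in> range (FD ?X u) \<and> (\<forall>w\<in>range (FD ?X u). ip c (g u) w = dir_deriv M x H (\<phi> u) w)"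
      using g_tan[OF u] by (auto simp: range_FD_X_iff u dd simp del: o_apply)
    fix v assume v: "v \<in> range (FD ?X u) \<and> (\<forall>w\<in>range (FD ?X u). ip c v w = dir_deriv M x H (\<phi> u) w)"
    have "v - g u = 0"
    proof (rule tangent_eq_0[OF u])
      show "ip c (v - g u) (?N u) = 0" "ip c (v - g u) (?X u) = 0"
        using v gt by (simp_all add: range_FD_X_iff u ip_simps del: o_apply)
      show "ip c (v - g u) (FD ?X u w) = 0" for w
        using v gt by (simp add: ip_simps)
    qed
    then show "v = g u" by simp
  qed
  have gpos: "ip c (g u) (g u) > 0" if u: "u \<in> V" for u
    using tangent_positive[OF u g_tan(2)[OF u]] nz[OF sub[OF u]] gg[OF u] by simp
  define r where "r u = 1 / sqrt (ip c (g u) (g u))" for u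
  have smgg: "smooth_on V (\<lambda>u. ip c (g u) (g u))" by (intro smooth_on_ip open_V smg)
  have smr: "smooth_on V r"
    unfolding r_def by (rule smooth_on_compose[OF open_V open_greaterThan _ smgg smooth_on_inverse_sqrt])
      (use gpos in auto)
  have eg: "(e \<circ> \<phi>) u = r u *\<^sub>R g u" if "u \<in> V" for u
    by (simp add: e unit_grad_def Let_def gg[OF that] r_def)
  have rpos: "r u > 0" "r u * r u * ip c (g u) (g u) = 1" if "u \<in> V" for u
    using gpos[OF that] by (auto simp: r_def)
  show thesis
  \<comment> \<open>This function is |grad H|, since r u is the reciprocal of that length.\<close>
  proof (rule that[of "\<lambda>u. r u * ip c (g u) (g u)"], unfold_locales)
    show "smooth_on V (H \<circ> \<phi>)" by (rule smH)
    show "smooth_on V (\<lambda>u. r u * ip c (g u) (g u))" by (intro smooth_on_mult open_V smr smgg)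
    show "smooth_on V (e \<circ> \<phi>)"
      by (rule smooth_on_cong[OF open_V _ smooth_on_scaleR[OF open_V smr smg]]) (simp add: eg del: o_apply)
    show "real n / 2 \<noteq> 0" using n by simp
    fix u assume u: "u \<in> V"
    show "0 < r u * ip c (g u) (g u)" using rpos[OF u] gpos[OF u] by simp
    show "ip c ((e \<circ> \<phi>) u) ((e \<circ> \<phi>) u) = 1"
      using rpos(2)[OF u] by (simp add: eg u ip_simps mult.assoc del: o_apply)
    show "ip c ((e \<circ> \<phi>) u) (?N u) = 0" "ip c ((e \<circ> \<phi>) u) (?X u) = 0"
      using g_tan[OF u] by (simp_all add: eg u ip_simps del: o_apply)
    show "FD (H \<circ> \<phi>) u v = r u * ip c (g u) (g u) * ip c ((e \<circ> \<phi>) u) (FD ?X u v)" for v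
    proof -
      have "r u * ip c (g u) (g u) * (r u * FD (H \<circ> \<phi>) u v)
          = (r u * r u * ip c (g u) (g u)) * FD (H \<circ> \<phi>) u v" by (simp only: ac_simps)
      then show ?thesis using g_tan(3)[OF u, of v] rpos(2)[OF u] by (simp add: eg u ip_simps del: o_apply)
    qed
    have gX: "FD ?X u (tc u (g u)) = g u" using g_tan[OF u] by (intro FD_tc[OF u])
    have "shape_op c M x N (\<phi> u) (grad c M x H (\<phi> u)) + (real n * H (\<phi> u) / 2) *\<^sub>R grad c M x H (\<phi> u) = 0"
      using bc sub[OF u] unfolding biconservative_def Let_def H[symmetric] by blast
    then have "FD ?N u (tc u (g u)) = (real n * H (\<phi> u) / 2) *\<^sub>R g u"
      using shape[OF u, of "tc u (g u)"] unfolding gX gg[OF u] by simp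
    then show "FD ?N u (tc u ((e \<circ> \<phi>) u)) = (real n / 2 * (H \<circ> \<phi>) u) *\<^sub>R (e \<circ> \<phi>) u"
      unfolding eg[OF u] linear_scale[OF linear_tc[OF u]] linear_scale[OF linN[OF u]] by simp
  qed
qed

section \<open>Parallel normal frames along the leaf\<close>

text \<open>For w tangent to the leaf the components of de w and dN w along Nu, X and e are zero or
  multiples of <e, dX w> = 0; for dN this rests on e being principal. Thus e, N and x are parallel
  normal fields along the leaf.\<close>

lemma (in biconservative_chart) frame_derivative_in_leaf:
  assumes u: "u \<in> V" and w: "ip c (FD X u w) (e u) = 0"
  shows "FD e u w \<in> {v \<in> range (FD X u). ip c v (e u) = 0}"
    "FD Nu u w \<in> {v \<in> range (FD X u). ip c v (e u) = 0}"
    "FD X u w \<in> {v \<in> range (FD X u). ip c v (e u) = 0}"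
proof -
  have w': "ip c (e u) (FD X u w) = 0" using w by (simp only: ip_commute)
  then show "FD e u w \<in> {v \<in> range (FD X u). ip c v (e u) = 0}"
    unfolding mem_Collect_eq range_FD_X_iff[OF u] by (simp add: DeN DeX Dee u)
  show "FD Nu u w \<in> {v \<in> range (FD X u). ip c v (e u) = 0}"
    unfolding mem_Collect_eq range_FD_X_iff[OF u] using w' by (simp add: DNN DNX DNe u)
  show "FD X u w \<in> {v \<in> range (FD X u). ip c v (e u) = 0}"
    using w by blast
qed

text \<open>The situation of two parallel normal fields: the derivative of each is tangent to the
  leaf and so orthogonal to the other.\<close>

lemma ip_constant_on_ball:
  fixes \<phi> \<xi> :: "'q::euclidean_space \<Rightarrow> real \<times> (real^'d)"
  assumes \<phi>: "\<And>t. t \<in> ball t0 r \<Longrightarrow> \<phi> differentiable (at t)"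
    and \<xi>: "\<And>t. t \<in> ball t0 r \<Longrightarrow> \<xi> differentiable (at t)"
    and o: "\<And>t v. t \<in> ball t0 r \<Longrightarrow> ip c (FD \<phi> t v) (\<xi> t) = 0"
      "\<And>t v. t \<in> ball t0 r \<Longrightarrow> ip c (\<phi> t) (FD \<xi> t v) = 0"
    and t: "t \<in> ball t0 r"
  shows "ip c (\<phi> t) (\<xi> t) = ip c (\<phi> t0) (\<xi> t0)"
proof -
  have "((\<lambda>t. ip c (\<phi> t) (\<xi> t)) has_derivative (\<lambda>v. 0)) (at t)" if "t \<in> ball t0 r" for t
  proof -
    have "((\<lambda>t. ip c (\<phi> t) (\<xi> t)) has_derivative
        (\<lambda>v. ip c (\<phi> t) (FD \<xi> t v) + ip c (FD \<phi> t v) (\<xi> t))) (at t)"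
      by (rule ip.FDERIV[OF FD_worksD[OF \<phi>[OF that]] FD_worksD[OF \<xi>[OF that]]])
    then show ?thesis by (simp add: o[OF that])
  qed
  then have "\<exists>k. \<forall>t\<in>ball t0 r. ip c (\<phi> t) (\<xi> t) = k"
    by (intro has_derivative_zero_constant convex_ball) (blast intro: has_derivative_at_withinI)
  moreover have "t0 \<in> ball t0 r" using t by (metis centre_in_ball ball_empty empty_iff not_le)
  ultimately show ?thesis using t by metis
qed

lemma orthonormal_expansion:
  fixes \<xi> :: "3 \<Rightarrow> real \<times> (real^'d)"
  assumes "\<And>i. \<bar>ip c (\<xi> i) (\<xi> i)\<bar> = 1" "\<And>i j. i \<noteq> j \<Longrightarrow> ip c (\<xi> i) (\<xi> j) = 0"
    and "v \<in> span (range \<xi>)"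
  shows "v = (\<Sum>i\<in>UNIV. (ip c (\<xi> i) (\<xi> i) * ip c v (\<xi> i)) *\<^sub>R \<xi> i)"
proof (rule linear_eq_on_span[OF linear_ident _ _ assms(3)])
  show "linear (\<lambda>v. \<Sum>i\<in>UNIV. (ip c (\<xi> i) (\<xi> i) * ip c v (\<xi> i)) *\<^sub>R \<xi> i)"
    by (rule linearI) (simp_all add: ip_simps algebra_simps sum.distrib scaleR_sum_right)
  fix v assume "v \<in> range \<xi>"
  then obtain j where j: "v = \<xi> j" by blast
  have sq: "ip c (\<xi> j) (\<xi> j) * ip c (\<xi> j) (\<xi> j) = 1" using assms(1)[of j] by (auto simp: abs_if split: if_splits)
  have "(\<Sum>i\<in>UNIV. (ip c (\<xi> i) (\<xi> i) * ip c v (\<xi> i)) *\<^sub>R \<xi> i) = (\<Sum>i\<in>UNIV. if i = j then \<xi> j else 0)"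
    by (rule sum.cong) (use assms(2) sq in \<open>auto simp: j\<close>)
  then show "v = (\<Sum>i\<in>UNIV. (ip c (\<xi> i) (\<xi> i) * ip c v (\<xi> i)) *\<^sub>R \<xi> i)"
    by (simp add: j)
qed

lemma local_param_compose:
  assumes lp: "local_param M x V \<phi>" and D: "open D" "G ` D \<subseteq> V" "open (G ` D)"
    and hom: "homeomorphism D (G ` D) G F" and smG: "smooth_on D G"
    and injG: "\<And>y. y \<in> D \<Longrightarrow> inj (FD G y)"
  shows "local_param M x D (\<phi> \<circ> G)"
proof -
  obtain \<psi> where \<psi>: "homeomorphism V (\<phi> ` V) \<phi> \<psi>" and op: "openin (top_of_set M) (\<phi> ` V)"
    and smX: "smooth_on V (x \<circ> \<phi>)" and injX: "\<And>u. u \<in> V \<Longrightarrow> inj (FD (x \<circ> \<phi>) u)" and V: "open V"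
    using lp unfolding local_param_def by blast
  have "openin (top_of_set (\<phi> ` V)) (\<phi> ` (G ` D))"
    by (rule homeomorphism_imp_open_map[OF \<psi>]) (use D V in \<open>simp add: openin_open_eq\<close>)
  then have "openin (top_of_set M) (\<phi> ` (G ` D))" using op by (rule openin_trans)
  moreover have "homeomorphism (G ` D) (\<phi> ` (G ` D)) \<phi> \<psi>"
    by (rule homeomorphism_of_subsets[OF \<psi> D(2) image_mono[OF D(2)]]) simp
  from homeomorphism_compose[OF hom this]
  have "homeomorphism D ((\<phi> \<circ> G) ` D) (\<phi> \<circ> G) (F \<circ> \<psi>)"
    by (simp only: image_comp)
  moreover have "smooth_on D (x \<circ> (\<phi> \<circ> G))"
    using smooth_on_compose[OF D(1) V D(2) smG smX] by (simp add: o_def)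
  moreover have "inj (FD (x \<circ> (\<phi> \<circ> G)) y)" if "y \<in> D" for y
  proof -
    have "G y \<in> V" using D(2) that by blast
    have "((x \<circ> (\<phi> \<circ> G)) has_derivative (\<lambda>v. FD (x \<circ> \<phi>) (G y) (FD G y v))) (at y)"
      using has_derivative_compose[OF smooth_on_has_derivative[OF smG that]
          smooth_on_has_derivative[OF smX \<open>G y \<in> V\<close>]] by (simp add: o_def)
    from FD_eqI[OF this] show ?thesis
      using inj_compose[OF injX[OF \<open>G y \<in> V\<close>] injG[OF that]] by (simp add: o_def)
  qed
  ultimately show ?thesis
    using D(1) by (auto simp: local_param_def image_comp)
qed

theorem theorem3p6:
  fixes n :: nat and c :: real
    and M L :: "'m::{t2_space, second_countable_topology} set"
    and x N :: "'m \<Rightarrow> real \<times> (real^'d)"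
    and H :: "'m \<Rightarrow> real"
    and e\<^sub>1 :: "'m \<Rightarrow> real \<times> (real^'d)"
    and m :: 'm
    and U :: "(real^'k) set" and \<Theta> :: "real^'k \<Rightarrow> 'm"
  assumes "CARD('k) = n - 1" and "CARD('d) = n + 1"
    and "c \<in> {-1, 1}"
    and "hypersurface TYPE(real \<times> (real^'k)) c M x"
    and "unit_normal TYPE(real \<times> (real^'k)) c M x N"
    and "biconservative n c M x N"
    and "H = mean_curvature n c M x N"
    and "\<And>p. p \<in> M \<Longrightarrow> grad c M x H p \<noteq> 0"
    and "\<And>p. p \<in> M \<Longrightarrow> H p > 0"
    and "m \<in> M"
    and "c = -1 \<Longrightarrow> H m \<noteq> 2 / real n"
    and "e\<^sub>1 = unit_grad c M x H"
    and "integral_submanifold TYPE(real^'k) M x (orth_distribution c M x e\<^sub>1) L"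
    and "m \<in> L"
    and "local_param L x U \<Theta>" and "m \<in> \<Theta> ` U"
  shows "\<exists>W. openin (top_of_set M) W \<and> m \<in> W \<and>
    (\<forall>\<xi>. parallel_orthonormal_normal_base c L x U \<Theta> \<xi> \<longrightarrow>
      (\<exists>a b U' \<psi> (\<alpha> :: 3 \<Rightarrow> real \<Rightarrow> real).
         U' \<subseteq> U \<and>
         local_param M x ({a<..<b} \<times> U') \<psi> \<and> \<psi> ` ({a<..<b} \<times> U') = W \<and>
         (\<forall>i. smooth_on {a<..<b} (\<alpha> i)) \<and>
         (\<forall>s\<in>{a<..<b}. \<forall>t\<in>U'. x (\<psi> (s, t)) =
            x (\<Theta> t) + \<alpha> 1 s *\<^sub>R \<xi> 1 t + \<alpha> 2 s *\<^sub>R \<xi> 2 t + \<alpha> 3 s *\<^sub>R \<xi> 3 t) \<and>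
         (\<forall>t\<in>U'. integral_curve M x e\<^sub>1 {a<..<b} (\<lambda>s. \<psi> (s, t)))))"
proof -
  have "CARD('k) > 0" by simp
  with assms(1) have n: "n > 0" by linarith
  have dim: "DIM(real \<times> (real^'k)) + 1 = CARD('d)" using assms(1,2) \<open>CARD('k) > 0\<close> by simp
  obtain V :: "(real \<times> (real^'k)) set" and \<phi> where lp: "local_param M x V \<phi>" and mV: "m \<in> \<phi> ` V"
    using assms(4,10) unfolding hypersurface_def immersed_manifold_def by blast
  obtain h where "biconservative_chart c V (x \<circ> \<phi>) (N \<circ> \<phi>) (H \<circ> \<phi>) h (e\<^sub>1 \<circ> \<phi>) (real n / 2)"
    by (rule biconservative_chartI[OF assms(3-5) lp dim n assms(6,7,8,12)])
  then interpret biconservative_chart c V "x \<circ> \<phi>" "N \<circ> \<phi>" "H \<circ> \<phi>" h "e\<^sub>1 \<circ> \<phi>" "real n / 2" .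
  note bc = biconservative_chart_axioms
  have sub: "\<phi> u \<in> M" if "u \<in> V" for u using local_param_subset[OF lp] that by blast
  obtain t0 where t0: "t0 \<in> U" "\<Theta> t0 = m" using assms(16) by blast
  have U: "open U" "continuous_on U \<Theta>" and smY: "smooth_on U (x \<circ> \<Theta>)"
    and injY: "\<And>t. t \<in> U \<Longrightarrow> inj (FD (x \<circ> \<Theta>) t)"
    using assms(15) unfolding local_param_def homeomorphism_def by auto
  have LM: "L \<subseteq> M" using assms(13) by (simp add: integral_submanifold_def)
  have \<Theta>L: "\<Theta> ` U \<subseteq> L" by (rule local_param_subset[OF assms(15)])
  have "\<Theta> ` U \<subseteq> M" using LM \<Theta>L by blast
  moreover have "\<Theta> t0 \<in> \<phi> ` V" using t0 mV by simp
  ultimately obtain T \<beta> where T: "open T" "t0 \<in> T" "T \<subseteq> U" "continuous_on T \<beta>"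
    and \<beta>: "\<And>t. t \<in> T \<Longrightarrow> \<beta> t \<in> V" "\<And>t. t \<in> T \<Longrightarrow> \<phi> (\<beta> t) = \<Theta> t"
    using local_param_pullback[OF lp U(1) t0(1) U(2)] by metis
  have \<beta>X: "(x \<circ> \<phi>) (\<beta> t) = (x \<circ> \<Theta>) t" if "t \<in> T" for t using \<beta>(2)[OF that] by simp
  have isC: "isCont \<beta> t" if "t \<in> T" for t
    using T(1,4) that by (simp add: continuous_on_eq_continuous_at)
  have TL: "tangent_space L x (\<Theta> t) = range (FD (x \<circ> \<Theta>) t)" if "t \<in> U" for t
    by (rule tangent_space_param[OF assms(15) that])
  have rangeY: "range (FD (x \<circ> \<Theta>) t) =
      {v \<in> range (FD (x \<circ> \<phi>) (\<beta> t)). ip c v ((e\<^sub>1 \<circ> \<phi>) (\<beta> t)) = 0}" if t: "t \<in> T" for t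
  proof -
    have tU: "t \<in> U" using t T by blast
    have "range (FD (x \<circ> \<Theta>) t) = orth_distribution c M x e\<^sub>1 (\<Theta> t)"
      unfolding TL[OF tU, symmetric]
      using assms(13) \<Theta>L tU unfolding integral_submanifold_def by blast
    also have "\<dots> = orth_distribution c M x e\<^sub>1 (\<phi> (\<beta> t))" by (simp only: \<beta>(2)[OF t])
    finally show ?thesis
      by (simp only: orth_distribution_def tangent_space_param[OF lp \<beta>(1)[OF t]] o_apply)
  qed
  obtain \<delta> r G F where \<delta>: "\<delta> > 0" and r: "r > 0" "ball t0 r \<subseteq> T"
    and GV: "G ` ({-\<delta><..<\<delta>} \<times> ball t0 r) \<subseteq> V" "open (G ` ({-\<delta><..<\<delta>} \<times> ball t0 r))"
    and hom: "homeomorphism ({-\<delta><..<\<delta>} \<times> ball t0 r) (G ` ({-\<delta><..<\<delta>} \<times> ball t0 r)) G F"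
    and smG: "smooth_on ({-\<delta><..<\<delta>} \<times> ball t0 r) G"
    and injG: "\<And>y. y \<in> {-\<delta><..<\<delta>} \<times> ball t0 r \<Longrightarrow> inj (FD G y)"
    and G0: "\<And>t. t \<in> ball t0 r \<Longrightarrow> G (0, t) = \<beta> t"
    and dG: "\<And>s t. s \<in> {-\<delta><..<\<delta>} \<Longrightarrow> t \<in> ball t0 r \<Longrightarrow>
       ((\<lambda>s. (x \<circ> \<phi>) (G (s, t))) has_vector_derivative (e\<^sub>1 \<circ> \<phi>) (G (s, t))) (at s)"
    and XG: "\<And>s t. s \<in> {-\<delta><..<\<delta>} \<Longrightarrow> t \<in> ball t0 r \<Longrightarrow> (x \<circ> \<phi>) (G (s, t)) =
       ip c ((x \<circ> \<phi>) (G (s, t0))) ((e\<^sub>1 \<circ> \<phi>) (\<beta> t0)) *\<^sub>R (e\<^sub>1 \<circ> \<phi>) (\<beta> t)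
       + ip c ((x \<circ> \<phi>) (G (s, t0))) ((N \<circ> \<phi>) (\<beta> t0)) *\<^sub>R (N \<circ> \<phi>) (\<beta> t)
       + (c * ip c ((x \<circ> \<phi>) (G (s, t0))) ((x \<circ> \<phi>) (\<beta> t0))) *\<^sub>R (x \<circ> \<phi>) (\<beta> t)"
    by (rule flow_box[OF bc T(1,2) smooth_on_subset[OF smY T(3)] injY[OF t0(1)] \<beta>(1) isC \<beta>X rangeY])
      (assumption | rule that; assumption)+
  let ?I = "{-\<delta><..<\<delta>}" and ?B = "ball t0 r"
  have BT: "t \<in> T" "t \<in> U" if "t \<in> ?B" for t using that r T by auto
  have t0B: "t0 \<in> ?B" using r by simp
  have oD: "open (?I \<times> ?B)" by (intro open_Times) auto
  have lp\<psi>: "local_param M x (?I \<times> ?B) (\<phi> \<circ> G)"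
    by (rule local_param_compose[OF lp oD GV hom smG injG])
  \<comment> \<open>The neighbourhood comes from the flow box alone and is therefore the same for
    every base \<xi>.\<close>
  define W where "W = (\<phi> \<circ> G) ` (?I \<times> ?B)"
  have "m = (\<phi> \<circ> G) (0, t0)" using G0[OF t0B] \<beta>(2)[OF T(2)] t0(2) by simp
  then have mW: "m \<in> W" unfolding W_def using \<delta> t0B by (intro image_eqI[of _ _ "(0, t0)"]) auto
  have W: "openin (top_of_set M) W" using lp\<psi> by (simp add: local_param_def W_def)
  have curves: "integral_curve M x e\<^sub>1 ?I (\<lambda>s. (\<phi> \<circ> G) (s, t))" if t: "t \<in> ?B" for t
    unfolding integral_curve_def
  proof (intro conjI ballI)
    show "(\<lambda>s. (\<phi> \<circ> G) (s, t)) ` ?I \<subseteq> M" using local_param_subset[OF lp\<psi>] t by auto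
    have "continuous_on (?I \<times> ?B) (\<phi> \<circ> G)"
      using lp\<psi> unfolding local_param_def homeomorphism_def by blast
    then show "continuous_on ?I (\<lambda>s. (\<phi> \<circ> G) (s, t))"
      by (rule continuous_on_compose2) (use t in \<open>auto intro!: continuous_intros\<close>)
    show "(x \<circ> (\<lambda>s. (\<phi> \<circ> G) (s, t)) has_vector_derivative e\<^sub>1 ((\<phi> \<circ> G) (s, t))) (at s)" if "s \<in> ?I" for s
      using dG[OF that t] by (simp add: o_def)
  qed
  have expand: "\<exists>\<alpha> :: 3 \<Rightarrow> real \<Rightarrow> real. (\<forall>i. smooth_on ?I (\<alpha> i)) \<and>
      (\<forall>s\<in>?I. \<forall>t\<in>?B. x ((\<phi> \<circ> G) (s, t)) =
        x (\<Theta> t) + \<alpha> 1 s *\<^sub>R \<xi> 1 t + \<alpha> 2 s *\<^sub>R \<xi> 2 t + \<alpha> 3 s *\<^sub>R \<xi> 3 t)"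
    if par: "parallel_orthonormal_normal_base c L x U \<Theta> \<xi>" for \<xi>
  proof -
    have sm\<xi>: "smooth_on U (\<xi> i)" for i using par by (simp add: parallel_orthonormal_normal_base_def)
    have sp: "span (range (\<lambda>i. \<xi> i t)) = normal_space c L x (\<Theta> t)"
      and on: "\<bar>ip c (\<xi> i t) (\<xi> i t)\<bar> = 1" "i \<noteq> j \<Longrightarrow> ip c (\<xi> i t) (\<xi> j t) = 0"
      and nd: "normal_deriv c L x \<Theta> (\<xi> i) t v = 0" if "t \<in> U" for t i j v
      using par that by (auto simp: parallel_orthonormal_normal_base_def)
    have \<xi>n: "ip c (\<xi> i t) v = 0" if "t \<in> U" "v \<in> range (FD (x \<circ> \<Theta>) t)" for i t v
    proof -
      have "\<xi> i t \<in> normal_space c L x (\<Theta> t)"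
        unfolding sp[OF that(1), symmetric] by (rule span_base) (rule rangeI)
      then show ?thesis using that(2) unfolding normal_space_def TL[OF that(1)] by blast
    qed
    \<comment> \<open>For a parallel field d\<xi> equals its projection to the tangent space of the
      leaf, and \<open>orth_proj_range\<close> puts that projection into the tangent space because
      the metric is positive there.\<close>
    have d\<xi>: "FD (\<xi> i) t v \<in> range (FD (x \<circ> \<Theta>) t)" if t: "t \<in> ?B" for i t v
    proof -
      have "orth_proj c (range (FD (x \<circ> \<Theta>) t)) (FD (\<xi> i) t v) \<in> range (FD (x \<circ> \<Theta>) t)"
      proof (rule orth_proj_range[OF smooth_on_linear_FD[OF smY BT(2)[OF t]]])
        fix v :: "real^'k" assume "v \<noteq> 0"
        then have "FD (x \<circ> \<Theta>) t v \<noteq> 0"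
          using injY[OF BT(2)[OF t]] linear_injective_0[OF smooth_on_linear_FD[OF smY BT(2)[OF t]]] by blast
        moreover have "FD (x \<circ> \<Theta>) t v \<in> range (FD (x \<circ> \<phi>) (\<beta> t))" using rangeY[OF BT(1)[OF t]] by blast
        ultimately show "ip c (FD (x \<circ> \<Theta>) t v) (FD (x \<circ> \<Theta>) t v) > 0"
          using tangent_positive[OF \<beta>(1)[OF BT(1)[OF t]]] range_FD_X_iff[OF \<beta>(1)[OF BT(1)[OF t]]] by blast
      qed
      then show ?thesis
        using nd[OF BT(2)[OF t], of i v] by (simp add: normal_deriv_def Let_def TL BT(2)[OF t])
    qed
    have d\<xi>': "\<xi> i differentiable (at t)" if "t \<in> ?B" for i t
      by (rule smooth_on_differentiable[OF sm\<xi> BT(2)[OF that]])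
    \<comment> \<open>The signs of the base vectors, which parallelism keeps constant on the
      ball.\<close>
    define \<epsilon> where "\<epsilon> i = ip c (\<xi> i t0) (\<xi> i t0)" for i
    have \<epsilon>: "ip c (\<xi> i t) (\<xi> i t) = \<epsilon> i" if "t \<in> ?B" for i t
      unfolding \<epsilon>_def
    proof (rule ip_constant_on_ball[OF _ _ _ _ that])
      fix t v assume t: "t \<in> ?B"
      show "ip c (\<xi> i t) (FD (\<xi> i) t v) = 0" by (rule \<xi>n[OF BT(2)[OF t] d\<xi>[OF t]])
      then show "ip c (FD (\<xi> i) t v) (\<xi> i t) = 0" by (simp only: ip_commute)
    qed (simp_all only: d\<xi>')
    \<comment> \<open>Parallel normal fields have constant scalar products with each \<xi> i, hence
      constant coefficients in this base; g will be e, N and x.\<close>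
    have ex: "g (\<beta> t) = (\<Sum>i\<in>UNIV. (\<epsilon> i * ip c (g (\<beta> t0)) (\<xi> i t0)) *\<^sub>R \<xi> i t)"
      if t: "t \<in> ?B" and smg: "smooth_on V g"
        and dg: "\<And>u w. u \<in> V \<Longrightarrow> ip c (FD (x \<circ> \<phi>) u w) ((e\<^sub>1 \<circ> \<phi>) u) = 0 \<Longrightarrow>
          FD g u w \<in> {v \<in> range (FD (x \<circ> \<phi>) u). ip c v ((e\<^sub>1 \<circ> \<phi>) u) = 0}"
        and ng: "\<And>u v. u \<in> V \<Longrightarrow> v \<in> range (FD (x \<circ> \<phi>) u) \<Longrightarrow> ip c v ((e\<^sub>1 \<circ> \<phi>) u) = 0 \<Longrightarrow> ip c (g u) v = 0"
      for g :: "real \<times> (real^'k) \<Rightarrow> real \<times> (real^'d)" and t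
    proof -
      have gn: "ip c (g (\<beta> t)) v = 0" if "t \<in> ?B" "v \<in> range (FD (x \<circ> \<Theta>) t)" for t v
        using that rangeY[OF BT(1)[OF that(1)]] ng[OF \<beta>(1)[OF BT(1)[OF that(1)]]] by blast
      have gd: "(\<lambda>t. g (\<beta> t)) differentiable (at t)" "FD (\<lambda>t. g (\<beta> t)) t v \<in> range (FD (x \<circ> \<Theta>) t)"
        if t: "t \<in> ?B" for t v
      proof -
        note tT = BT(1)[OF t]
        obtain \<beta>' where \<beta>': "(\<beta> has_derivative \<beta>') (at t)" "\<And>v. FD (x \<circ> \<phi>) (\<beta> t) (\<beta>' v) = FD (x \<circ> \<Theta>) t v"
          by (rule chart_lift_derivative[OF isC[OF tT] \<beta>(1)[OF tT] T(1) tT \<beta>X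
                smooth_on_has_derivative[OF smY BT(2)[OF t]]]) (assumption, rule that)
        have d: "((\<lambda>t. g (\<beta> t)) has_derivative (\<lambda>v. FD g (\<beta> t) (\<beta>' v))) (at t)"
          by (rule has_derivative_compose[OF \<beta>'(1) smooth_on_has_derivative[OF smg \<beta>(1)[OF tT]]])
        then show "(\<lambda>t. g (\<beta> t)) differentiable (at t)" unfolding differentiable_def by blast
        have "FD (x \<circ> \<Theta>) t v \<in> {v \<in> range (FD (x \<circ> \<phi>) (\<beta> t)). ip c v ((e\<^sub>1 \<circ> \<phi>) (\<beta> t)) = 0}"
          using rangeY[OF tT] by blast
        then have "ip c (FD (x \<circ> \<phi>) (\<beta> t) (\<beta>' v)) ((e\<^sub>1 \<circ> \<phi>) (\<beta> t)) = 0" unfolding \<beta>'(2) by blast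
        then show "FD (\<lambda>t. g (\<beta> t)) t v \<in> range (FD (x \<circ> \<Theta>) t)"
          unfolding FD_eqI[OF d] rangeY[OF tT] by (rule dg[OF \<beta>(1)[OF tT]])
      qed
      have "g (\<beta> t) \<in> span (range (\<lambda>i. \<xi> i t))"
        unfolding sp[OF BT(2)[OF t]] normal_space_def TL[OF BT(2)[OF t]] using gn[OF t] by blast
      then have "g (\<beta> t) = (\<Sum>i\<in>UNIV. (ip c (\<xi> i t) (\<xi> i t) * ip c (g (\<beta> t)) (\<xi> i t)) *\<^sub>R \<xi> i t)"
        by (intro orthonormal_expansion on BT(2)[OF t])
      moreover have "ip c (g (\<beta> t)) (\<xi> i t) = ip c (g (\<beta> t0)) (\<xi> i t0)" for i
      proof (rule ip_constant_on_ball[OF gd(1) d\<xi>' _ _ t])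
        fix t v assume t: "t \<in> ?B"
        show "ip c (g (\<beta> t)) (FD (\<xi> i) t v) = 0" by (rule gn[OF t d\<xi>[OF t]])
        have "ip c (\<xi> i t) (FD (\<lambda>t. g (\<beta> t)) t v) = 0" by (rule \<xi>n[OF BT(2)[OF t] gd(2)[OF t]])
        then show "ip c (FD (\<lambda>t. g (\<beta> t)) t v) (\<xi> i t) = 0" by (simp only: ip_commute)
      qed
      ultimately show ?thesis using \<epsilon>[OF t] by simp
    qed
    note frame = frame_derivative_in_leaf
    have ex_e: "(e\<^sub>1 \<circ> \<phi>) (\<beta> t) = (\<Sum>i\<in>UNIV. (\<epsilon> i * ip c ((e\<^sub>1 \<circ> \<phi>) (\<beta> t0)) (\<xi> i t0)) *\<^sub>R \<xi> i t)"
      if "t \<in> ?B" for t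
      by (rule ex[OF that sme frame(1)]) (simp_all only: ip_commute)
    have ex_N: "(N \<circ> \<phi>) (\<beta> t) = (\<Sum>i\<in>UNIV. (\<epsilon> i * ip c ((N \<circ> \<phi>) (\<beta> t0)) (\<xi> i t0)) *\<^sub>R \<xi> i t)"
      if "t \<in> ?B" for t
      by (rule ex[OF that smN frame(2)]) (auto simp: NDX simp del: o_apply)
    have ex_X: "(x \<circ> \<phi>) (\<beta> t) = (\<Sum>i\<in>UNIV. (\<epsilon> i * ip c ((x \<circ> \<phi>) (\<beta> t0)) (\<xi> i t0)) *\<^sub>R \<xi> i t)"
      if "t \<in> ?B" for t
      by (rule ex[OF that smX frame(3)]) (auto simp: DXX ip_commute[of c "(x \<circ> \<phi>) _"] simp del: o_apply)
    \<comment> \<open>The coordinates, in the base at t0, of the displacement along the single curve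
      through t0.\<close>
    define \<alpha> where "\<alpha> i s = \<epsilon> i * ip c ((x \<circ> \<phi>) (G (s, t0)) - (x \<circ> \<phi>) (\<beta> t0)) (\<xi> i t0)" for i s
    have "smooth_on ?I (\<lambda>s. (x \<circ> \<phi>) (G (s, t0)))"
    proof (rule smooth_on_compose[OF _ open_V _ _ smX])
      have "smooth_on ?I (\<lambda>s. (s, t0))"
        by (intro smooth_on_Pair smooth_on_linear smooth_on_const bounded_linear_ident) auto
      then show "smooth_on ?I (\<lambda>s. G (s, t0))"
        by (intro smooth_on_compose[OF _ oD _ _ smG]) (use t0B in auto)
      show "(\<lambda>s. G (s, t0)) ` ?I \<subseteq> V" using GV(1) t0B by auto
    qed auto
    then have "smooth_on ?I (\<alpha> i)" for i
      unfolding \<alpha>_def by (intro smooth_on_mult smooth_on_const smooth_on_ip smooth_on_diff) auto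
    moreover have "x ((\<phi> \<circ> G) (s, t)) = x (\<Theta> t) + \<alpha> 1 s *\<^sub>R \<xi> 1 t + \<alpha> 2 s *\<^sub>R \<xi> 2 t + \<alpha> 3 s *\<^sub>R \<xi> 3 t"
      if s: "s \<in> ?I" and t: "t \<in> ?B" for s t
    proof -
      define A where "A = ip c ((x \<circ> \<phi>) (G (s, t0))) ((e\<^sub>1 \<circ> \<phi>) (\<beta> t0))"
      define B where "B = ip c ((x \<circ> \<phi>) (G (s, t0))) ((N \<circ> \<phi>) (\<beta> t0))"
      define C where "C = c * ip c ((x \<circ> \<phi>) (G (s, t0))) ((x \<circ> \<phi>) (\<beta> t0))"
      note XG' = XG[OF s, folded A_def B_def C_def]
      \<comment> \<open>The displacement has the same coefficients A, B, C - 1 in the frames at t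
        and at t0. Each frame vector has the same coordinates in \<xi> at both points, hence so does
        the displacement.\<close>
      have diff: "(x \<circ> \<phi>) (G (s, t)) - (x \<circ> \<phi>) (\<beta> t)
          = A *\<^sub>R (e\<^sub>1 \<circ> \<phi>) (\<beta> t) + B *\<^sub>R (N \<circ> \<phi>) (\<beta> t) + (C - 1) *\<^sub>R (x \<circ> \<phi>) (\<beta> t)"
        if "t \<in> ?B" for t
        unfolding XG'[OF that] by (simp add: algebra_simps del: o_apply)
      have "(x \<circ> \<phi>) (G (s, t)) - (x \<circ> \<phi>) (\<beta> t)
          = A *\<^sub>R (e\<^sub>1 \<circ> \<phi>) (\<beta> t) + B *\<^sub>R (N \<circ> \<phi>) (\<beta> t) + (C - 1) *\<^sub>R (x \<circ> \<phi>) (\<beta> t)"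
        by (rule diff[OF t])
      also have "\<dots> = (\<Sum>i\<in>UNIV. (\<epsilon> i * ip c (A *\<^sub>R (e\<^sub>1 \<circ> \<phi>) (\<beta> t0) + B *\<^sub>R (N \<circ> \<phi>) (\<beta> t0)
          + (C - 1) *\<^sub>R (x \<circ> \<phi>) (\<beta> t0)) (\<xi> i t0)) *\<^sub>R \<xi> i t)"
        unfolding ex_e[OF t] ex_N[OF t] ex_X[OF t]
        by (simp add: scaleR_sum_right sum.distrib[symmetric] ip_simps algebra_simps del: o_apply)
      also have "A *\<^sub>R (e\<^sub>1 \<circ> \<phi>) (\<beta> t0) + B *\<^sub>R (N \<circ> \<phi>) (\<beta> t0) + (C - 1) *\<^sub>R (x \<circ> \<phi>) (\<beta> t0)
          = (x \<circ> \<phi>) (G (s, t0)) - (x \<circ> \<phi>) (\<beta> t0)"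
        by (rule diff[OF t0B, symmetric])
      finally have "(x \<circ> \<phi>) (G (s, t)) - (x \<circ> \<phi>) (\<beta> t) = (\<Sum>i\<in>UNIV. \<alpha> i s *\<^sub>R \<xi> i t)"
        by (simp only: \<alpha>_def)
      then show ?thesis
        using \<beta>(2)[OF BT(1)[OF t]] by (simp add: sum_3 algebra_simps)
    qed
    ultimately show ?thesis by (intro exI[of _ \<alpha>]) blast
  qed
  show ?thesis
  proof (intro exI[of _ W] conjI W mW allI impI)
    fix \<xi> assume "parallel_orthonormal_normal_base c L x U \<Theta> \<xi>"
    from expand[OF this] obtain \<alpha> :: "3 \<Rightarrow> real \<Rightarrow> real" where \<alpha>: "\<forall>i. smooth_on ?I (\<alpha> i)"
      "\<forall>s\<in>?I. \<forall>t\<in>?B. x ((\<phi> \<circ> G) (s, t)) =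
        x (\<Theta> t) + \<alpha> 1 s *\<^sub>R \<xi> 1 t + \<alpha> 2 s *\<^sub>R \<xi> 2 t + \<alpha> 3 s *\<^sub>R \<xi> 3 t" by blast
    show "\<exists>a b U' \<psi> (\<alpha> :: 3 \<Rightarrow> real \<Rightarrow> real).
         U' \<subseteq> U \<and>
         local_param M x ({a<..<b} \<times> U') \<psi> \<and> \<psi> ` ({a<..<b} \<times> U') = W \<and>
         (\<forall>i. smooth_on {a<..<b} (\<alpha> i)) \<and>
         (\<forall>s\<in>{a<..<b}. \<forall>t\<in>U'. x (\<psi> (s, t)) =
            x (\<Theta> t) + \<alpha> 1 s *\<^sub>R \<xi> 1 t + \<alpha> 2 s *\<^sub>R \<xi> 2 t + \<alpha> 3 s *\<^sub>R \<xi> 3 t) \<and>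
         (\<forall>t\<in>U'. integral_curve M x e\<^sub>1 {a<..<b} (\<lambda>s. \<psi> (s, t)))"
    proof (intro exI conjI)
      show "?B \<subseteq> U" using r T by blast
      show "local_param M x (?I \<times> ?B) (\<phi> \<circ> G)" by (rule lp\<psi>)
      show "(\<phi> \<circ> G) ` (?I \<times> ?B) = W" by (simp only: W_def)
      show "\<forall>i. smooth_on ?I (\<alpha> i)" by (rule \<alpha>)
      show "\<forall>s\<in>?I. \<forall>t\<in>?B. x ((\<phi> \<circ> G) (s, t)) =
        x (\<Theta> t) + \<alpha> 1 s *\<^sub>R \<xi> 1 t + \<alpha> 2 s *\<^sub>R \<xi> 2 t + \<alpha> 3 s *\<^sub>R \<xi> 3 t" by (rule \<alpha>)
      show "\<forall>t\<in>?B. integral_curve M x e\<^sub>1 ?I (\<lambda>s. (\<phi> \<circ> G) (s, t))" using curves by blast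
    qed
  qed
qed

end
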